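(* Let $D$ be the selfadjoint operator on $\mathcal{H}$ with $D|j\mu n\uparrow\rangle=d_j^\uparrow|j\mu n\uparrow\rangle$, $D|j\mu n\downarrow\rangle=d_j^\downarrow|j\mu n\downarrow\rangle$, where $d_j^\uparrow=c_1^\uparrow j+c_2^\uparrow$, $d_j^\downarrow=c_1^\downarrow j+c_2^\downarrow$ with real constants satisfying $c_1^\uparrow\ne0$, $c_1^\downarrow=-c_1^\uparrow$, $c_2^\downarrow=-c_2^\uparrow+c_1^\uparrow$. Then the real spectral triple $(\mathcal{A}(SU_q(2)),\mathcal{H},D,J)$, with $\mathcal{A}(SU_q(2))$ acting on $\mathcal{H}$ via the spinor representation $\pi'$, satisfies both the commutant property and the first order condition up to infinitesimals: $$[\pi'^{\circ}(x),\pi'(y)]\in\mathcal{K}_q,\qquad [\pi'^{\circ}(x),[D,\pi'(y)]]\in\mathcal{K}_q,\qquad\text{for all }x,y\in\mathcal{A}(SU_q(2)).$$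
   Context: Fix a real number $q$ with $0<q<1$ and put $[n]=\frac{q^n-q^{-n}}{q-q^{-1}}$. $\mathcal{A}=\mathcal{A}(SU_q(2))$ is the unital complex $*$-algebra generated by $a,b$ with relations $ba=qab$, $b^*a=qab^*$, $bb^*=b^*b$, $a^*a+q^2b^*b=1$, $aa^*+bb^*=1$. For any index $x$ write $x^\pm=x\pm\frac12$. Let $\mathcal{H}_\psi$ be the Hilbert space with orthonormal basis $|lmn\rangle$, $l=0,\frac12,1,\frac32,\dots$, $m,n\in\{-l,-l+1,\dots,l\}$. The (left regular) $*$-representation $\pi$ of $\mathcal{A}$ on $\mathcal{H}_\psi$ is $$\pi(a)|lmn\rangle=A^+_{lmn}|l^+m^+n^+\rangle+A^-_{lmn}|l^-m^+n^+\rangle,\quad \pi(b)|lmn\rangle=B^+_{lmn}|l^+m^+n^-\rangle+B^-_{lmn}|l^-m^+n^-\rangle,$$ $$A^+_{lmn}=q^{(-2l+m+n-1)/2}\Big(\tfrac{[l+m+1][l+n+1]}{[2l+1][2l+2]}\Big)^{1/2},\quad A^-_{lmn}=q^{(2l+m+n+1)/2}\Big(\tfrac{[l-m][l-n]}{[2l][2l+1]}\Big)^{1/2},$$ $$B^+_{lmn}=q^{(m+n-1)/2}\Big(\tfrac{[l+m+1][l-n+1]}{[2l+1][2l+2]}\Big)^{1/2},\quad B^-_{lmn}=-q^{(m+n-1)/2}\Big(\tfrac{[l-m][l+n]}{[2l][2l+1]}\Big)^{1/2}$$ (terms with $l^-<0$ are absent). Let $\mathbb{C}^2$ have orthonormal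 basis $|\frac12,\pm\frac12\rangle$. The space of spinors is $\mathcal{H}=\mathcal{H}_\psi\otimes\mathbb{C}^2$, and $\pi'=\pi\otimes\mathrm{id}$. With $C_{j\mu}=q^{-(j+\mu)/2}\frac{[j-\mu]^{1/2}}{[2j]^{1/2}}$, $S_{j\mu}=q^{(j-\mu)/2}\frac{[j+\mu]^{1/2}}{[2j]^{1/2}}$, the orthonormal spinor basis of $\mathcal{H}$ is $$|j\mu n\downarrow\rangle=C_{j\mu}|j^-\mu^+n\rangle\otimes|\tfrac12,-\tfrac12\rangle+S_{j\mu}|j^-\mu^-n\rangle\otimes|\tfrac12,+\tfrac12\rangle$$ for $j=\frac12,1,\frac32,\dots$, $\mu=-j,\dots,j$, $n=-j^-,\dots,j^-$, and $$|j\mu n\uparrow\rangle=-S_{j+1,\mu}|j^+\mu^+n\rangle\otimes|\tfrac12,-\tfrac12\rangle+C_{j+1,\mu}|j^+\mu^-n\rangle\otimes|\tfrac12,+\tfrac12\rangle$$ for $j=0,\frac12,1,\dots$, $\mu=-j,\dots,j$, $n=-j^+,\dots,j^+$ (vectors with out-of-range indices occur with coefficient $0$). The real structure $J$ is the antiunitary operator on $\mathcal{H}$ given by $$J|j\mu n\uparrow\rangle=i^{2(2j+\mu+n)}|j,-\mu,-n,\uparrow\rangle,\qquad J|j\mu n\downarrow\rangle=i^{2(2j-\mu-n)}|j,-\mu,-n,\downarrow\rangle .$$ The right spinor antirepresentation is $\pi'^{\circ}(x)=J\pi'(x^* )J^{-1}$, $x\in\mathcal{A}$. $L_q$ is the positive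 trace-class operator with $L_q|j\mu n\uparrow\rangle=q^j|j\mu n\uparrow\rangle$, $L_q|j\mu n\downarrow\rangle=q^j|j\mu n\downarrow\rangle$, and $\mathcal{K}_q$ is the two-sided ideal of $\mathcal{B}(\mathcal{H})$ generated by $L_q$. $[D,\pi'(y)]$ denotes the bounded extension of the commutator. *)

theory Defs
  imports
    "HOL-Analysis.Analysis"
    "HOL-Library.Poly_Mapping"
    "HOL-Algebra.QuotRing"
begin

section \<open>The Hilbert space of square-summable families\<close>

typedef 'i ell2 = "{f :: 'i \<Rightarrow> complex. (\<lambda>i. (cmod (f i))\<^sup>2) summable_on UNIV}"
  morphisms coord Abs_ell2
  by (rule exI[of _ "\<lambda>_. 0"]) simp

setup_lifting type_definition_ell2

lemma coord_square_summable: "(\<lambda>i. (cmod (coord v i))\<^sup>2) summable_on UNIV"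
  using coord[of v] by simp

lemma ell2_eqI: "(\<And>i. coord v i = coord w i) \<Longrightarrow> v = w"
  by (metis coord_inject ext)

lemma square_summable_add:
  fixes f g :: "'i \<Rightarrow> complex"
  assumes "(\<lambda>i. (cmod (f i))\<^sup>2) summable_on A" "(\<lambda>i. (cmod (g i))\<^sup>2) summable_on A"
  shows "(\<lambda>i. (cmod (f i + g i))\<^sup>2) summable_on A"
proof (rule summable_on_comparison_test)
  show "(\<lambda>i. 2 * (cmod (f i))\<^sup>2 + 2 * (cmod (g i))\<^sup>2) summable_on A"
    by (intro summable_on_add summable_on_cmult_right assms)
next
  fix i
  have "(cmod (f i + g i))\<^sup>2 \<le> (cmod (f i) + cmod (g i))\<^sup>2"
    by (intro power_mono norm_triangle_ineq) auto
  also have "\<dots> \<le> 2 * (cmod (f i))\<^sup>2 + 2 * (cmod (g i))\<^sup>2"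
    using sum_squares_bound[of "cmod (f i)" "cmod (g i)"] by (simp add: power2_sum)
  finally show "(cmod (f i + g i))\<^sup>2 \<le> 2 * (cmod (f i))\<^sup>2 + 2 * (cmod (g i))\<^sup>2" .
qed auto

lemma square_summable_mult:
  fixes f :: "'i \<Rightarrow> complex"
  assumes "(\<lambda>i. (cmod (f i))\<^sup>2) summable_on A"
  shows "(\<lambda>i. (cmod (c * f i))\<^sup>2) summable_on A"
  using summable_on_cmult_right[OF assms, of "(cmod c)\<^sup>2"]
  by (simp add: norm_mult power_mult_distrib)

lemma square_summable_prod:
  fixes f g :: "'i \<Rightarrow> complex"
  assumes "(\<lambda>i. (cmod (f i))\<^sup>2) summable_on A" "(\<lambda>i. (cmod (g i))\<^sup>2) summable_on A"
  shows "(\<lambda>i. cnj (f i) * g i) summable_on A"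
proof -
  have "(\<lambda>i. cmod (cnj (f i) * g i)) summable_on A"
    by (rule abs_summable_product) (use assms in \<open>simp_all add: norm_mult power2_eq_square\<close>)
  thus ?thesis by (rule abs_summable_summable)
qed

instantiation ell2 :: (type) real_vector
begin
lift_definition zero_ell2 :: "'a ell2" is "\<lambda>_. 0" by simp
lift_definition plus_ell2 :: "'a ell2 \<Rightarrow> 'a ell2 \<Rightarrow> 'a ell2" is "\<lambda>f g i. f i + g i"
  by (rule square_summable_add)
lift_definition uminus_ell2 :: "'a ell2 \<Rightarrow> 'a ell2" is "\<lambda>f i. - f i" by simp
lift_definition minus_ell2 :: "'a ell2 \<Rightarrow> 'a ell2 \<Rightarrow> 'a ell2" is "\<lambda>f g i. f i - g i"
  subgoal for f g using square_summable_add[of f UNIV "\<lambda>i. - g i"] by simp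
  done
lift_definition scaleR_ell2 :: "real \<Rightarrow> 'a ell2 \<Rightarrow> 'a ell2" is "\<lambda>r f i. complex_of_real r * f i"
  by (rule square_summable_mult)
instance
  by standard (transfer; auto simp: algebra_simps)+
end

lift_definition scaleC :: "complex \<Rightarrow> 'i ell2 \<Rightarrow> 'i ell2" (infixr \<open>*\<^sub>C\<close> 75)
  is "\<lambda>c f i. c * f i"
  by (rule square_summable_mult)

definition cinner :: "'i ell2 \<Rightarrow> 'i ell2 \<Rightarrow> complex"
  where "cinner v w = (\<Sum>\<^sub>\<infinity>i. cnj (coord v i) * coord w i)"

lemma cinner_summable: "(\<lambda>i. cnj (coord v i) * coord w i) summable_on UNIV"
  by (intro square_summable_prod coord_square_summable)

lemma cinner_commute: "cinner v w = cnj (cinner w v)"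
  unfolding cinner_def
  by (simp flip: infsum_cnj add: mult.commute)

lemma cinner_add_left: "cinner (u + v) w = cinner u w + cinner v w"
  unfolding cinner_def
  by (simp flip: infsum_add[OF cinner_summable cinner_summable]
           add: plus_ell2.rep_eq ring_distribs)

lemma cinner_scaleR_left: "cinner (r *\<^sub>R v) w = complex_of_real r * cinner v w"
  unfolding cinner_def
  by (simp flip: infsum_cmult_right[OF cinner_summable]
           add: scaleR_ell2.rep_eq mult.assoc)

lemma cinner_self: "cinner v v = complex_of_real (\<Sum>\<^sub>\<infinity>i. (cmod (coord v i))\<^sup>2)"
proof -
  have "((\<lambda>i. complex_of_real ((cmod (coord v i))\<^sup>2)) has_sum
      complex_of_real (\<Sum>\<^sub>\<infinity>i. (cmod (coord v i))\<^sup>2)) UNIV"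
    by (intro has_sum_of_real has_sum_infsum coord_square_summable)
  moreover have "complex_of_real ((cmod (coord v i))\<^sup>2) = cnj (coord v i) * coord v i" for i
    by (simp only: complex_norm_square mult.commute)
  ultimately show ?thesis
    unfolding cinner_def by (simp add: infsumI)
qed

lemma cinner_self_eq_0:
  assumes "(\<Sum>\<^sub>\<infinity>i. (cmod (coord v i))\<^sup>2) = 0" shows "v = 0"
proof (rule ell2_eqI)
  fix i
  have "(cmod (coord v i))\<^sup>2 = 0"
    by (rule nonneg_infsum_le_0D[OF _ coord_square_summable]) (use assms in auto)
  thus "coord v i = coord 0 i" by (simp add: zero_ell2.rep_eq)
qed

instantiation ell2 :: (type) real_inner
begin
definition inner_ell2 :: "'a ell2 \<Rightarrow> 'a ell2 \<Rightarrow> real"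
  where "inner_ell2 v w = Re (cinner v w)"
definition norm_ell2 :: "'a ell2 \<Rightarrow> real" where "norm_ell2 v = sqrt (inner v v)"
definition dist_ell2 :: "'a ell2 \<Rightarrow> 'a ell2 \<Rightarrow> real" where "dist_ell2 v w = norm (v - w)"
definition sgn_ell2 :: "'a ell2 \<Rightarrow> 'a ell2" where "sgn_ell2 v = v /\<^sub>R norm v"
definition uniformity_ell2 :: "('a ell2 \<times> 'a ell2) filter"
  where "uniformity_ell2 = (INF e\<in>{0 <..}. principal {(x, y). dist x y < e})"
definition open_ell2 :: "'a ell2 set \<Rightarrow> bool"
  where "open_ell2 U \<longleftrightarrow> (\<forall>x\<in>U. eventually (\<lambda>(x', y). x' = x \<longrightarrow> y \<in> U) uniformity)"
instance
proof
  fix v w :: "'a ell2"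
  show "inner v w = inner w v"
    by (metis cinner_commute cnj.simps(1) inner_ell2_def)
  show "0 \<le> inner v v"
    by (simp add: inner_ell2_def cinner_self infsum_nonneg)
  show "inner v v = 0 \<longleftrightarrow> v = 0"
  proof
    assume "inner v v = 0"
    thus "v = 0" by (intro cinner_self_eq_0) (simp add: inner_ell2_def cinner_self)
  qed (simp add: inner_ell2_def cinner_self zero_ell2.rep_eq)
qed (simp_all add: inner_ell2_def norm_ell2_def dist_ell2_def sgn_ell2_def uniformity_ell2_def
       open_ell2_def cinner_add_left cinner_scaleR_left)
end

lemma norm_ell2_power2: "(norm v)\<^sup>2 = (\<Sum>\<^sub>\<infinity>i. (cmod (coord v i))\<^sup>2)" for v :: "'i ell2"
  by (simp add: power2_norm_eq_inner inner_ell2_def cinner_self)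

lemma sum_coord_le_norm:
  fixes v :: "'i ell2"
  assumes "finite F" shows "(\<Sum>i\<in>F. (cmod (coord v i))\<^sup>2) \<le> (norm v)\<^sup>2"
  unfolding norm_ell2_power2
  by (rule finite_sum_le_infsum) (use assms coord_square_summable in auto)

lemma coord_diff: "coord (v - w) i = coord v i - coord w i"
  by (simp add: minus_ell2.rep_eq)

lemma cmod_coord_le_norm: "cmod (coord v i) \<le> norm v" for v :: "'i ell2"
  using sum_coord_le_norm[of "{i}" v] by (simp add: power2_le_iff_abs_le)

instance ell2 :: (type) complete_space
proof
  fix X :: "nat \<Rightarrow> 'a ell2"
  assume X: "Cauchy X"
  have "Cauchy (\<lambda>n. coord (X n) i)" for i
  proof (rule metric_CauchyI)
    fix e :: real assume "0 < e"
    then obtain M where "\<forall>m\<ge>M. \<forall>n\<ge>M. dist (X m) (X n) < e"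
      using metric_CauchyD[OF X] by blast
    thus "\<exists>M. \<forall>m\<ge>M. \<forall>n\<ge>M. dist (coord (X m) i) (coord (X n) i) < e"
      by (metis cmod_coord_le_norm coord_diff dist_norm le_less_trans)
  qed
  hence conv: "convergent (\<lambda>n. coord (X n) i)" for i
    by (simp add: Cauchy_convergent_iff)
  define f where "f i = lim (\<lambda>n. coord (X n) i)" for i
  have f: "(\<lambda>n. coord (X n) i) \<longlonglongrightarrow> f i" for i
    unfolding f_def using conv by (simp add: convergent_LIMSEQ_iff)
  have tail: "\<exists>M. \<forall>n\<ge>M. \<forall>F. finite F \<longrightarrow> (\<Sum>i\<in>F. (cmod (coord (X n) i - f i))\<^sup>2) \<le> e\<^sup>2"
    if "0 < e" for e
  proof -
    obtain M where M: "\<And>m n. M \<le> m \<Longrightarrow> M \<le> n \<Longrightarrow> norm (X n - X m) < e"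
      using metric_CauchyD[OF X \<open>0 < e\<close>] by (metis dist_norm)
    have "(\<Sum>i\<in>F. (cmod (coord (X n) i - f i))\<^sup>2) \<le> e\<^sup>2" if "M \<le> n" "finite F" for n F
    proof (rule Lim_bounded)
      show "(\<lambda>m. \<Sum>i\<in>F. (cmod (coord (X n) i - coord (X m) i))\<^sup>2)
          \<longlonglongrightarrow> (\<Sum>i\<in>F. (cmod (coord (X n) i - f i))\<^sup>2)"
        by (intro tendsto_intros f)
      show "\<forall>m\<ge>M. (\<Sum>i\<in>F. (cmod (coord (X n) i - coord (X m) i))\<^sup>2) \<le> e\<^sup>2"
      proof (intro allI impI)
        fix m assume "M \<le> m"
        have "(\<Sum>i\<in>F. (cmod (coord (X n) i - coord (X m) i))\<^sup>2) \<le> (norm (X n - X m))\<^sup>2"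
          using sum_coord_le_norm[OF \<open>finite F\<close>, of "X n - X m"] by (simp add: coord_diff)
        also have "\<dots> \<le> e\<^sup>2"
          using M[OF \<open>M \<le> m\<close> \<open>M \<le> n\<close>] by (intro power_mono) auto
        finally show "(\<Sum>i\<in>F. (cmod (coord (X n) i - coord (X m) i))\<^sup>2) \<le> e\<^sup>2" .
      qed
    qed
    thus ?thesis by blast
  qed
  have diff_summable: "(\<lambda>i. (cmod (g i))\<^sup>2) summable_on UNIV"
    if "\<And>F. finite F \<Longrightarrow> (\<Sum>i\<in>F. (cmod (g i))\<^sup>2) \<le> e\<^sup>2" for g :: "'a \<Rightarrow> complex" and e :: real
    by (rule nonneg_bdd_above_summable_on) (use that in \<open>auto intro!: bdd_aboveI[of _ "e\<^sup>2"]\<close>)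
  obtain M where "\<forall>n\<ge>M. \<forall>F. finite F \<longrightarrow> (\<Sum>i\<in>F. (cmod (coord (X n) i - f i))\<^sup>2) \<le> 1\<^sup>2"
    using tail[of 1] by auto
  hence "(\<lambda>i. (cmod (coord (X M) i - f i))\<^sup>2) summable_on UNIV"
    by (intro diff_summable) blast
  hence "(\<lambda>i. (cmod (f i - coord (X M) i))\<^sup>2) summable_on UNIV"
    by (simp add: norm_minus_commute)
  from square_summable_add[OF this coord_square_summable[of "X M"]]
  have f_summable: "(\<lambda>i. (cmod (f i))\<^sup>2) summable_on UNIV" by simp
  define v where "v = Abs_ell2 f"
  have v: "coord v = f"
    unfolding v_def using f_summable by (simp add: Abs_ell2_inverse)
  have "X \<longlonglongrightarrow> v"
  proof (rule metric_LIMSEQ_I)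
    fix r :: real assume "0 < r"
    obtain M where M: "\<And>n F. M \<le> n \<Longrightarrow> finite F \<Longrightarrow>
        (\<Sum>i\<in>F. (cmod (coord (X n - v) i))\<^sup>2) \<le> (r / 2)\<^sup>2"
      using tail[of "r / 2"] \<open>0 < r\<close> by (auto simp: coord_diff v)
    have "norm (X n - v) < r" if "M \<le> n" for n
    proof -
      have "(norm (X n - v))\<^sup>2 \<le> (r / 2)\<^sup>2"
        unfolding norm_ell2_power2
        by (rule infsum_le_finite_sums[OF coord_square_summable]) (use M that in auto)
      hence "norm (X n - v) \<le> r / 2"
        using \<open>0 < r\<close> by (simp add: power2_le_iff_abs_le)
      thus ?thesis using \<open>0 < r\<close> by simp
    qed
    thus "\<exists>M. \<forall>n\<ge>M. dist (X n) v < r" by (auto simp: dist_norm)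
  qed
  thus "convergent X" by (auto simp: convergent_def)
qed

lift_definition basis_vec :: "'i \<Rightarrow> 'i ell2" is "\<lambda>k i. if i = k then 1 else 0"
proof -
  fix k :: 'i
  have "(\<lambda>i. (cmod (if i = k then 1 else 0))\<^sup>2) summable_on {k}" by simp
  thus "(\<lambda>i. (cmod (if i = k then 1 else 0))\<^sup>2) summable_on UNIV"
    by (subst summable_on_cong_neutral[of "{k}" UNIV _ "\<lambda>i. (cmod (if i = k then 1 else 0))\<^sup>2"]) auto
qed


section \<open>Operators\<close>

definition bounded_clinear :: "('i ell2 \<Rightarrow> 'i ell2) \<Rightarrow> bool"
  where "bounded_clinear T \<longleftrightarrow> bounded_linear T \<and> (\<forall>c v. T (c *\<^sub>C v) = c *\<^sub>C T v)"

definition antiunitary :: "('i ell2 \<Rightarrow> 'i ell2) \<Rightarrow> bool"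
  where "antiunitary J \<longleftrightarrow> bij J \<and> (\<forall>v w. J (v + w) = J v + J w) \<and>
    (\<forall>c v. J (c *\<^sub>C v) = cnj c *\<^sub>C J v) \<and> (\<forall>v w. cinner (J v) (J w) = cinner w v)"

definition positive_op :: "('i ell2 \<Rightarrow> 'i ell2) \<Rightarrow> bool"
  where "positive_op T \<longleftrightarrow> bounded_clinear T \<and> (\<forall>v. cinner v (T v) \<in> \<real>\<^sub>\<ge>\<^sub>0)"

text \<open>For positive operators the trace does not depend on the orthonormal basis, so that
  it may be computed in the standard one.\<close>

definition positive_trace_class :: "('i ell2 \<Rightarrow> 'i ell2) \<Rightarrow> bool"
  where "positive_trace_class T \<longleftrightarrow>
    positive_op T \<and> (\<lambda>i. cinner (basis_vec i) (T (basis_vec i))) summable_on UNIV"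

text \<open>An unbounded operator is a domain \<open>E\<close> with a function whose values off \<open>E\<close> are
  irrelevant.  The last conjunct says that its graph is that of its adjoint.\<close>

definition selfadjoint_on :: "'i ell2 set \<Rightarrow> ('i ell2 \<Rightarrow> 'i ell2) \<Rightarrow> bool"
  where "selfadjoint_on E D \<longleftrightarrow>
    0 \<in> E \<and> (\<forall>v\<in>E. \<forall>w\<in>E. v + w \<in> E \<and> D (v + w) = D v + D w) \<and>
    (\<forall>c. \<forall>v\<in>E. c *\<^sub>C v \<in> E \<and> D (c *\<^sub>C v) = c *\<^sub>C D v) \<and>
    closure E = UNIV \<and>
    (\<forall>v w. v \<in> E \<and> D v = w \<longleftrightarrow> (\<forall>u\<in>E. cinner (D u) v = cinner u w))"

definition commutator :: "('i ell2 \<Rightarrow> 'i ell2) \<Rightarrow> ('i ell2 \<Rightarrow> 'i ell2) \<Rightarrow> 'i ell2 \<Rightarrow> 'i ell2"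
  where "commutator S T v = S (T v) - T (S v)"

text \<open>\<open>T\<close> is the (unique, as \<open>E\<close> is dense) bounded extension of the commutator of the
  unbounded operator \<open>D\<close> with domain \<open>E\<close> and the bounded operator \<open>A\<close>.\<close>

definition bounded_commutator_ext ::
    "'i ell2 set \<Rightarrow> ('i ell2 \<Rightarrow> 'i ell2) \<Rightarrow> ('i ell2 \<Rightarrow> 'i ell2) \<Rightarrow> ('i ell2 \<Rightarrow> 'i ell2) \<Rightarrow> bool"
  where "bounded_commutator_ext E D A T \<longleftrightarrow>
    bounded_clinear T \<and> (\<forall>v\<in>E. A v \<in> E \<and> T v = commutator D A v)"

definition bounded_ops :: "('i ell2 \<Rightarrow> 'i ell2) ring"
  where "bounded_ops = \<lparr>carrier = {T. bounded_clinear T}, mult = (\<circ>), one = id,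
    zero = (\<lambda>_. 0), add = (\<lambda>S T v. S v + T v)\<rparr>"

lemma scaleC_zero_right: "c *\<^sub>C (0 :: 'i ell2) = 0"
  by transfer simp

lemma scaleC_add_right: "c *\<^sub>C (v + w :: 'i ell2) = c *\<^sub>C v + c *\<^sub>C w"
  by transfer (simp add: ring_distribs)

lemma scaleC_minus_right: "c *\<^sub>C (- v :: 'i ell2) = - (c *\<^sub>C v)"
  by transfer simp

lemma ring_bounded_ops: "ring (bounded_ops :: ('i ell2 \<Rightarrow> 'i ell2) ring)"
proof (rule ringI)
  show "abelian_group (bounded_ops :: ('i ell2 \<Rightarrow> 'i ell2) ring)"
  proof (rule abelian_groupI)
    fix T :: "'i ell2 \<Rightarrow> 'i ell2"
    assume "T \<in> carrier bounded_ops"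
    hence "(\<lambda>v. - T v) \<in> carrier bounded_ops \<and> (\<lambda>v. - T v) \<oplus>\<^bsub>bounded_ops\<^esub> T = \<zero>\<^bsub>bounded_ops\<^esub>"
      by (auto simp: bounded_ops_def bounded_clinear_def scaleC_minus_right
               intro: bounded_linear_minus)
    thus "\<exists>S\<in>carrier bounded_ops. S \<oplus>\<^bsub>bounded_ops\<^esub> T = \<zero>\<^bsub>bounded_ops\<^esub>" by blast
  qed (auto simp: bounded_ops_def bounded_clinear_def scaleC_add_right scaleC_zero_right
            fun_eq_iff algebra_simps intro: bounded_linear_add)
  show "Group.monoid (bounded_ops :: ('i ell2 \<Rightarrow> 'i ell2) ring)"
    by (rule monoidI)
      (auto simp: bounded_ops_def bounded_clinear_def o_def id_def
            intro: bounded_linear_compose bounded_linear_ident)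
qed (auto simp: bounded_ops_def bounded_clinear_def fun_eq_iff bounded_linear.linear linear_add)


section \<open>The $*$-algebra $\mathcal{A}(SU_q(2))$\<close>

text \<open>The free unital complex algebra on the four letters $a, a^*, b, b^*$ consists of the finitely
  supported functions on words, multiplied by convolution along concatenation.\<close>

datatype letter = La | La' | Lb | Lb'

datatype word = Word (letters: "letter list")

instantiation word :: monoid_add
begin
definition "0 = Word []"
definition "v + w = Word (letters v @ letters w)"
instance by standard (auto simp: zero_word_def plus_word_def)
end

type_synonym free_alg = "word \<Rightarrow>\<^sub>0 complex"

definition gen :: "letter \<Rightarrow> free_alg"
  where "gen x = Poly_Mapping.single (Word [x]) 1"

definition const :: "complex \<Rightarrow> free_alg"
  where "const c = Poly_Mapping.single 0 c"

fun letter_star :: "letter \<Rightarrow> letter" where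
  "letter_star La = La'" | "letter_star La' = La" | "letter_star Lb = Lb'" | "letter_star Lb' = Lb"

definition word_star :: "word \<Rightarrow> word"
  where "word_star w = Word (rev (map letter_star (letters w)))"

definition free_star :: "free_alg \<Rightarrow> free_alg"
  where "free_star f =
    (\<Sum>w\<in>Poly_Mapping.keys f. Poly_Mapping.single (word_star w) (cnj (Poly_Mapping.lookup f w)))"

definition free_ring :: "free_alg ring"
  where "free_ring = \<lparr>carrier = UNIV, mult = (*), one = 1, zero = 0, add = (+)\<rparr>"

lemma ring_free_ring: "ring free_ring"
proof (rule ringI)
  show "abelian_group free_ring"
    by (rule abelian_groupI)
      (auto simp: free_ring_def algebra_simps intro: exI[of _ "- x" for x])
  show "Group.monoid free_ring"
    by (rule monoidI) (auto simp: free_ring_def algebra_simps)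
qed (auto simp: free_ring_def algebra_simps)

definition suq2_relators :: "real \<Rightarrow> free_alg set"
  where "suq2_relators q =
   (let a = gen La; a' = gen La'; b = gen Lb; b' = gen Lb'; cq = const (complex_of_real q) in
    { b * a - cq * a * b,
      b' * a - cq * a * b',
      b * b' - b' * b,
      a' * a + cq * cq * b' * b - 1,
      a * a' + b * b' - 1 })"

text \<open>Adding the adjoints of the relators makes the ideal $*$-invariant.\<close>

definition suq2_ideal :: "real \<Rightarrow> free_alg set"
  where "suq2_ideal q = Idl\<^bsub>free_ring\<^esub> (suq2_relators q \<union> free_star ` suq2_relators q)"

definition suq2 :: "real \<Rightarrow> free_alg set ring"
  where "suq2 q = free_ring Quot suq2_ideal q"

definition suq2_class :: "real \<Rightarrow> free_alg \<Rightarrow> free_alg set"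
  where "suq2_class q f = suq2_ideal q +>\<^bsub>free_ring\<^esub> f"

definition suq2_star :: "free_alg set \<Rightarrow> free_alg set"
  where "suq2_star X = free_star ` X"

definition suq2_scale :: "real \<Rightarrow> complex \<Rightarrow> free_alg set \<Rightarrow> free_alg set"
  where "suq2_scale q c X = suq2_class q (const c) \<otimes>\<^bsub>suq2 q\<^esub> X"

definition star_representation :: "real \<Rightarrow> (free_alg set \<Rightarrow> 'i ell2 \<Rightarrow> 'i ell2) \<Rightarrow> bool"
  where "star_representation q rep \<longleftrightarrow>
    (\<forall>x\<in>carrier (suq2 q). bounded_clinear (rep x)) \<and>
    rep \<one>\<^bsub>suq2 q\<^esub> = id \<and>
    (\<forall>x\<in>carrier (suq2 q). \<forall>y\<in>carrier (suq2 q).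
       rep (x \<oplus>\<^bsub>suq2 q\<^esub> y) = (\<lambda>v. rep x v + rep y v) \<and>
       rep (x \<otimes>\<^bsub>suq2 q\<^esub> y) = rep x \<circ> rep y) \<and>
    (\<forall>c. \<forall>x\<in>carrier (suq2 q). rep (suq2_scale q c x) = (\<lambda>v. c *\<^sub>C rep x v)) \<and>
    (\<forall>x\<in>carrier (suq2 q). \<forall>v w. cinner (rep (suq2_star x) v) w = cinner v (rep x w))"


section \<open>The left regular representation\<close>

definition half_nats :: "real set"
  where "half_nats = {real k / 2 | k :: nat. True}"

definition steps :: "real \<Rightarrow> real set"
  where "steps l = {- l + real k | k :: nat. - l + real k \<le> l}"

typedef lmn = "{(l, m, n). l \<in> half_nats \<and> m \<in> steps l \<and> n \<in> steps l}"
proof -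
  have "(0 :: real) \<in> half_nats" by (auto simp: half_nats_def intro: exI[of _ 0])
  moreover have "(0 :: real) \<in> steps 0" by (auto simp: steps_def intro: exI[of _ 0])
  ultimately show ?thesis by auto
qed

type_synonym hpsi = "lmn ell2"

text \<open>Out-of-range indices give the zero vector.\<close>

definition ket :: "real \<Rightarrow> real \<Rightarrow> real \<Rightarrow> hpsi"
  where "ket l m n =
    (if l \<in> half_nats \<and> m \<in> steps l \<and> n \<in> steps l then basis_vec (Abs_lmn (l, m, n)) else 0)"

definition qnum :: "real \<Rightarrow> real \<Rightarrow> real"
  where "qnum q x = (q powr x - q powr (- x)) / (q - inverse q)"

definition A_plus :: "real \<Rightarrow> real \<Rightarrow> real \<Rightarrow> real \<Rightarrow> real" where
  "A_plus q l m n = q powr ((- 2 * l + m + n - 1) / 2) *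
     sqrt (qnum q (l + m + 1) * qnum q (l + n + 1) / (qnum q (2 * l + 1) * qnum q (2 * l + 2)))"

definition A_minus :: "real \<Rightarrow> real \<Rightarrow> real \<Rightarrow> real \<Rightarrow> real" where
  "A_minus q l m n = q powr ((2 * l + m + n + 1) / 2) *
     sqrt (qnum q (l - m) * qnum q (l - n) / (qnum q (2 * l) * qnum q (2 * l + 1)))"

definition B_plus :: "real \<Rightarrow> real \<Rightarrow> real \<Rightarrow> real \<Rightarrow> real" where
  "B_plus q l m n = q powr ((m + n - 1) / 2) *
     sqrt (qnum q (l + m + 1) * qnum q (l - n + 1) / (qnum q (2 * l + 1) * qnum q (2 * l + 2)))"

definition B_minus :: "real \<Rightarrow> real \<Rightarrow> real \<Rightarrow> real \<Rightarrow> real" where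
  "B_minus q l m n = - (q powr ((m + n - 1) / 2) *
     sqrt (qnum q (l - m) * qnum q (l + n) / (qnum q (2 * l) * qnum q (2 * l + 1))))"

definition left_regular :: "real \<Rightarrow> (free_alg set \<Rightarrow> hpsi \<Rightarrow> hpsi) \<Rightarrow> bool"
  where "left_regular q rep \<longleftrightarrow> star_representation q rep \<and>
    (\<forall>l\<in>half_nats. \<forall>m\<in>steps l. \<forall>n\<in>steps l.
       rep (suq2_class q (gen La)) (ket l m n) =
         A_plus q l m n *\<^sub>R ket (l + 1/2) (m + 1/2) (n + 1/2) +
         A_minus q l m n *\<^sub>R ket (l - 1/2) (m + 1/2) (n + 1/2) \<and>
       rep (suq2_class q (gen Lb)) (ket l m n) =
         B_plus q l m n *\<^sub>R ket (l + 1/2) (m + 1/2) (n - 1/2) +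
         B_minus q l m n *\<^sub>R ket (l - 1/2) (m + 1/2) (n - 1/2))"


section \<open>Spinors\<close>

text \<open>\<open>Minus\<close> and \<open>Plus\<close> label the basis vectors $|\frac12,-\frac12\rangle$ and
  $|\frac12,+\frac12\rangle$ of $\mathbb{C}^2$; the tensor product of two spaces of
  square-summable families is modelled on the product of the index sets.\<close>

datatype spin = Minus | Plus

type_synonym spinor = "(lmn \<times> spin) ell2"

lift_definition tensor_spin :: "'i ell2 \<Rightarrow> spin \<Rightarrow> ('i \<times> spin) ell2"  (infixl \<open>\<otimes>\<^sub>s\<close> 70)
  is "\<lambda>f s (i, t). if t = s then f i else 0"
proof -
  fix f :: "'i \<Rightarrow> complex" and s :: spin
  assume f: "(\<lambda>i. (cmod (f i))\<^sup>2) summable_on UNIV"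
  let ?g = "\<lambda>p. (cmod (case p of (i, t) \<Rightarrow> if t = s then f i else 0))\<^sup>2"
  have "?g summable_on range (\<lambda>i. (i, s))"
    using f by (subst summable_on_reindex) (auto simp: inj_on_def o_def)
  moreover have "?g summable_on range (\<lambda>i. (i, s)) \<longleftrightarrow> ?g summable_on UNIV"
    by (rule summable_on_cong_neutral) auto
  ultimately show "?g summable_on UNIV" by blast
qed

lift_definition spin_component :: "('i \<times> spin) ell2 \<Rightarrow> spin \<Rightarrow> 'i ell2"
  is "\<lambda>f s i. f (i, s)"
proof -
  fix f :: "'i \<times> spin \<Rightarrow> complex" and s :: spin
  assume "(\<lambda>p. (cmod (f p))\<^sup>2) summable_on UNIV"
  hence "(\<lambda>p. (cmod (f p))\<^sup>2) summable_on range (\<lambda>i. (i, s))"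
    by (rule summable_on_subset) auto
  thus "(\<lambda>i. (cmod (f (i, s)))\<^sup>2) summable_on UNIV"
    by (subst (asm) summable_on_reindex) (auto simp: inj_on_def o_def)
qed

definition tensor_id :: "('i ell2 \<Rightarrow> 'i ell2) \<Rightarrow> ('i \<times> spin) ell2 \<Rightarrow> ('i \<times> spin) ell2"
  where "tensor_id T v =
    T (spin_component v Minus) \<otimes>\<^sub>s Minus + T (spin_component v Plus) \<otimes>\<^sub>s Plus"

definition spinor_rep :: "(free_alg set \<Rightarrow> hpsi \<Rightarrow> hpsi) \<Rightarrow> free_alg set \<Rightarrow> spinor \<Rightarrow> spinor"
  where "spinor_rep rep x = tensor_id (rep x)"

definition C_coef :: "real \<Rightarrow> real \<Rightarrow> real \<Rightarrow> real" where
  "C_coef q j \<mu> = q powr (- (j + \<mu>) / 2) * (sqrt (qnum q (j - \<mu>)) / sqrt (qnum q (2 * j)))"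

definition S_coef :: "real \<Rightarrow> real \<Rightarrow> real \<Rightarrow> real" where
  "S_coef q j \<mu> = q powr ((j - \<mu>) / 2) * (sqrt (qnum q (j + \<mu>)) / sqrt (qnum q (2 * j)))"

definition ket_dn :: "real \<Rightarrow> real \<Rightarrow> real \<Rightarrow> real \<Rightarrow> spinor" where
  "ket_dn q j \<mu> n =
     C_coef q j \<mu> *\<^sub>R (ket (j - 1/2) (\<mu> + 1/2) n \<otimes>\<^sub>s Minus) +
     S_coef q j \<mu> *\<^sub>R (ket (j - 1/2) (\<mu> - 1/2) n \<otimes>\<^sub>s Plus)"

definition ket_up :: "real \<Rightarrow> real \<Rightarrow> real \<Rightarrow> real \<Rightarrow> spinor" where
  "ket_up q j \<mu> n =
     - S_coef q (j + 1) \<mu> *\<^sub>R (ket (j + 1/2) (\<mu> + 1/2) n \<otimes>\<^sub>s Minus) +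
     C_coef q (j + 1) \<mu> *\<^sub>R (ket (j + 1/2) (\<mu> - 1/2) n \<otimes>\<^sub>s Plus)"

definition up_index :: "(real \<times> real \<times> real) set" where
  "up_index = {(j, \<mu>, n). j \<in> half_nats \<and> \<mu> \<in> steps j \<and> n \<in> steps (j + 1/2)}"

definition dn_index :: "(real \<times> real \<times> real) set" where
  "dn_index = {(j, \<mu>, n). j \<in> half_nats \<and> 0 < j \<and> \<mu> \<in> steps j \<and> n \<in> steps (j - 1/2)}"

text \<open>On the index ranges both exponents of \<open>\<i>\<close> below are integers.\<close>

definition real_structure :: "real \<Rightarrow> (spinor \<Rightarrow> spinor) \<Rightarrow> bool"
  where "real_structure q J \<longleftrightarrow> antiunitary J \<and>
    (\<forall>(j, \<mu>, n)\<in>up_index.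
       J (ket_up q j \<mu> n) = (\<i> powi \<lfloor>2 * (2 * j + \<mu> + n)\<rfloor>) *\<^sub>C ket_up q j (- \<mu>) (- n)) \<and>
    (\<forall>(j, \<mu>, n)\<in>dn_index.
       J (ket_dn q j \<mu> n) = (\<i> powi \<lfloor>2 * (2 * j - \<mu> - n)\<rfloor>) *\<^sub>C ket_dn q j (- \<mu>) (- n))"

definition opposite_rep ::
    "(spinor \<Rightarrow> spinor) \<Rightarrow> (free_alg set \<Rightarrow> hpsi \<Rightarrow> hpsi) \<Rightarrow> free_alg set \<Rightarrow> spinor \<Rightarrow> spinor"
  where "opposite_rep J rep x = J \<circ> spinor_rep rep (suq2_star x) \<circ> inv_into UNIV J"

definition is_L_q :: "real \<Rightarrow> (spinor \<Rightarrow> spinor) \<Rightarrow> bool"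
  where "is_L_q q L \<longleftrightarrow> positive_trace_class L \<and>
    (\<forall>(j, \<mu>, n)\<in>up_index. L (ket_up q j \<mu> n) = (q powr j) *\<^sub>R ket_up q j \<mu> n) \<and>
    (\<forall>(j, \<mu>, n)\<in>dn_index. L (ket_dn q j \<mu> n) = (q powr j) *\<^sub>R ket_dn q j \<mu> n)"

definition dirac_operator ::
    "real \<Rightarrow> (real \<Rightarrow> real) \<Rightarrow> (real \<Rightarrow> real) \<Rightarrow> spinor set \<Rightarrow> (spinor \<Rightarrow> spinor) \<Rightarrow> bool"
  where "dirac_operator q d_up d_dn E D \<longleftrightarrow> selfadjoint_on E D \<and>
    (\<forall>(j, \<mu>, n)\<in>up_index.
       ket_up q j \<mu> n \<in> E \<and> D (ket_up q j \<mu> n) = d_up j *\<^sub>R ket_up q j \<mu> n) \<and>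
    (\<forall>(j, \<mu>, n)\<in>dn_index.
       ket_dn q j \<mu> n \<in> E \<and> D (ket_dn q j \<mu> n) = d_dn j *\<^sub>R ket_dn q j \<mu> n)"

end

theory Submission
  imports Defs
begin

text \<open>In the spinor basis, indexed by $N = 2j$, $x = j + \mu$ and $y = j \pm \frac12 + n$, the operators
  $\pi'(a)$ and $\pi'(b)$ are finite sums of weighted shifts.  Up to errors of order $q^N$ they
  preserve the arrows, and each weight is a product $\phi(x)\psi(y)$ in which $\phi$ tends to a
  constant at the rate $q^x$; when the shift moves the dual coordinate $N - x$, this constant is $0$,
  and likewise for $\psi$ and $y$.  Conjugation by $J$ exchanges $x$ with $N - x$ and $y$ with
  $N \pm 1 - y$.  Hence in a commutator $[\pi'^\circ(x), \pi'(y)]$ of generators the constants cancel,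
  and what remains is bounded by $q^x q^{N - x}$ or $q^y q^{N \pm 1 - y}$.  A weighted shift with weight $O(q^{N/2})$ lies in $\mathcal{K}_q$.  As $D$ is diagonal with
  eigenvalues linear in $j$ on each arrow, $[D, \pi'(y)]$ has the same form, its off-diagonal weights
  being of order $N q^N$.  The general case follows because $\mathcal{K}_q$ is an ideal and commutators
  are derivations.\<close>

section \<open>Bounded operators between spaces of square-summable families\<close>

text \<open>The basis is placed in the group Z^4 and set to 0 off its index set, so that every shift
  is a group translation and products, adjoints and commutators act on weights alone. The obstacle
  is the boundary: a product \<phi>(x)\<psi>(y) ignores the conditions x \<le> N and y \<le> N + s,
  and in a commutator one order of two shifts may be cut off there while the other is not. This is
  harmless: a shift that crosses the upper edge x = N changes N - x, so its factor tends to 0 and is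
  of order q^N near that edge, while at the lower edge x = 0 the factor is required to vanish
  exactly. The room for D is the gap between the errors q^N of the generators and the eigenvalue q^j
  = q^(N/2) of L, which absorbs a factor N. Leading weights carry a separate factor depending on the
  arrow, because [D, .] multiplies them by the slope of D on that arrow; such factors commute, since
  shifts with a nonzero leading weight preserve the arrow.\<close>

definition bounded_clin :: "('i ell2 \<Rightarrow> 'k ell2) \<Rightarrow> bool"
  where "bounded_clin T \<longleftrightarrow> bounded_linear T \<and> (\<forall>c v. T (c *\<^sub>C v) = c *\<^sub>C T v)"

text \<open>\<open>bounded_clinear\<close> knows a single index type, whereas
  \<open>analysis\<close> and \<open>synthesis\<close> below pass between families over different
  index types; hence the more general predicate.\<close>

lemma bounded_clinear_iff: "bounded_clinear T \<longleftrightarrow> bounded_clin T"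
  by (simp add: bounded_clinear_def bounded_clin_def)

lemma bounded_clin_linear: "bounded_clin T \<Longrightarrow> bounded_linear T"
  and bounded_clin_scaleC: "bounded_clin T \<Longrightarrow> T (c *\<^sub>C v) = c *\<^sub>C T v"
  by (auto simp: bounded_clin_def)

lemma bounded_clin_zero: "bounded_clin T \<Longrightarrow> T 0 = 0"
  and bounded_clin_add: "bounded_clin T \<Longrightarrow> T (v + w) = T v + T w"
  and bounded_clin_diff: "bounded_clin T \<Longrightarrow> T (v - w) = T v - T w"
  and bounded_clin_scaleR: "bounded_clin T \<Longrightarrow> T (r *\<^sub>R v) = r *\<^sub>R T v"
  and bounded_clin_sum: "bounded_clin T \<Longrightarrow> T (sum g A) = (\<Sum>i\<in>A. T (g i))"
  by (auto simp: bounded_clin_def linear_0 linear_add linear_diff linear_scale linear_sum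
        bounded_linear.linear)

lemma coord_add: "coord (v + w) i = coord v i + coord w i"
  by (simp add: plus_ell2.rep_eq)

lemma coord_scaleC: "coord (c *\<^sub>C v) i = c * coord v i"
  by (simp add: scaleC.rep_eq)

lemma coord_scaleR: "coord (r *\<^sub>R v) i = complex_of_real r * coord v i"
  by (simp add: scaleR_ell2.rep_eq)

lemma coord_zero: "coord 0 i = 0"
  by (simp add: zero_ell2.rep_eq)

lemma coord_sum: "coord (sum g A) i = (\<Sum>j\<in>A. coord (g j) i)"
  by (induction A rule: infinite_finite_induct) (auto simp: coord_zero coord_add)

lemma coord_basis_vec: "coord (basis_vec k) i = (if i = k then 1 else 0)"
  by (simp add: basis_vec.rep_eq)

lemma scaleR_eq_scaleC: "r *\<^sub>R v = complex_of_real r *\<^sub>C v"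
  by (rule ell2_eqI) (simp add: coord_scaleR coord_scaleC)

lemma scaleC_scaleC: "c *\<^sub>C d *\<^sub>C v = (c * d) *\<^sub>C v"
  by (rule ell2_eqI) (simp add: coord_scaleC)

lemma scaleC_one: "1 *\<^sub>C v = v"
  by (rule ell2_eqI) (simp add: coord_scaleC)

lemma scaleC_zero_left: "0 *\<^sub>C v = 0"
  by (rule ell2_eqI) (simp add: coord_scaleC coord_zero)

lemma scaleC_add_left: "(c + d) *\<^sub>C v = c *\<^sub>C v + d *\<^sub>C v"
  by (rule ell2_eqI) (simp add: coord_scaleC coord_add ring_distribs)

lemma scaleC_diff_right: "c *\<^sub>C (v - w) = c *\<^sub>C v - c *\<^sub>C w"
  by (rule ell2_eqI) (simp add: coord_scaleC coord_diff ring_distribs)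

lemma cinner_add_right: "cinner w (u + v) = cinner w u + cinner w v"
  by (metis cinner_add_left cinner_commute complex_cnj_add)

lemma cinner_scaleC_right: "cinner v (c *\<^sub>C w) = c * cinner v w"
  unfolding cinner_def
  by (simp add: coord_scaleC mult.left_commute flip: infsum_cmult_right[OF cinner_summable])

lemma cinner_scaleC_left: "cinner (c *\<^sub>C v) w = cnj c * cinner v w"
  by (metis cinner_commute cinner_scaleC_right complex_cnj_mult)

lemma cinner_scaleR_right: "cinner v (r *\<^sub>R w) = complex_of_real r * cinner v w"
  by (simp add: scaleR_eq_scaleC cinner_scaleC_right)

lemma cinner_zero_left: "cinner 0 v = 0" and cinner_zero_right: "cinner v 0 = 0"
  by (simp_all add: cinner_def coord_zero)

lemma cinner_minus_right: "cinner v (- w) = - cinner v w"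
  using cinner_scaleR_right[of v "-1" w] by simp

lemma cinner_diff_right: "cinner w (u - v) = cinner w u - cinner w v"
  using cinner_add_right[of w u "- v"] by (simp add: cinner_minus_right)

lemma cinner_diff_left: "cinner (u - v) w = cinner u w - cinner v w"
  by (metis cinner_diff_right cinner_commute complex_cnj_diff)

lemma cinner_sum_right: "cinner w (sum g A) = (\<Sum>j\<in>A. cinner w (g j))"
  by (induction A rule: infinite_finite_induct) (auto simp: cinner_zero_right cinner_add_right)

lemma cinner_sum_left: "cinner (sum g A) w = (\<Sum>j\<in>A. cinner (g j) w)"
  by (induction A rule: infinite_finite_induct) (auto simp: cinner_zero_left cinner_add_left)

lemma cinner_norm: "cinner v v = complex_of_real ((norm v)\<^sup>2)"
  by (simp add: cinner_self norm_ell2_power2)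

lemma cinner_basis_vec: "cinner (basis_vec i) v = coord v i"
proof -
  have "cinner (basis_vec i) v = (\<Sum>\<^sub>\<infinity>j\<in>{i}. coord v j)"
    unfolding cinner_def by (rule infsum_cong_neutral) (auto simp: coord_basis_vec)
  thus ?thesis by simp
qed

lemma cnj_mult_self: "cnj z * z = complex_of_real ((cmod z)\<^sup>2)"
  by (metis complex_norm_square mult.commute)

lemma norm_scaleC: "norm (c *\<^sub>C v) = cmod c * norm v"
proof -
  have "complex_of_real ((norm (c *\<^sub>C v))\<^sup>2) = complex_of_real ((cmod c * norm v)\<^sup>2)"
    unfolding cinner_norm[symmetric] cinner_scaleC_left cinner_scaleC_right
    unfolding cinner_norm mult.assoc[symmetric] of_real_mult power_mult_distrib
    by (simp add: complex_norm_square mult.commute del: of_real_power)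
  hence "(norm (c *\<^sub>C v))\<^sup>2 = (cmod c * norm v)\<^sup>2" by (simp only: of_real_eq_iff)
  thus ?thesis by (simp add: power2_eq_iff_nonneg)
qed

text \<open>The inner product of the class is only the real part of \<open>cinner\<close>. A phase
  turns \<open>cinner v w\<close> onto the positive axis, where the real Cauchy-Schwarz inequality
  applies.\<close>

lemma cmod_cinner_le: "cmod (cinner v w) \<le> norm v * norm w"
proof (cases "cinner v w = 0")
  case False
  define c where "c = cnj (cinner v w) / cmod (cinner v w)"
  have "cinner v w * c = complex_of_real ((cmod (cinner v w))\<^sup>2) / complex_of_real (cmod (cinner v w))"
    by (simp only: c_def complex_norm_square times_divide_eq_right)
  hence *: "c * cinner v w = of_real (cmod (cinner v w))"
    using False by (simp add: power2_eq_square mult.commute)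
  hence "cmod (cinner v w) = Re (cinner v (c *\<^sub>C w))" by (simp add: cinner_scaleC_right)
  also have "\<dots> \<le> norm v * norm (c *\<^sub>C w)"
    using norm_cauchy_schwarz[of v "c *\<^sub>C w"] by (simp add: inner_ell2_def)
  also have "cmod c = 1" using False by (simp add: c_def norm_divide)
  hence "norm (c *\<^sub>C w) = norm w" by (simp add: norm_scaleC)
  finally show ?thesis .
qed auto

lemma bounded_clinI:
  assumes "\<And>v w. T (v + w) = T v + T w" "\<And>c v. T (c *\<^sub>C v) = c *\<^sub>C T v"
    "\<And>v. norm (T v) \<le> K * norm v"
  shows "bounded_clin T"
  unfolding bounded_clin_def
  using assms by (auto intro!: bounded_linear_intro[of _ K] simp: scaleR_eq_scaleC mult.commute)

lemma bounded_clin_compose: "bounded_clin S \<Longrightarrow> bounded_clin T \<Longrightarrow> bounded_clin (\<lambda>v. S (T v))"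
  unfolding bounded_clin_def by (auto intro: bounded_linear_compose)

lemma bounded_clin_plus: "bounded_clin S \<Longrightarrow> bounded_clin T \<Longrightarrow> bounded_clin (\<lambda>v. S v + T v)"
  unfolding bounded_clin_def by (auto intro: bounded_linear_add simp: scaleC_add_right)

lemma bounded_clin_minus: "bounded_clin S \<Longrightarrow> bounded_clin T \<Longrightarrow> bounded_clin (\<lambda>v. S v - T v)"
  unfolding bounded_clin_def by (auto intro: bounded_linear_sub simp: scaleC_diff_right)

lemma bounded_clin_id: "bounded_clin (\<lambda>v. v)"
  unfolding bounded_clin_def by (auto intro: bounded_linear_ident)

lemma bounded_clin_const_zero: "bounded_clin (\<lambda>v. 0)"
  unfolding bounded_clin_def by (auto simp: scaleC_zero_right)

lemma bounded_clin_scaleC_comp: "bounded_clin T \<Longrightarrow> bounded_clin (\<lambda>v. c *\<^sub>C T v)"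
proof (rule bounded_clinI[where K = "cmod c * onorm T"])
  fix v assume T: "bounded_clin T"
  show "norm (c *\<^sub>C T v) \<le> cmod c * onorm T * norm v"
    using onorm[OF bounded_clin_linear[OF T], of v]
    by (simp add: norm_scaleC mult.assoc mult_left_mono)
qed (auto simp: bounded_clin_add bounded_clin_scaleC scaleC_add_right scaleC_scaleC mult.commute)

section \<open>Density of the finitely supported vectors\<close>

lemma truncation_close:
  assumes "0 < \<epsilon>"
  shows "\<exists>F. finite F \<and> norm (v - (\<Sum>i\<in>F. coord v i *\<^sub>C basis_vec i)) < \<epsilon>"
proof -
  have "((\<lambda>i. (cmod (coord v i))\<^sup>2) has_sum (norm v)\<^sup>2) UNIV"
    unfolding norm_ell2_power2 by (rule has_sum_infsum[OF coord_square_summable])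
  hence "\<forall>\<^sub>F F in finite_subsets_at_top UNIV.
      dist (\<Sum>i\<in>F. (cmod (coord v i))\<^sup>2) ((norm v)\<^sup>2) < \<epsilon>\<^sup>2"
    unfolding has_sum_def by (rule tendstoD) (use assms in simp)
  then obtain F where F: "finite F" "dist (\<Sum>i\<in>F. (cmod (coord v i))\<^sup>2) ((norm v)\<^sup>2) < \<epsilon>\<^sup>2"
    unfolding eventually_finite_subsets_at_top by auto
  define u where "u = (\<Sum>i\<in>F. coord v i *\<^sub>C basis_vec i)"
  have u: "cinner u w = (\<Sum>i\<in>F. cnj (coord v i) * coord w i)" for w
    unfolding u_def cinner_sum_left cinner_scaleC_left cinner_basis_vec ..
  have cu: "coord u i = (if i \<in> F then coord v i else 0)" for i
  proof -
    have "coord u i = (\<Sum>j\<in>F. if j = i then coord v i else 0)"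
      unfolding u_def coord_sum coord_scaleC coord_basis_vec by (rule sum.cong) auto
    thus ?thesis using F by simp
  qed
  have uv: "cinner u v = of_real (\<Sum>i\<in>F. (cmod (coord v i))\<^sup>2)"
    unfolding u of_real_sum cnj_mult_self ..
  have uu: "cinner u u = of_real (\<Sum>i\<in>F. (cmod (coord v i))\<^sup>2)"
    unfolding u cu of_real_sum by (rule sum.cong) (simp_all add: cnj_mult_self)
  \<comment> \<open>\<open>u\<close> is the orthogonal projection of \<open>v\<close> to the
    coordinates in \<open>F\<close>, so the squared distance is the tail of the sum of
    squares.\<close>
  have "complex_of_real ((norm (v - u))\<^sup>2) =
      of_real ((norm v)\<^sup>2 - (\<Sum>i\<in>F. (cmod (coord v i))\<^sup>2))"
    unfolding cinner_norm[symmetric] cinner_diff_left cinner_diff_right uu uv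
      cinner_commute[of v u]
    by (simp add: cinner_norm)
  hence "(norm (v - u))\<^sup>2 = (norm v)\<^sup>2 - (\<Sum>i\<in>F. (cmod (coord v i))\<^sup>2)"
    by (simp only: of_real_eq_iff)
  hence "(norm (v - u))\<^sup>2 < \<epsilon>\<^sup>2" using F(2) by (simp add: dist_real_def)
  hence "norm (v - u) < \<epsilon>" using assms by (simp add: power2_less_imp_less)
  thus ?thesis using F(1) unfolding u_def by blast
qed

lemma bounded_clin_eq_zero:
  assumes T: "bounded_clin T" and "\<And>i. T (basis_vec i) = 0"
  shows "T v = 0"
proof -
  obtain K where K: "0 < K" "\<And>u. norm (T u) \<le> norm u * K"
    using bounded_linear.pos_bounded[OF bounded_clin_linear[OF T]] by blast
  have "norm (T v) \<le> \<epsilon>" if \<epsilon>: "0 < \<epsilon>" for \<epsilon>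
  proof -
    obtain F where F: "finite F" "norm (v - (\<Sum>i\<in>F. coord v i *\<^sub>C basis_vec i)) < \<epsilon> / K"
      using truncation_close[of "\<epsilon> / K" v] \<epsilon> K by auto
    have "T v = T (v - (\<Sum>i\<in>F. coord v i *\<^sub>C basis_vec i))"
      using T assms(2) by (simp add: bounded_clin_diff bounded_clin_sum bounded_clin_scaleC
          scaleC_zero_right)
    hence "norm (T v) \<le> norm (v - (\<Sum>i\<in>F. coord v i *\<^sub>C basis_vec i)) * K" using K(2) by metis
    also have "\<dots> \<le> \<epsilon> / K * K" using F(2) K(1) by (intro mult_right_mono) auto
    finally show ?thesis using K(1) by simp
  qed
  hence "norm (T v) \<le> 0" by (metis dense_ge)
  thus ?thesis by simp
qed

lemma bounded_clin_eqI:
  assumes "bounded_clin S" "bounded_clin T" "\<And>i. S (basis_vec i) = T (basis_vec i)"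
  shows "S = T"
proof
  fix v
  have "S v - T v = 0"
    by (rule bounded_clin_eq_zero[OF bounded_clin_minus]) (use assms in auto)
  thus "S v = T v" by simp
qed

text \<open>\<open>Abs_ell2\<close> is unspecified off the square-summable families, so the
  coordinates of \<open>Abs_ell2 f\<close> are available only along with a bound on the finite
  sums.\<close>

lemma bounded_square_sums:
  assumes "\<And>F. finite F \<Longrightarrow> (\<Sum>i\<in>F. (cmod (f i))\<^sup>2) \<le> B\<^sup>2" "0 \<le> B"
  shows "(\<lambda>i. (cmod (f i))\<^sup>2) summable_on UNIV" "norm (Abs_ell2 f) \<le> B" "coord (Abs_ell2 f) = f"
proof -
  show s: "(\<lambda>i. (cmod (f i))\<^sup>2) summable_on UNIV"
    by (rule nonneg_bdd_above_summable_on) (use assms in \<open>auto intro!: bdd_aboveI[of _ "B\<^sup>2"]\<close>)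
  show c: "coord (Abs_ell2 f) = f" using s by (simp add: Abs_ell2_inverse)
  have "(norm (Abs_ell2 f))\<^sup>2 \<le> B\<^sup>2"
    unfolding norm_ell2_power2 c by (rule infsum_le_finite_sums[OF s]) (use assms in auto)
  thus "norm (Abs_ell2 f) \<le> B" using assms(2) by (simp add: power2_le_iff_abs_le)
qed

section \<open>Adjoints\<close>

definition adj :: "('i ell2 \<Rightarrow> 'k ell2) \<Rightarrow> 'k ell2 \<Rightarrow> 'i ell2"
  where "adj T w = Abs_ell2 (\<lambda>i. cinner (T (basis_vec i)) w)"

lemma
  assumes T: "bounded_clin T"
  shows coord_adj: "coord (adj T w) i = cinner (T (basis_vec i)) w"
    and norm_adj_le: "norm (adj T w) \<le> onorm T * norm w"
proof -
  note bl = bounded_clin_linear[OF T]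
  have "(\<Sum>i\<in>F. (cmod (cinner (T (basis_vec i)) w))\<^sup>2) \<le> (onorm T * norm w)\<^sup>2" if "finite F" for F
  proof -
    define s where "s = (\<Sum>i\<in>F. (cmod (cinner (T (basis_vec i)) w))\<^sup>2)"
    \<comment> \<open>The truncation to \<open>F\<close> of the vector that is to become the adjoint
      at \<open>w\<close>. Testing \<open>T\<close> on it gives |u|^2 = <T u, w> \<le>
      \<open>onorm T\<close> |u| |w|, and one factor |u| cancels.\<close>
    define u where "u = (\<Sum>i\<in>F. cinner (T (basis_vec i)) w *\<^sub>C basis_vec i)"
    have cu: "coord u i = (if i \<in> F then cinner (T (basis_vec i)) w else 0)" for i
    proof -
      have "coord u i = (\<Sum>j\<in>F. if j = i then cinner (T (basis_vec i)) w else 0)"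
        unfolding u_def coord_sum coord_scaleC coord_basis_vec by (rule sum.cong) auto
      thus ?thesis using that by simp
    qed
    have cu': "cinner u u' = (\<Sum>i\<in>F. cnj (cinner (T (basis_vec i)) w) * coord u' i)" for u'
      unfolding u_def cinner_sum_left cinner_scaleC_left cinner_basis_vec ..
    have "cinner u u = of_real s"
      unfolding cu' cu s_def of_real_sum by (rule sum.cong) (simp_all add: cnj_mult_self)
    hence nu: "(norm u)\<^sup>2 = s" unfolding cinner_norm by (simp only: of_real_eq_iff)
    have "cinner (T u) w = of_real s"
      unfolding u_def s_def bounded_clin_sum[OF T] bounded_clin_scaleC[OF T] cinner_sum_left
        cinner_scaleC_left of_real_sum cnj_mult_self ..
    hence "cmod (cinner (T u) w) = \<bar>s\<bar>" by (simp only: norm_of_real)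
    hence "s = cmod (cinner (T u) w)" unfolding s_def by (simp add: sum_nonneg)
    also have "\<dots> \<le> norm (T u) * norm w" by (rule cmod_cinner_le)
    also have "\<dots> \<le> onorm T * norm u * norm w"
      by (intro mult_right_mono onorm[OF bl]) auto
    finally have "(norm u)\<^sup>2 \<le> (onorm T * norm w) * norm u" using nu by (simp add: mult_ac)
    hence "norm u \<le> onorm T * norm w"
      using onorm_pos_le[OF bl] by (cases "norm u = 0") (auto simp: power2_eq_square)
    hence "(norm u)\<^sup>2 \<le> (onorm T * norm w)\<^sup>2" by (intro power_mono) auto
    thus ?thesis using nu unfolding s_def by simp
  qed
  note b = bounded_square_sums[OF this]
  show "coord (adj T w) i = cinner (T (basis_vec i)) w" "norm (adj T w) \<le> onorm T * norm w"
    unfolding adj_def using b(2,3) onorm_pos_le[OF bl] by (auto simp: fun_eq_iff)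
qed

lemma bounded_clin_adj: "bounded_clin T \<Longrightarrow> bounded_clin (adj T)"
  by (rule bounded_clinI[where K = "onorm T"])
    (auto intro!: ell2_eqI
      simp: coord_adj coord_add cinner_add_right coord_scaleC cinner_scaleC_right norm_adj_le)

lemma cinner_adj_left:
  assumes T: "bounded_clin T" shows "cinner (adj T w) u = cinner w (T u)"
proof (cases "w = 0")
  case True
  thus ?thesis using bounded_clin_zero[OF bounded_clin_adj[OF T]] by (simp add: cinner_zero_left)
next
  case False
  \<comment> \<open>as functions of \<open>u\<close>, both sides times a unit vector are bounded operators\<close>
  let ?S = "\<lambda>u. cinner (adj T w) u *\<^sub>C w" and ?R = "\<lambda>u. cinner w (T u) *\<^sub>C w"
  have "?S = ?R"
  proof (rule bounded_clin_eqI)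
    show "bounded_clin ?S"
    proof (rule bounded_clinI[where K = "norm (adj T w) * norm w"])
      fix v show "norm (cinner (adj T w) v *\<^sub>C w) \<le> norm (adj T w) * norm w * norm v"
        using mult_right_mono[OF cmod_cinner_le[of "adj T w" v], of "norm w"]
        by (simp add: norm_scaleC mult_ac)
    qed (auto simp: cinner_add_right cinner_scaleC_right scaleC_add_left scaleC_scaleC)
    show "bounded_clin ?R"
    proof (rule bounded_clinI[where K = "norm w * onorm T * norm w"])
      fix v
      have "cmod (cinner w (T v)) \<le> norm w * (onorm T * norm v)"
        by (rule order_trans[OF cmod_cinner_le])
          (intro mult_left_mono onorm bounded_clin_linear T, simp)
      from mult_right_mono[OF this, of "norm w"]
      show "norm (cinner w (T v) *\<^sub>C w) \<le> norm w * onorm T * norm w * norm v"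
        by (simp add: norm_scaleC mult_ac)
    qed (auto simp: cinner_add_right cinner_scaleC_right scaleC_add_left scaleC_scaleC
        bounded_clin_add[OF T] bounded_clin_scaleC[OF T])
  next
    fix i
    have "cinner (adj T w) (basis_vec i) = cinner w (T (basis_vec i))"
      by (metis cinner_basis_vec cinner_commute coord_adj[OF T])
    thus "cinner (adj T w) (basis_vec i) *\<^sub>C w = cinner w (T (basis_vec i)) *\<^sub>C w" by simp
  qed
  hence "cinner w (cinner (adj T w) u *\<^sub>C w) = cinner w (cinner w (T u) *\<^sub>C w)" by metis
  thus ?thesis using False by (simp add: cinner_scaleC_right cinner_norm)
qed

lemma cinner_adj_right: "bounded_clin T \<Longrightarrow> cinner u (adj T w) = cinner (T u) w"
  by (metis cinner_adj_left cinner_commute)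

section \<open>Weighted shifts of an orthonormal basis\<close>

text \<open>The basis is indexed by a subset \<open>V\<close> of a group and extended by zero, so that every
  translation of the group shifts it.\<close>

locale shift_basis =
  fixes e :: "'g::ab_group_add \<Rightarrow> 'k ell2" and V :: "'g set"
  assumes ortho: "cinner (e i) (e j) = (if i = j \<and> i \<in> V then 1 else 0)"
    and total: "(\<And>i. i \<in> V \<Longrightarrow> cinner (e i) v = 0) \<Longrightarrow> v = 0"
begin

lemma e_outside: "i \<notin> V \<Longrightarrow> e i = 0"
  using cinner_norm[of "e i"] by (simp add: ortho)

lemma eq_by_cinner: "(\<And>i. i \<in> V \<Longrightarrow> cinner (e i) v = cinner (e i) w) \<Longrightarrow> v = w"
  using total[of "v - w"] by (simp add: cinner_diff_right)

section \<open>Bessel's inequality and expansion in the basis\<close>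

definition analysis :: "'k ell2 \<Rightarrow> 'g ell2"
  where "analysis v = Abs_ell2 (\<lambda>i. cinner (e i) v)"

lemma
  shows coord_analysis: "coord (analysis v) i = cinner (e i) v"
    and norm_analysis_le: "norm (analysis v) \<le> norm v"
proof -
  have "(\<Sum>i\<in>F. (cmod (cinner (e i) v))\<^sup>2) \<le> (norm v)\<^sup>2" if "finite F" for F
  proof -
    define s where "s = (\<Sum>i\<in>F. (cmod (cinner (e i) v))\<^sup>2)"
    \<comment> \<open>The projection of \<open>v\<close> to the span of the \<open>e i\<close> with
      i in \<open>F\<close>; Bessel's inequality is the positivity of |v - u|^2.\<close>
    define u where "u = (\<Sum>i\<in>F. cinner (e i) v *\<^sub>C e i)"
    have ev: "cinner (e i) u = (if i \<in> F then cinner (e i) v else 0)" for i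
    proof -
      have "cinner (e i) u = (\<Sum>j\<in>F. if j = i then cinner (e i) v else 0)"
        unfolding u_def cinner_sum_right cinner_scaleC_right
        by (rule sum.cong) (auto simp: ortho e_outside cinner_zero_left)
      thus ?thesis using \<open>finite F\<close> by simp
    qed
    have u: "cinner u w = (\<Sum>i\<in>F. cnj (cinner (e i) v) * cinner (e i) w)" for w
      unfolding u_def cinner_sum_left cinner_scaleC_left ..
    have uv: "cinner u v = of_real s"
      unfolding u s_def of_real_sum cnj_mult_self ..
    have uu: "cinner u u = of_real s"
      unfolding u ev s_def of_real_sum by (rule sum.cong) (simp_all add: cnj_mult_self)
    have "complex_of_real ((norm (v - u))\<^sup>2) = of_real ((norm v)\<^sup>2 - s)"
      unfolding cinner_norm[symmetric] cinner_diff_left cinner_diff_right uu uv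
        cinner_commute[of v u] by (simp add: cinner_norm)
    hence "(norm (v - u))\<^sup>2 = (norm v)\<^sup>2 - s" by (simp only: of_real_eq_iff)
    thus ?thesis using zero_le_power2[of "norm (v - u)"] unfolding s_def by linarith
  qed
  note b = bounded_square_sums[OF this]
  show "coord (analysis v) i = cinner (e i) v" "norm (analysis v) \<le> norm v"
    unfolding analysis_def using b(2,3) by (auto simp: fun_eq_iff)
qed

lemma bounded_clin_analysis: "bounded_clin analysis"
  by (rule bounded_clinI[where K = 1])
    (auto intro!: ell2_eqI simp: coord_analysis coord_add cinner_add_right coord_scaleC
      cinner_scaleC_right norm_analysis_le)

lemma analysis_e: "i \<in> V \<Longrightarrow> analysis (e i) = basis_vec i"
  by (rule ell2_eqI) (auto simp: coord_analysis ortho coord_basis_vec)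

text \<open>As the adjoint of a bounded map it is bounded without a convergence argument for the
  series of all c i times e i.\<close>

definition synthesis :: "'g ell2 \<Rightarrow> 'k ell2"
  where "synthesis = adj analysis"

lemma bounded_clin_synthesis: "bounded_clin synthesis"
  unfolding synthesis_def by (intro bounded_clin_adj bounded_clin_analysis)

lemma synthesis_basis_vec: "synthesis (basis_vec i) = e i"
proof (rule eq_by_cinner)
  fix j assume "j \<in> V"
  have "cinner (e j) (synthesis (basis_vec i)) = cinner (analysis (e j)) (basis_vec i)"
    unfolding synthesis_def by (rule cinner_adj_right[OF bounded_clin_analysis])
  also have "\<dots> = cinner (e j) (e i)"
    using \<open>j \<in> V\<close> by (auto simp: analysis_e cinner_basis_vec coord_basis_vec ortho)
  finally show "cinner (e j) (synthesis (basis_vec i)) = cinner (e j) (e i)" .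
qed

lemma synthesis_analysis: "synthesis (analysis v) = v"
proof (rule eq_by_cinner)
  fix i assume "i \<in> V"
  thus "cinner (e i) (synthesis (analysis v)) = cinner (e i) v"
    unfolding synthesis_def cinner_adj_right[OF bounded_clin_analysis]
    by (simp add: analysis_e cinner_basis_vec coord_analysis)
qed

lemma cinner_parseval: "cinner v w = cinner (analysis v) (analysis w)"
  by (metis bounded_clin_analysis cinner_adj_right synthesis_analysis synthesis_def)

lemma eq_on_basis:
  assumes "bounded_clin S" "bounded_clin T" "\<And>i. i \<in> V \<Longrightarrow> S (e i) = T (e i)"
  shows "S = T"
proof
  fix v
  have "(\<lambda>c. S (synthesis c)) = (\<lambda>c. T (synthesis c))"
  proof (rule bounded_clin_eqI)
    fix i show "S (synthesis (basis_vec i)) = T (synthesis (basis_vec i))"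
      using assms by (cases "i \<in> V") (auto simp: synthesis_basis_vec e_outside bounded_clin_zero)
  qed (use assms(1,2) in \<open>simp_all only: bounded_clin_compose[OF _ bounded_clin_synthesis]\<close>)
  from fun_cong[OF this, of "analysis v"] show "S v = T v" by (simp add: synthesis_analysis)
qed

section \<open>Weighted shifts and their weights\<close>

definition bounded_symbol :: "('g \<Rightarrow> real) \<Rightarrow> bool"
  where "bounded_symbol f \<longleftrightarrow> (\<exists>B. \<forall>i\<in>V. \<bar>f i\<bar> \<le> B)"

text \<open>The family may have nonzero coordinates off \<open>V\<close>, when the translation by
  \<open>k\<close> leaves \<open>V\<close>; \<open>synthesis\<close> sends these to 0.\<close>

definition shifted :: "('g \<Rightarrow> real) \<Rightarrow> 'g \<Rightarrow> 'k ell2 \<Rightarrow> 'g ell2"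
  where "shifted f k v = Abs_ell2 (\<lambda>i. of_real (f (i - k)) * cinner (e (i - k)) v)"

definition wshift :: "('g \<Rightarrow> real) \<Rightarrow> 'g \<Rightarrow> 'k ell2 \<Rightarrow> 'k ell2"
  where "wshift f k v = synthesis (shifted f k v)"

lemma coord_shift:
  assumes "bounded_symbol f"
  shows "\<exists>B\<ge>0. \<forall>v. norm (shifted f k v) \<le> B * norm v \<and>
    coord (shifted f k v) =
      (\<lambda>i. of_real (f (i - k)) * cinner (e (i - k)) v)"
proof -
  obtain B where B: "\<And>i. i \<in> V \<Longrightarrow> \<bar>f i\<bar> \<le> B" using assms by (auto simp: bounded_symbol_def)
  \<comment> \<open>If \<open>V\<close> is empty the bound may be negative, hence the
    maximum.\<close>
  define B' where "B' = max B 0"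
  have B': "cmod (of_real (f i) * cinner (e i) v) \<le> B' * cmod (cinner (e i) v)" for i v
    using B[of i] by (cases "i \<in> V")
      (auto simp: norm_mult B'_def e_outside cinner_zero_left intro!: mult_right_mono)
  have "(\<Sum>i\<in>F. (cmod (of_real (f (i - k)) * cinner (e (i - k)) v))\<^sup>2) \<le> (B' * norm v)\<^sup>2"
    if "finite F" for F v
  proof -
    have "(\<Sum>i\<in>F. (cmod (of_real (f (i - k)) * cinner (e (i - k)) v))\<^sup>2)
        \<le> (\<Sum>i\<in>F. B'\<^sup>2 * (cmod (coord (analysis v) (i - k)))\<^sup>2)"
      by (intro sum_mono) (metis B' coord_analysis norm_ge_zero power_mono power_mult_distrib)
    also have "\<dots> = B'\<^sup>2 * (\<Sum>i\<in>(\<lambda>i. i - k) ` F. (cmod (coord (analysis v) i))\<^sup>2)"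
      by (subst sum.reindex) (auto simp: sum_distrib_left inj_on_def)
    also have "\<dots> \<le> B'\<^sup>2 * (norm (analysis v))\<^sup>2"
      by (intro mult_left_mono sum_coord_le_norm) (use that in auto)
    also have "\<dots> \<le> B'\<^sup>2 * (norm v)\<^sup>2"
      by (intro mult_left_mono power_mono norm_analysis_le) auto
    finally show ?thesis by (simp add: power_mult_distrib)
  qed
  note b = bounded_square_sums[OF this]
  show ?thesis by (rule exI[of _ B']) (use b(2,3) in \<open>auto simp: B'_def shifted_def\<close>)
qed

lemma cinner_wshift:
  assumes "bounded_symbol f" "j \<in> V"
  shows "cinner (e j) (wshift f k v) = of_real (f (j - k)) * cinner (e (j - k)) v"
proof -
  have "cinner (e j) (wshift f k v) =
      coord (shifted f k v) j"
    unfolding wshift_def synthesis_def cinner_adj_right[OF bounded_clin_analysis]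
    by (simp add: analysis_e \<open>j \<in> V\<close> cinner_basis_vec)
  thus ?thesis using coord_shift[OF assms(1), of k] by auto
qed

lemma bounded_clin_wshift:
  assumes "bounded_symbol f" shows "bounded_clin (wshift f k)"
proof -
  obtain B where B: "B \<ge> 0"
    "\<And>v. norm (shifted f k v) \<le> B * norm v"
    using coord_shift[OF assms, of k] by blast
  note sbl = bounded_clin_linear[OF bounded_clin_synthesis]
  show ?thesis
  proof (rule bounded_clinI[where K = "onorm synthesis * B"])
    fix v
    have "norm (wshift f k v) \<le> onorm synthesis * (B * norm v)" unfolding wshift_def
      by (rule order_trans[OF onorm[OF sbl]]) (intro mult_left_mono B onorm_pos_le sbl)
    thus "norm (wshift f k v) \<le> onorm synthesis * B * norm v" by (simp add: mult.assoc)
  qed (auto intro!: eq_by_cinner simp: cinner_wshift[OF assms] cinner_add_right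
      cinner_scaleC_right ring_distribs)
qed

lemma wshift_e:
  assumes "bounded_symbol f" "i \<in> V"
  shows "wshift f k (e i) = f i *\<^sub>R e (i + k)"
  by (rule eq_by_cinner) (auto simp: cinner_wshift assms ortho cinner_scaleR_right)

end

section \<open>Weights of commutators, adjoints and conjugates\<close>

context shift_basis
begin

lemma bounded_symbolI: "(\<And>i. i \<in> V \<Longrightarrow> \<bar>f i\<bar> \<le> B) \<Longrightarrow> bounded_symbol f"
  by (auto simp: bounded_symbol_def)

lemma bounded_symbol_bound:
  assumes "bounded_symbol f"
  obtains B where "0 \<le> B" "\<And>i. i \<in> V \<Longrightarrow> \<bar>f i\<bar> \<le> B"
proof -
  obtain B where B: "\<And>i. i \<in> V \<Longrightarrow> \<bar>f i\<bar> \<le> B" using assms by (auto simp: bounded_symbol_def)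
  show thesis by (rule that[of "max 0 B"]) (auto intro: order_trans[OF B])
qed

text \<open>Where i + k leaves \<open>V\<close> the target vector is 0, so the weight at i is
  free.\<close>

lemma wshift_cong:
  assumes "bounded_symbol f" "\<And>i. i \<in> V \<Longrightarrow> i + k \<in> V \<Longrightarrow> g i = f i" "bounded_symbol g"
  shows "wshift g k = wshift f k"
proof (rule eq_on_basis)
  fix i assume "i \<in> V"
  thus "wshift g k (e i) = wshift f k (e i)"
    using assms by (cases "i + k \<in> V") (auto simp: wshift_e e_outside)
qed (intro bounded_clin_wshift assms)+

text \<open>The case distinctions record that an intermediate vector off \<open>V\<close> is 0; the
  weights themselves need not vanish there.\<close>

definition shift_comm :: "('g \<Rightarrow> real) \<Rightarrow> 'g \<Rightarrow> ('g \<Rightarrow> real) \<Rightarrow> 'g \<Rightarrow> 'g \<Rightarrow> real"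
  where "shift_comm f k g l i =
    (if i + l \<in> V then g i * f (i + l) else 0) - (if i + k \<in> V then f i * g (i + k) else 0)"

lemma bounded_shift_comm:
  assumes "bounded_symbol f" "bounded_symbol g"
  shows "bounded_symbol (shift_comm f k g l)"
proof -
  obtain B where B: "0 \<le> B" "\<And>i. i \<in> V \<Longrightarrow> \<bar>f i\<bar> \<le> B" using assms by (metis bounded_symbol_bound)
  obtain C where C: "0 \<le> C" "\<And>i. i \<in> V \<Longrightarrow> \<bar>g i\<bar> \<le> C" using assms by (metis bounded_symbol_bound)
  show ?thesis
  proof (rule bounded_symbolI)
    fix i assume i: "i \<in> V"
    have "\<bar>if i + l \<in> V then g i * f (i + l) else 0\<bar> \<le> C * B"
      using B C i by (auto simp: abs_mult intro!: mult_mono)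
    moreover have "\<bar>if i + k \<in> V then f i * g (i + k) else 0\<bar> \<le> B * C"
      using B C i by (auto simp: abs_mult intro!: mult_mono)
    ultimately show "\<bar>shift_comm f k g l i\<bar> \<le> C * B + B * C"
      unfolding shift_comm_def by (intro order_trans[OF abs_triangle_ineq4] add_mono)
  qed
qed

lemma commutator_wshift:
  assumes f: "bounded_symbol f" and g: "bounded_symbol g"
  shows "commutator (wshift f k) (wshift g l) = wshift (shift_comm f k g l) (k + l)"
proof (rule eq_on_basis)
  fix i assume i: "i \<in> V"
  have *: "wshift f k (wshift g l (e i)) =
      (if i + l \<in> V then g i * f (i + l) else 0) *\<^sub>R e (i + (k + l))"
    if f: "bounded_symbol f" and g: "bounded_symbol g" for f g k l
    using i by (auto simp: wshift_e f g bounded_clin_scaleR[OF bounded_clin_wshift]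
        e_outside bounded_clin_zero[OF bounded_clin_wshift] ac_simps)
  show "commutator (wshift f k) (wshift g l) (e i) = wshift (shift_comm f k g l) (k + l) (e i)"
    unfolding commutator_def *[OF f g] *[OF g f]
    by (simp add: wshift_e bounded_shift_comm f g i shift_comm_def algebra_simps)
next
  show "bounded_clin (commutator (wshift f k) (wshift g l))"
    unfolding commutator_def[abs_def]
    using bounded_clin_compose[OF bounded_clin_wshift[OF f] bounded_clin_wshift[OF g]]
      bounded_clin_compose[OF bounded_clin_wshift[OF g] bounded_clin_wshift[OF f]]
    by (rule bounded_clin_minus)
  show "bounded_clin (wshift (shift_comm f k g l) (k + l))"
    by (rule bounded_clin_wshift[OF bounded_shift_comm[OF f g]])
qed

definition adj_symbol :: "('g \<Rightarrow> real) \<Rightarrow> 'g \<Rightarrow> 'g \<Rightarrow> real"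
  where "adj_symbol f k i = (if i - k \<in> V then f (i - k) else 0)"

lemma bounded_adj_symbol:
  assumes "bounded_symbol f" shows "bounded_symbol (adj_symbol f k)"
proof -
  obtain B where "0 \<le> B" "\<And>i. i \<in> V \<Longrightarrow> \<bar>f i\<bar> \<le> B" using assms by (metis bounded_symbol_bound)
  thus ?thesis by (intro bounded_symbolI[of _ B]) (auto simp: adj_symbol_def)
qed

lemma adj_wshift:
  assumes f: "bounded_symbol f"
  shows "adj (wshift f k) = wshift (adj_symbol f k) (- k)"
proof (rule eq_on_basis)
  fix i assume i: "i \<in> V"
  show "adj (wshift f k) (e i) = wshift (adj_symbol f k) (- k) (e i)"
  proof (rule eq_by_cinner)
    fix j assume j: "j \<in> V"
    show "cinner (e j) (adj (wshift f k) (e i)) = cinner (e j) (wshift (adj_symbol f k) (- k) (e i))"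
      unfolding cinner_adj_right[OF bounded_clin_wshift[OF f]]
      using i j by (auto simp: cinner_wshift bounded_adj_symbol f wshift_e ortho adj_symbol_def
          cinner_scaleR_left cinner_scaleR_right cinner_zero_right)
  qed
qed (intro bounded_clin_adj bounded_clin_wshift bounded_adj_symbol f)+

text \<open>The index travels from i to bar i, to bar i + k, and to i + k'. As \<open>J\<close>
  conjugates the phase picked up by its inverse, the two phases met on the way combine to the
  constant \<sigma>; a real \<sigma> keeps the weight real.\<close>

lemma conj_wshift:
  assumes J: "antiunitary J" and Je: "\<And>i. i \<in> V \<Longrightarrow> J (e i) = p i *\<^sub>C e (bar i)"
    and bar: "\<And>i. bar (bar i) = i" "\<And>i. bar i \<in> V \<longleftrightarrow> i \<in> V" "\<And>i. bar (i + k) = bar i + k'"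
    and p: "\<And>i. cmod (p i) = 1" "\<And>i. p (i + k) * cnj (p i) = of_real \<sigma>"
    and f: "bounded_symbol f"
    and JT: "bounded_clin (\<lambda>v. J (wshift f k (inv_into UNIV J v)))"
  shows "bounded_symbol (\<lambda>i. \<sigma> * f (bar i))"
    and "(\<lambda>v. J (wshift f k (inv_into UNIV J v))) = wshift (\<lambda>i. \<sigma> * f (bar i)) k'"
proof -
  have J': "bij J" "\<And>c v. J (c *\<^sub>C v) = cnj c *\<^sub>C J v" using J by (auto simp: antiunitary_def)
  have J0: "J 0 = 0" using J'(2)[of 0 0] by (simp add: scaleC_zero_left)
  obtain B where B: "\<And>i. i \<in> V \<Longrightarrow> \<bar>f i\<bar> \<le> B" using f by (auto simp: bounded_symbol_def)
  show b: "bounded_symbol (\<lambda>i. \<sigma> * f (bar i))"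
    by (rule bounded_symbolI[of _ "\<bar>\<sigma>\<bar> * B"]) (auto simp: abs_mult bar intro!: mult_left_mono B)
  show "(\<lambda>v. J (wshift f k (inv_into UNIV J v))) = wshift (\<lambda>i. \<sigma> * f (bar i)) k'"
  proof (rule eq_on_basis[OF JT bounded_clin_wshift[OF b]])
    fix i assume i: "i \<in> V"
    hence bi: "bar i \<in> V" by (simp add: bar)
    \<comment> \<open>Antilinearity conjugates the phase in front, which then cancels against the
      phase that \<open>J\<close> produces.\<close>
    have "J (p (bar i) *\<^sub>C e (bar i)) = e i"
      unfolding J'(2) Je[OF bi] bar scaleC_scaleC cnj_mult_self p by (simp add: scaleC_one)
    hence "inv_into UNIV J (e i) = p (bar i) *\<^sub>C e (bar i)" using J'(1) by (metis bij_inv_eq_iff)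
    hence "J (wshift f k (inv_into UNIV J (e i))) =
        J (p (bar i) *\<^sub>C of_real (f (bar i)) *\<^sub>C e (bar i + k))"
      by (simp add: bounded_clin_scaleC[OF bounded_clin_wshift[OF f]] wshift_e f bi
          scaleR_eq_scaleC)
    also have "\<dots> = (cnj (p (bar i)) * of_real (f (bar i))) *\<^sub>C J (e (bar i + k))"
      by (simp add: J'(2) scaleC_scaleC)
    also have "J (e (bar i + k)) = p (bar i + k) *\<^sub>C e (i + k')"
    proof (cases "bar i + k \<in> V")
      case True
      thus ?thesis by (simp add: Je bar)
    next
      case False
      hence "i + k' \<notin> V" using bar by metis
      thus ?thesis using False by (simp add: e_outside J0 scaleC_zero_right)
    qed
    also have "(cnj (p (bar i)) * of_real (f (bar i))) *\<^sub>C p (bar i + k) *\<^sub>C e (i + k') =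
        (of_real (f (bar i)) * (p (bar i + k) * cnj (p (bar i)))) *\<^sub>C e (i + k')"
      by (simp add: scaleC_scaleC mult_ac)
    also have "\<dots> = (\<sigma> * f (bar i)) *\<^sub>R e (i + k')"
      unfolding p(2) by (simp add: scaleR_eq_scaleC mult.commute)
    finally show "J (wshift f k (inv_into UNIV J (e i))) = wshift (\<lambda>i. \<sigma> * f (bar i)) k' (e i)"
      by (simp add: wshift_e[OF b] i)
  qed
qed

end

section \<open>Conjugation by an antiunitary operator\<close>

lemma antiunitary_norm: "antiunitary J \<Longrightarrow> norm (J v) = norm v"
proof -
  assume "antiunitary J"
  hence "complex_of_real ((norm (J v))\<^sup>2) = of_real ((norm v)\<^sup>2)"
    unfolding cinner_norm[symmetric] by (simp add: antiunitary_def)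
  thus ?thesis by (simp only: of_real_eq_iff power2_eq_iff_nonneg norm_ge_zero)
qed

lemma
  assumes J: "antiunitary J"
  shows antiunitary_inv_add: "inv_into UNIV J (v + w) = inv_into UNIV J v + inv_into UNIV J w"
    and antiunitary_inv_scaleC: "inv_into UNIV J (c *\<^sub>C v) = cnj c *\<^sub>C inv_into UNIV J v"
    and antiunitary_inv: "J (inv_into UNIV J v) = v" "inv_into UNIV J (J v) = v"
    and antiunitary_inv_norm: "norm (inv_into UNIV J v) = norm v"
proof -
  have b: "bij J" and J': "\<And>v w. J (v + w) = J v + J w" "\<And>c v. J (c *\<^sub>C v) = cnj c *\<^sub>C J v"
    using J by (auto simp: antiunitary_def)
  show i: "J (inv_into UNIV J v) = v" "inv_into UNIV J (J v) = v" for v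
    using b by (auto simp: bij_is_surj bij_is_inj surj_f_inv_f)
  have inj: "J x = J y \<Longrightarrow> x = y" for x y using b by (metis i(2))
  show "inv_into UNIV J (v + w) = inv_into UNIV J v + inv_into UNIV J w" by (rule inj) (simp add: J' i)
  show "inv_into UNIV J (c *\<^sub>C v) = cnj c *\<^sub>C inv_into UNIV J v" by (rule inj) (simp add: J' i)
  show "norm (inv_into UNIV J v) = norm v" by (metis antiunitary_norm[OF J] i(1))
qed

lemma bounded_clin_conj:
  assumes J: "antiunitary J" and T: "bounded_clin T"
  shows "bounded_clin (\<lambda>v. J (T (inv_into UNIV J v)))"
proof (rule bounded_clinI[where K = "onorm T"])
  have J': "\<And>v w. J (v + w) = J v + J w" "\<And>c v. J (c *\<^sub>C v) = cnj c *\<^sub>C J v"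
    using J by (auto simp: antiunitary_def)
  fix v w c
  show "J (T (inv_into UNIV J (v + w))) = J (T (inv_into UNIV J v)) + J (T (inv_into UNIV J w))"
    by (simp add: antiunitary_inv_add[OF J] bounded_clin_add[OF T] J')
  show "J (T (inv_into UNIV J (c *\<^sub>C v))) = c *\<^sub>C J (T (inv_into UNIV J v))"
    by (simp add: antiunitary_inv_scaleC[OF J] bounded_clin_scaleC[OF T] J')
  show "norm (J (T (inv_into UNIV J v))) \<le> onorm T * norm v"
    using onorm[OF bounded_clin_linear[OF T], of "inv_into UNIV J v"]
    by (simp add: antiunitary_norm[OF J] antiunitary_inv_norm[OF J])
qed

section \<open>The ideal generated by an operator\<close>

context
  fixes L :: "'k ell2 \<Rightarrow> 'k ell2" and K
  assumes L: "bounded_clin L" and K_def: "K = Idl\<^bsub>bounded_ops\<^esub> {L}"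
begin

lemma ideal_K: "ideal K bounded_ops"
  unfolding K_def by (rule ring.genideal_ideal[OF ring_bounded_ops])
    (use L in \<open>auto simp: bounded_ops_def bounded_clinear_iff\<close>)

lemma L_in_K: "L \<in> K"
  using ring.genideal_self[OF ring_bounded_ops, of "{L}"] L
  unfolding K_def by (auto simp: bounded_ops_def bounded_clinear_iff)

lemma K_comp_left: "bounded_clin A \<Longrightarrow> T \<in> K \<Longrightarrow> (\<lambda>v. A (T v)) \<in> K"
  using ideal.I_l_closed[OF ideal_K, of T A] by (auto simp: bounded_ops_def bounded_clinear_iff o_def)

lemma K_comp_right: "bounded_clin A \<Longrightarrow> T \<in> K \<Longrightarrow> (\<lambda>v. T (A v)) \<in> K"
  using ideal.I_r_closed[OF ideal_K, of T A] by (auto simp: bounded_ops_def bounded_clinear_iff o_def)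

lemma K_plus: "S \<in> K \<Longrightarrow> T \<in> K \<Longrightarrow> (\<lambda>v. S v + T v) \<in> K"
  using additive_subgroup.a_closed[OF ideal.axioms(1)[OF ideal_K], of S T]
  by (simp add: bounded_ops_def)

lemma K_zero: "(\<lambda>v. 0) \<in> K"
  using additive_subgroup.zero_closed[OF ideal.axioms(1)[OF ideal_K]] by (simp add: bounded_ops_def)

lemma K_scaleC: "T \<in> K \<Longrightarrow> (\<lambda>v. c *\<^sub>C T v) \<in> K"
  using K_comp_left[OF bounded_clin_scaleC_comp[OF bounded_clin_id]] .

lemma commutator_K_plus_right:
  assumes "bounded_clin X" "commutator X S \<in> K" "commutator X T \<in> K"
  shows "commutator X (\<lambda>v. S v + T v) \<in> K"
proof -
  have "commutator X (\<lambda>v. S v + T v) = (\<lambda>v. commutator X S v + commutator X T v)"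
    by (auto simp: commutator_def bounded_clin_add[OF assms(1)])
  thus ?thesis using assms K_plus by simp
qed

lemma commutator_K_plus_left:
  assumes "bounded_clin X" "commutator S X \<in> K" "commutator T X \<in> K"
  shows "commutator (\<lambda>v. S v + T v) X \<in> K"
proof -
  have "commutator (\<lambda>v. S v + T v) X = (\<lambda>v. commutator S X v + commutator T X v)"
    by (auto simp: commutator_def bounded_clin_add[OF assms(1)])
  thus ?thesis using assms K_plus by simp
qed

lemma commutator_K_scale_right:
  assumes "bounded_clin X" "commutator X T \<in> K"
  shows "commutator X (\<lambda>v. c *\<^sub>C T v) \<in> K"
proof -
  have "commutator X (\<lambda>v. c *\<^sub>C T v) = (\<lambda>v. c *\<^sub>C commutator X T v)"
    by (auto simp: commutator_def bounded_clin_scaleC[OF assms(1)] scaleC_diff_right)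
  thus ?thesis using assms K_scaleC by simp
qed

lemma commutator_K_scale_left:
  assumes "bounded_clin X" "commutator T X \<in> K"
  shows "commutator (\<lambda>v. c *\<^sub>C T v) X \<in> K"
proof -
  have "commutator (\<lambda>v. c *\<^sub>C T v) X = (\<lambda>v. c *\<^sub>C commutator T X v)"
    by (auto simp: commutator_def bounded_clin_scaleC[OF assms(1)] scaleC_diff_right)
  thus ?thesis using assms K_scaleC by simp
qed

lemma commutator_K_comp_right:
  assumes "bounded_clin X" "bounded_clin S" "bounded_clin T" "commutator X S \<in> K" "commutator X T \<in> K"
  shows "commutator X (\<lambda>v. S (T v)) \<in> K"
proof -
  have "commutator X (\<lambda>v. S (T v)) = (\<lambda>v. commutator X S (T v) + S (commutator X T v))"
    by (auto simp: commutator_def bounded_clin_diff[OF assms(2)])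
  thus ?thesis using assms K_plus K_comp_left K_comp_right by simp
qed

lemma commutator_K_comp_left:
  assumes "bounded_clin X" "bounded_clin S" "bounded_clin T" "commutator S X \<in> K" "commutator T X \<in> K"
  shows "commutator (\<lambda>v. S (T v)) X \<in> K"
proof -
  have "commutator (\<lambda>v. S (T v)) X = (\<lambda>v. S (commutator T X v) + commutator S X (T v))"
    by (auto simp: commutator_def bounded_clin_diff[OF assms(2)])
  thus ?thesis using assms K_plus K_comp_left K_comp_right by simp
qed

end

text \<open>Divide the weight by the eigenvalue of \<open>L\<close>: the quotient is bounded, and
  the shift with this quotient as weight, composed with \<open>L\<close>, is the given
  operator.\<close>

lemma (in shift_basis) wshift_in_ideal:
  assumes L: "bounded_clin L" "\<And>i. i \<in> V \<Longrightarrow> L (e i) = w i *\<^sub>R e i"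
    and w: "\<And>i. i \<in> V \<Longrightarrow> 0 < w i" and f: "\<And>i. i \<in> V \<Longrightarrow> \<bar>f i\<bar> \<le> B * w i"
    and b: "bounded_symbol f"
  shows "wshift f k \<in> Idl\<^bsub>bounded_ops\<^esub> {L}"
proof -
  have b': "bounded_symbol (\<lambda>i. f i / w i)"

  proof (rule bounded_symbolI[of _ B])
    fix i assume "i \<in> V"
    thus "\<bar>f i / w i\<bar> \<le> B" using f[of i] w[of i] by (simp add: abs_divide divide_le_eq)
  qed
  have "wshift f k = (\<lambda>v. wshift (\<lambda>i. f i / w i) k (L v))"
  proof (rule eq_on_basis[OF bounded_clin_wshift[OF b]
          bounded_clin_compose[OF bounded_clin_wshift[OF b'] L(1)]])
    fix i assume i: "i \<in> V"
    show "wshift f k (e i) = wshift (\<lambda>i. f i / w i) k (L (e i))"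
      using w[OF i]
      by (simp add: wshift_e b b' i L bounded_clin_scaleR[OF bounded_clin_wshift[OF b']])
  qed
  thus ?thesis using K_comp_left[OF L(1) refl bounded_clin_wshift[OF b'] L_in_K[OF L(1) refl]] by simp
qed

section \<open>Commutators with a self-adjoint operator\<close>

lemma bounded_commutator_ext_plus:
  assumes "selfadjoint_on E D" "bounded_commutator_ext E D A S" "bounded_commutator_ext E D B T"
  shows "bounded_commutator_ext E D (\<lambda>v. A v + B v) (\<lambda>v. S v + T v)"
proof -
  have "bounded_clin (\<lambda>v. S v + T v)"
    using assms by (intro bounded_clin_plus) (auto simp: bounded_commutator_ext_def bounded_clinear_iff)
  moreover have "\<And>v w. v \<in> E \<Longrightarrow> w \<in> E \<Longrightarrow> v + w \<in> E \<and> D (v + w) = D v + D w"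
    using assms(1) by (auto simp: selfadjoint_on_def)
  ultimately show ?thesis using assms(2,3)
    by (auto simp: bounded_commutator_ext_def bounded_clinear_iff commutator_def)
qed

lemma bounded_commutator_ext_scaleC:
  assumes "selfadjoint_on E D" "bounded_commutator_ext E D A S"
  shows "bounded_commutator_ext E D (\<lambda>v. c *\<^sub>C A v) (\<lambda>v. c *\<^sub>C S v)"
proof -
  have "bounded_clin (\<lambda>v. c *\<^sub>C S v)"
    using assms by (intro bounded_clin_scaleC_comp) (auto simp: bounded_commutator_ext_def bounded_clinear_iff)
  moreover have "\<And>c v. v \<in> E \<Longrightarrow> c *\<^sub>C v \<in> E \<and> D (c *\<^sub>C v) = c *\<^sub>C D v"
    using assms(1) by (auto simp: selfadjoint_on_def)
  ultimately show ?thesis using assms(2)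
    by (auto simp: bounded_commutator_ext_def bounded_clinear_iff commutator_def scaleC_diff_right)
qed

lemma bounded_commutator_ext_id: "bounded_commutator_ext E D (\<lambda>v. v) (\<lambda>v. 0)"
  using bounded_clin_const_zero
  by (auto simp: bounded_commutator_ext_def bounded_clinear_iff commutator_def)

lemma bounded_commutator_ext_comp:
  assumes "bounded_commutator_ext E D A S" "bounded_commutator_ext E D B T"
    and AB: "bounded_clin A" "bounded_clin B"
  shows "bounded_commutator_ext E D (\<lambda>v. A (B v)) (\<lambda>v. S (B v) + A (T v))"
proof -
  have "bounded_clin (\<lambda>v. S (B v) + A (T v))"
    using assms(1,2) bounded_clin_plus[OF bounded_clin_compose[OF _ AB(2)] bounded_clin_compose[OF AB(1)]]
    by (simp add: bounded_commutator_ext_def bounded_clinear_iff)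
  thus ?thesis using assms(1,2)
    by (simp add: bounded_commutator_ext_def bounded_clinear_iff commutator_def bounded_clin_diff[OF AB(1)])
qed

context shift_basis
begin

text \<open>An orthonormal eigenbasis forces the domain of a self-adjoint operator. By Parseval's
  identity any \<open>w\<close> with the right coordinates satisfies the adjoint relation against
  all of \<open>E\<close>, and self-adjointness then puts \<open>v\<close> into \<open>E\<close>.
  This makes membership in \<open>E\<close> a condition on coordinates.\<close>

lemma selfadjoint_diagonal:
  assumes D: "selfadjoint_on E D" and De: "\<And>i. i \<in> V \<Longrightarrow> e i \<in> E \<and> D (e i) = d i *\<^sub>R e i"
  shows "v \<in> E \<and> D v = w \<longleftrightarrow> (\<forall>i\<in>V. cinner (e i) w = of_real (d i) * cinner (e i) v)"
proof
  assume "v \<in> E \<and> D v = w"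
  hence *: "\<And>u. u \<in> E \<Longrightarrow> cinner (D u) v = cinner u w" using D by (auto simp: selfadjoint_on_def)
  show "\<forall>i\<in>V. cinner (e i) w = of_real (d i) * cinner (e i) v"
  proof
    fix i assume "i \<in> V"
    thus "cinner (e i) w = of_real (d i) * cinner (e i) v"
      using *[of "e i"] De[of i] by (simp add: cinner_scaleR_left)
  qed
next
  assume w: "\<forall>i\<in>V. cinner (e i) w = of_real (d i) * cinner (e i) v"
  have "cinner (D u) v = cinner u w" if u: "u \<in> E" for u
  proof -
    have Du: "cinner (D u) z = cinner u (D z)" if "z \<in> E" for z
      using D u that unfolding selfadjoint_on_def by blast
    \<comment> \<open>Symmetry of \<open>D\<close>, tested against the eigenvector
      \<open>e i\<close>.\<close>
    have "cinner (e i) (D u) = of_real (d i) * cinner (e i) u" if i: "i \<in> V" for i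
      using Du[of "e i"] De[OF i] cinner_commute[of "e i" "D u"] cinner_commute[of "e i" u]
      by (simp add: cinner_scaleR_right)
    hence *: "cnj (cinner (e i) (D u)) * cinner (e i) v = cnj (cinner (e i) u) * cinner (e i) w" for i
      using w by (cases "i \<in> V") (auto simp: e_outside cinner_zero_left)
    thus ?thesis unfolding cinner_parseval[of "D u"] cinner_parseval[of u]
      by (simp add: cinner_def coord_analysis)
  qed
  thus "v \<in> E \<and> D v = w" using D unfolding selfadjoint_on_def by blast
qed

text \<open>That the shift preserves \<open>E\<close> is part of the claim. Once the new weight is
  bounded, there is a candidate for the value of \<open>D\<close> at the shifted vector, namely the
  sum given by the Leibniz rule, and a comparison of coordinates puts the shifted vector into
  \<open>E\<close>.\<close>

lemma bounded_commutator_ext_wshift: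
  assumes D: "selfadjoint_on E D" and De: "\<And>i. i \<in> V \<Longrightarrow> e i \<in> E \<and> D (e i) = d i *\<^sub>R e i"
    and f: "bounded_symbol f" "bounded_symbol (\<lambda>i. (d (i + k) - d i) * f i)"
  shows "bounded_commutator_ext E D (wshift f k) (wshift (\<lambda>i. (d (i + k) - d i) * f i) k)"
  unfolding bounded_commutator_ext_def bounded_clinear_iff
proof (intro conjI ballI)
  let ?g = "\<lambda>i. (d (i + k) - d i) * f i"
  show "bounded_clin (wshift ?g k)" by (intro bounded_clin_wshift f)
  fix v assume "v \<in> E"
  hence v: "\<And>i. i \<in> V \<Longrightarrow> cinner (e i) (D v) = of_real (d i) * cinner (e i) v"
    using selfadjoint_diagonal[OF D De, where v = v and w = "D v"] by auto
  have "wshift f k v \<in> E \<and> D (wshift f k v) = wshift ?g k v + wshift f k (D v)"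
  proof (rule iffD2[OF selfadjoint_diagonal[OF D De]], assumption, rule ballI)
    fix i assume i: "i \<in> V"
    show "cinner (e i) (wshift ?g k v + wshift f k (D v)) =
        of_real (d i) * cinner (e i) (wshift f k v)"
      unfolding cinner_add_right cinner_wshift[OF f(1) i] cinner_wshift[OF f(2) i]
      by (cases "i - k \<in> V") (simp_all add: v e_outside cinner_zero_left algebra_simps)
  qed
  thus "wshift f k v \<in> E" "wshift ?g k v = commutator D (wshift f k) v"
    by (auto simp: commutator_def)
qed

end

section \<open>Generators and involution of $\mathcal{A}(SU_q(2))$\<close>

lemma word_star_star: "word_star (word_star w) = w"
proof -
  have "letter_star (letter_star x) = x" for x by (cases x) auto
  thus ?thesis by (simp add: word_star_def rev_map o_def)
qed

lemma word_star_plus: "word_star (v + w) = word_star w + word_star v"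
  by (simp add: word_star_def plus_word_def)

lemma lookup_free_star:
  "Poly_Mapping.lookup (free_star f) w = cnj (Poly_Mapping.lookup f (word_star w))"
proof -
  have "Poly_Mapping.lookup (free_star f) w =
      (\<Sum>v\<in>Poly_Mapping.keys f. if v = word_star w then cnj (Poly_Mapping.lookup f (word_star w)) else 0)"
    unfolding free_star_def lookup_sum lookup_single
    by (rule sum.cong) (auto simp: when_def word_star_star)
  thus ?thesis by (simp add: in_keys_iff)
qed

lemma free_star_plus: "free_star (f + g) = free_star f + free_star g"
  by (rule poly_mapping_eqI) (simp add: lookup_free_star lookup_add)

lemma free_star_uminus: "free_star (- f) = - free_star f"
  by (rule poly_mapping_eqI) (simp add: lookup_free_star)

lemma free_star_zero: "free_star 0 = 0"
  by (rule poly_mapping_eqI) (simp add: lookup_free_star)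

lemma free_star_free_star: "free_star (free_star f) = f"
  by (rule poly_mapping_eqI) (simp add: lookup_free_star word_star_star)

lemma free_star_single: "free_star (Poly_Mapping.single w c) = Poly_Mapping.single (word_star w) (cnj c)"
  by (rule poly_mapping_eqI) (auto simp: lookup_free_star lookup_single when_def word_star_star)

lemma free_star_gen: "free_star (gen x) = gen (letter_star x)"
  by (simp add: gen_def free_star_single word_star_def)

lemma poly_mapping_monomial_sum:
  fixes f :: "'a \<Rightarrow>\<^sub>0 'b::comm_monoid_add"
  shows "f = (\<Sum>w\<in>Poly_Mapping.keys f. Poly_Mapping.single w (Poly_Mapping.lookup f w))"
proof (rule poly_mapping_eqI)
  fix v
  have "Poly_Mapping.lookup (\<Sum>w\<in>Poly_Mapping.keys f. Poly_Mapping.single w (Poly_Mapping.lookup f w)) v =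
      (\<Sum>w\<in>Poly_Mapping.keys f. if w = v then Poly_Mapping.lookup f v else 0)"
    unfolding lookup_sum lookup_single by (rule sum.cong) (auto simp: when_def)
  thus "Poly_Mapping.lookup f v =
      Poly_Mapping.lookup (\<Sum>w\<in>Poly_Mapping.keys f. Poly_Mapping.single w (Poly_Mapping.lookup f w)) v"
    by (simp add: in_keys_iff)
qed

lemma monomial_induct:
  fixes f :: "'a \<Rightarrow>\<^sub>0 'b::comm_monoid_add"
  assumes "P 0" "\<And>f g. P f \<Longrightarrow> P g \<Longrightarrow> P (f + g)" "\<And>w c. P (Poly_Mapping.single w c)"
  shows "P f"
proof -
  have "P (\<Sum>w\<in>A. Poly_Mapping.single w (Poly_Mapping.lookup f w))" for A
    by (induction A rule: infinite_finite_induct) (simp_all add: assms)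
  thus ?thesis by (subst poly_mapping_monomial_sum) auto
qed

lemma free_star_mult: "free_star (f * g) = free_star g * free_star f"
proof (induction f rule: monomial_induct)
  case (3 v c)
  show ?case
    by (induction g rule: monomial_induct)
      (simp_all add: free_star_zero free_star_plus ring_distribs mult_single free_star_single
        word_star_plus mult.commute)
qed (simp_all add: free_star_zero free_star_plus ring_distribs)

context
  fixes q :: real
begin

lemma ideal_suq2: "ideal (suq2_ideal q) free_ring"
  unfolding suq2_ideal_def by (rule ring.genideal_ideal[OF ring_free_ring]) (simp add: free_ring_def)

text \<open>The preimage of the ideal under the involution is a two-sided ideal, because the
  involution reverses products, and it contains the relators, because they were adjoined together
  with their adjoints. Minimality of the generated ideal gives the rest.\<close>

lemma suq2_ideal_star:
  assumes "f \<in> suq2_ideal q" shows "free_star f \<in> suq2_ideal q"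
proof -
  let ?I = "suq2_ideal q" and ?S = "suq2_relators q \<union> free_star ` suq2_relators q"
  interpret I: ideal ?I free_ring by (rule ideal_suq2)
  have closed: "\<And>f g. f \<in> ?I \<Longrightarrow> g \<in> ?I \<Longrightarrow> f + g \<in> ?I" "0 \<in> ?I"
    "\<And>f g. f \<in> ?I \<Longrightarrow> g * f \<in> ?I" "\<And>f g. f \<in> ?I \<Longrightarrow> f * g \<in> ?I"
    using additive_subgroup.a_closed[OF I.additive_subgroup_axioms]
      additive_subgroup.zero_closed[OF I.additive_subgroup_axioms] I.I_l_closed I.I_r_closed
    by (simp_all add: free_ring_def)
  have neg: "- f \<in> ?I" if "f \<in> ?I" for f using closed(3)[OF that, of "- 1"] by simp
  have S: "?S \<subseteq> ?I"
    unfolding suq2_ideal_def by (rule ring.genideal_self[OF ring_free_ring]) (simp add: free_ring_def)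
  have inv: "inv\<^bsub>add_monoid free_ring\<^esub> x = - x" for x
    by (rule group.inv_equality[OF abelian_group.a_group[OF ring.is_abelian_group[OF ring_free_ring]]])
      (simp_all add: free_ring_def)
  have "ideal {f. free_star f \<in> ?I} free_ring"
    by (rule idealI[OF ring_free_ring], rule subgroup.intro)
      (auto simp: free_ring_def free_star_plus free_star_mult free_star_zero closed
        inv[unfolded free_ring_def, simplified] free_star_uminus neg)
  moreover have "?S \<subseteq> {f. free_star f \<in> ?I}"
    using S by (auto simp: free_star_free_star)
  ultimately have "?I \<subseteq> {f. free_star f \<in> ?I}"
    unfolding suq2_ideal_def by (rule ring.genideal_minimal[OF ring_free_ring])
  thus ?thesis using assms by auto
qed

lemma suq2_class_eq: "suq2_class q f = (\<lambda>h. h + f) ` suq2_ideal q"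
  by (auto simp: suq2_class_def a_r_coset_def r_coset_def free_ring_def)

lemma suq2_star_class: "suq2_star (suq2_class q f) = suq2_class q (free_star f)"
proof -
  have *: "free_star ` suq2_ideal q = suq2_ideal q"
  proof
    show "suq2_ideal q \<subseteq> free_star ` suq2_ideal q"
      using suq2_ideal_star by (metis free_star_free_star image_eqI subsetI)
  qed (use suq2_ideal_star in blast)
  have "suq2_star (suq2_class q f) = (\<lambda>h. h + free_star f) ` free_star ` suq2_ideal q"
    unfolding suq2_class_eq suq2_star_def image_image free_star_plus ..
  thus ?thesis unfolding * suq2_class_eq .
qed

lemma suq2_carrier: "carrier (suq2 q) = range (suq2_class q)"
  by (auto simp: suq2_def FactRing_def A_RCOSETS_def' suq2_class_def a_r_coset_def
      RCOSETS_def A_RCOSETS_def free_ring_def)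

lemma suq2_class_one: "\<one>\<^bsub>suq2 q\<^esub> = suq2_class q 1"
  by (simp add: suq2_def FactRing_def suq2_class_def) (simp add: free_ring_def)

lemma suq2_class_mult: "suq2_class q (f * g) = suq2_class q f \<otimes>\<^bsub>suq2 q\<^esub> suq2_class q g"
  using ideal.rcoset_mult_add[OF ideal_suq2, of f g]
  by (simp add: suq2_def FactRing_def suq2_class_def) (simp add: free_ring_def)

lemma suq2_class_plus: "suq2_class q (f + g) = suq2_class q f \<oplus>\<^bsub>suq2 q\<^esub> suq2_class q g"
  using abelian_subgroup.a_rcos_sum[OF abelian_subgroupI3, of "suq2_ideal q" free_ring f g]
    ideal.axioms(1)[OF ideal_suq2] ring.is_abelian_group[OF ring_free_ring]
  by (simp add: suq2_def FactRing_def suq2_class_def) (simp add: free_ring_def)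

lemma suq2_class_scale: "suq2_class q (const c * f) = suq2_scale q c (suq2_class q f)"
  by (simp add: suq2_scale_def suq2_class_mult)

text \<open>There is no case for the involution: the starred letters are generators in their own
  right, and every class is a linear combination of classes of words.\<close>

lemma suq2_induct [consumes 1]:
  assumes x: "x \<in> carrier (suq2 q)"
    and gens: "\<And>l. P (suq2_class q (gen l))" and one: "P \<one>\<^bsub>suq2 q\<^esub>"
    and plus: "\<And>x y. x \<in> carrier (suq2 q) \<Longrightarrow> y \<in> carrier (suq2 q) \<Longrightarrow> P x \<Longrightarrow> P y \<Longrightarrow> P (x \<oplus>\<^bsub>suq2 q\<^esub> y)"
    and mult: "\<And>x y. x \<in> carrier (suq2 q) \<Longrightarrow> y \<in> carrier (suq2 q) \<Longrightarrow> P x \<Longrightarrow> P y \<Longrightarrow> P (x \<otimes>\<^bsub>suq2 q\<^esub> y)"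
    and scale: "\<And>x c. x \<in> carrier (suq2 q) \<Longrightarrow> P x \<Longrightarrow> P (suq2_scale q c x)"
  shows "P x"
proof -
  note carr = suq2_carrier
  have words: "P (suq2_class q (Poly_Mapping.single (Word ls) 1))" for ls
  proof (induction ls)
    case Nil
    thus ?case using one by (simp add: suq2_class_one zero_word_def[symmetric] single_one)
  next
    case (Cons l ls)
    have "Poly_Mapping.single (Word (l # ls)) 1 = gen l * Poly_Mapping.single (Word ls) 1"
      by (simp add: gen_def mult_single plus_word_def)
    thus ?case using mult[OF _ _ gens Cons] by (simp add: suq2_class_mult carr)
  qed
  have monomials: "P (suq2_class q (Poly_Mapping.single w c))" for w c
  proof -
    have "Poly_Mapping.single w c = const c * Poly_Mapping.single w 1"
      by (simp add: const_def mult_single)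
    thus ?thesis using scale[OF _ words, of "letters w" c] by (simp add: suq2_class_scale carr)
  qed
  have "P (suq2_class q f)" for f
  proof (induction f rule: monomial_induct)
    case 1 show ?case using monomials[of 0 0] by simp
  next
    case (2 f g) thus ?case using plus by (simp add: suq2_class_plus carr)
  qed (rule monomials)
  thus ?thesis using x by (auto simp: carr)
qed

end

section \<open>Reduction to generators\<close>

lemma coord_spin_component: "coord (spin_component v s) i = coord v (i, s)"
  by (simp add: spin_component.rep_eq)

lemma coord_tensor_spin: "coord (u \<otimes>\<^sub>s s) p = (if snd p = s then coord u (fst p) else 0)"
  by (cases p) (simp add: tensor_spin.rep_eq)

lemma spin_component_add: "spin_component (v + w) s = spin_component v s + spin_component w s"
  and spin_component_scaleC: "spin_component (c *\<^sub>C v) s = c *\<^sub>C spin_component v s"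
  and spin_component_tensor_spin: "spin_component (u \<otimes>\<^sub>s t) s = (if s = t then u else 0)"
  by (rule ell2_eqI; simp add: coord_spin_component coord_add coord_scaleC coord_scaleR
      coord_tensor_spin coord_zero)+

lemma tensor_spin_add: "(u + v) \<otimes>\<^sub>s s = u \<otimes>\<^sub>s s + v \<otimes>\<^sub>s s"
  and tensor_spin_scaleR: "(r *\<^sub>R v) \<otimes>\<^sub>s s = r *\<^sub>R (v \<otimes>\<^sub>s s)"
  by (rule ell2_eqI; simp add: coord_add coord_scaleC coord_scaleR coord_tensor_spin coord_zero)+

lemma spin_eqI: "(\<And>s. spin_component v s = spin_component w s) \<Longrightarrow> v = w"
  by (rule ell2_eqI) (metis coord_spin_component surj_pair)

lemma spin_component_tensor_id: "spin_component (tensor_id T v) s = T (spin_component v s)"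
  by (cases s) (simp_all add: tensor_id_def spin_component_add spin_component_tensor_spin)

lemma cinner_spin:
  "cinner v w = cinner (spin_component v Minus) (spin_component w Minus) +
     cinner (spin_component v Plus) (spin_component w Plus)"
proof -
  have UNIV: "(UNIV :: ('a \<times> spin) set) = range (\<lambda>i. (i, Minus)) \<union> range (\<lambda>i. (i, Plus))"
  proof -
    have "p \<in> range (\<lambda>i. (i, Minus)) \<union> range (\<lambda>i. (i, Plus))" for p :: "'a \<times> spin"
      by (cases p; cases "snd p") auto
    thus ?thesis by auto
  qed
  let ?f = "\<lambda>p. cnj (coord v p) * coord w p"
  have "cinner v w = infsum ?f (range (\<lambda>i. (i, Minus))) + infsum ?f (range (\<lambda>i. (i, Plus)))"
    unfolding cinner_def UNIV
    by (rule infsum_Un_disjoint) (auto intro: summable_on_subset[OF cinner_summable])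
  thus ?thesis
    by (simp add: cinner_def coord_spin_component infsum_reindex inj_on_def o_def)
qed

lemma bounded_clin_tensor_id:
  assumes T: "bounded_clin T" shows "bounded_clin (tensor_id T)"
proof (rule bounded_clinI[where K = "onorm T"])
  note bl = bounded_clin_linear[OF T]
  have n: "(norm v)\<^sup>2 = (norm (spin_component v Minus))\<^sup>2 + (norm (spin_component v Plus))\<^sup>2"
    for v :: "('c \<times> spin) ell2"
    using cinner_spin[of v v] unfolding cinner_norm of_real_add[symmetric] of_real_eq_iff .
  fix v
  have "(norm (tensor_id T v))\<^sup>2 \<le> (onorm T * norm (spin_component v Minus))\<^sup>2 +
      (onorm T * norm (spin_component v Plus))\<^sup>2"
    unfolding n[of "tensor_id T v"] spin_component_tensor_id
    by (intro add_mono power_mono onorm[OF bl]) auto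
  also have "\<dots> = (onorm T * norm v)\<^sup>2"
    by (simp add: power_mult_distrib n[of v] ring_distribs)
  finally show "norm (tensor_id T v) \<le> onorm T * norm v"
    by (rule power2_le_imp_le) (simp add: onorm_pos_le[OF bl])
qed (auto intro!: spin_eqI simp: spin_component_tensor_id spin_component_add spin_component_scaleC
    bounded_clin_add[OF T] bounded_clin_scaleC[OF T])

lemma eq_by_cinner_all: "(\<And>w. cinner v w = cinner v' w) \<Longrightarrow> v = v'"
  by (rule ell2_eqI) (metis cinner_basis_vec cinner_commute)

text \<open>Turns the relation by which \<open>star_representation\<close> describes the involution
  into an equation with \<open>adj\<close>, and gives the algebraic rules for adjoints.\<close>

lemma adj_unique:
  assumes "bounded_clin T" "\<And>v w. cinner (S v) w = cinner v (T w)"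
  shows "S = adj T"
  by (rule ext, rule eq_by_cinner_all) (simp add: assms cinner_adj_left)

lemma adj_plus: "bounded_clin S \<Longrightarrow> bounded_clin T \<Longrightarrow> adj (\<lambda>v. S v + T v) = (\<lambda>v. adj S v + adj T v)"
  by (rule adj_unique[symmetric])
    (auto intro: bounded_clin_plus simp: cinner_add_left cinner_add_right cinner_adj_left)

lemma adj_scaleC: "bounded_clin T \<Longrightarrow> adj (\<lambda>v. c *\<^sub>C T v) = (\<lambda>v. cnj c *\<^sub>C adj T v)"
  by (rule adj_unique[symmetric])
    (auto intro: bounded_clin_scaleC_comp simp: cinner_scaleC_left cinner_scaleC_right cinner_adj_left)

lemma adj_comp: "bounded_clin S \<Longrightarrow> bounded_clin T \<Longrightarrow> adj (\<lambda>v. S (T v)) = (\<lambda>v. adj T (adj S v))"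
  by (rule adj_unique[symmetric]) (auto intro: bounded_clin_compose simp: cinner_adj_left)

lemma adj_id: "adj (\<lambda>v. v) = (\<lambda>v. v)"
  by (rule adj_unique[symmetric]) (auto intro: bounded_clin_id)

lemma adj_zero: "adj (\<lambda>v. 0) = (\<lambda>v. 0)"
  by (rule adj_unique[symmetric]) (auto intro: bounded_clin_const_zero simp: cinner_zero_left cinner_zero_right)

section \<open>The spinor representation, its opposite, and induction from the generators\<close>

context
  fixes q :: real and rep :: "free_alg set \<Rightarrow> hpsi \<Rightarrow> hpsi"
  assumes rep: "star_representation q rep"
begin

lemma bounded_spinor_rep: "x \<in> carrier (suq2 q) \<Longrightarrow> bounded_clin (spinor_rep rep x)"
  using rep by (auto simp: spinor_rep_def star_representation_def bounded_clinear_iff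
      intro: bounded_clin_tensor_id)

lemma spinor_rep_one: "spinor_rep rep \<one>\<^bsub>suq2 q\<^esub> = (\<lambda>v. v)"
  using rep by (auto intro!: ext spin_eqI simp: spinor_rep_def star_representation_def spin_component_tensor_id)

lemma spinor_rep_plus:
  "x \<in> carrier (suq2 q) \<Longrightarrow> y \<in> carrier (suq2 q) \<Longrightarrow>
    spinor_rep rep (x \<oplus>\<^bsub>suq2 q\<^esub> y) = (\<lambda>v. spinor_rep rep x v + spinor_rep rep y v)"
  using rep by (auto intro!: ext spin_eqI
      simp: spinor_rep_def star_representation_def spin_component_tensor_id spin_component_add)

lemma spinor_rep_mult:
  "x \<in> carrier (suq2 q) \<Longrightarrow> y \<in> carrier (suq2 q) \<Longrightarrow>
    spinor_rep rep (x \<otimes>\<^bsub>suq2 q\<^esub> y) = (\<lambda>v. spinor_rep rep x (spinor_rep rep y v))"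
  using rep by (auto intro!: ext spin_eqI
      simp: spinor_rep_def star_representation_def spin_component_tensor_id)

lemma spinor_rep_scale:
  "x \<in> carrier (suq2 q) \<Longrightarrow> spinor_rep rep (suq2_scale q c x) = (\<lambda>v. c *\<^sub>C spinor_rep rep x v)"
  using rep by (auto intro!: ext spin_eqI
      simp: spinor_rep_def star_representation_def spin_component_tensor_id spin_component_scaleC)

lemma spinor_rep_star:
  assumes x: "x \<in> carrier (suq2 q)"
  shows "spinor_rep rep (suq2_star x) = adj (spinor_rep rep x)"
proof (rule adj_unique[OF bounded_spinor_rep[OF x]])
  fix v w
  have "cinner (rep (suq2_star x) u) u' = cinner u (rep x u')" for u u'
    using rep x by (auto simp: star_representation_def)
  thus "cinner (spinor_rep rep (suq2_star x) v) w = cinner v (spinor_rep rep x w)"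
    unfolding cinner_spin[of "spinor_rep rep (suq2_star x) v"] cinner_spin[of v]
    by (simp add: spinor_rep_def spin_component_tensor_id)
qed

lemma spinor_rep_gen_star:
  "spinor_rep rep (suq2_class q (gen (letter_star l))) = adj (spinor_rep rep (suq2_class q (gen l)))"
  by (subst spinor_rep_star[symmetric]) (auto simp: suq2_carrier suq2_star_class free_star_gen)

lemma opposite_rep_eq:
  "x \<in> carrier (suq2 q) \<Longrightarrow>
    opposite_rep J rep x = (\<lambda>v. J (adj (spinor_rep rep x) (inv_into UNIV J v)))"
  by (simp add: opposite_rep_def spinor_rep_star fun_eq_iff)

context
  fixes J L D :: "spinor \<Rightarrow> spinor" and E :: "spinor set" and K
  assumes J: "antiunitary J" and L: "bounded_clin L" and D: "selfadjoint_on E D"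
    and K_def: "K = Idl\<^bsub>bounded_ops\<^esub> {L}"
    and gens: "\<And>l. \<exists>T. bounded_commutator_ext E D (spinor_rep rep (suq2_class q (gen l))) T \<and>
      (\<forall>l'. commutator (opposite_rep J rep (suq2_class q (gen l')))
              (spinor_rep rep (suq2_class q (gen l))) \<in> K \<and>
            commutator (opposite_rep J rep (suq2_class q (gen l'))) T \<in> K)"
begin

abbreviation "op_gen l \<equiv> opposite_rep J rep (suq2_class q (gen l))"

lemma bounded_opposite_rep: "x \<in> carrier (suq2 q) \<Longrightarrow> bounded_clin (opposite_rep J rep x)"
  by (simp add: opposite_rep_eq bounded_clin_conj[OF J] bounded_clin_adj bounded_spinor_rep)

text \<open>Induction on y, with the opposite factor running over the generators. Both memberships
  are carried together, with one \<open>T\<close> for all letters: for a product of x and y the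
  extension is S \<pi>'(y) + \<pi>'(x) T, and its commutator involves those of \<pi>'(x) and
  \<pi>'(y) as well as those of \<open>S\<close> and \<open>T\<close>.\<close>

lemma spinor_rep_commutators:
  assumes "y \<in> carrier (suq2 q)"
  shows "\<exists>T. bounded_commutator_ext E D (spinor_rep rep y) T \<and>
    (\<forall>l. commutator (op_gen l) (spinor_rep rep y) \<in> K \<and> commutator (op_gen l) T \<in> K)"
  using assms
proof (induction y rule: suq2_induct)
  case (1 l) show ?case by (rule gens)
next
  case 2
  have "commutator (op_gen l) (\<lambda>v. v) = (\<lambda>v. 0)" "commutator (op_gen l) (\<lambda>v. 0) = (\<lambda>v. 0)" for l
    using bounded_clin_zero[OF bounded_opposite_rep] by (auto simp: commutator_def suq2_carrier)
  thus ?case unfolding spinor_rep_one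
    using bounded_commutator_ext_id K_zero[OF L K_def] by metis
next
  case (3 x y)
  from 3 obtain S T where ST:
    "bounded_commutator_ext E D (spinor_rep rep x) S" "bounded_commutator_ext E D (spinor_rep rep y) T"
    "\<And>l. commutator (op_gen l) (spinor_rep rep x) \<in> K" "\<And>l. commutator (op_gen l) S \<in> K"
    "\<And>l. commutator (op_gen l) (spinor_rep rep y) \<in> K" "\<And>l. commutator (op_gen l) T \<in> K"
    by blast
  show ?case unfolding spinor_rep_plus[OF 3(1,2)]
    by (rule exI[of _ "\<lambda>v. S v + T v"])
      (auto intro!: bounded_commutator_ext_plus[OF D] ST commutator_K_plus_right[OF L K_def]
        bounded_opposite_rep simp: suq2_carrier)
next
  case (4 x y)
  from 4 obtain S T where ST:
    "bounded_commutator_ext E D (spinor_rep rep x) S" "bounded_commutator_ext E D (spinor_rep rep y) T"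
    "\<And>l. commutator (op_gen l) (spinor_rep rep x) \<in> K" "\<And>l. commutator (op_gen l) S \<in> K"
    "\<And>l. commutator (op_gen l) (spinor_rep rep y) \<in> K" "\<And>l. commutator (op_gen l) T \<in> K"
    by blast
  have b: "bounded_clin S" "bounded_clin T"
    using ST by (auto simp: bounded_commutator_ext_def bounded_clinear_iff)
  note b' = bounded_spinor_rep[OF 4(1)] bounded_spinor_rep[OF 4(2)]
  have bo: "bounded_clin (op_gen l)" for l by (simp add: bounded_opposite_rep suq2_carrier)
  show ?case unfolding spinor_rep_mult[OF 4(1,2)]
    using bounded_commutator_ext_comp[OF ST(1,2) b'] commutator_K_comp_right[OF L K_def bo b' ST(3,5)]
      commutator_K_plus_right[OF L K_def bo commutator_K_comp_right[OF L K_def bo b(1) b'(2) ST(4,5)]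
        commutator_K_comp_right[OF L K_def bo b'(1) b(2) ST(3,6)]]
    by blast
next
  case (5 x c)
  from 5 obtain S where S: "bounded_commutator_ext E D (spinor_rep rep x) S"
    "\<And>l. commutator (op_gen l) (spinor_rep rep x) \<in> K" "\<And>l. commutator (op_gen l) S \<in> K"
    by blast
  show ?case unfolding spinor_rep_scale[OF 5(1)]
    by (rule exI[of _ "\<lambda>v. c *\<^sub>C S v"])
      (auto intro!: bounded_commutator_ext_scaleC[OF D] S commutator_K_scale_right[OF L K_def]
        bounded_opposite_rep simp: suq2_carrier)
qed

text \<open>A second induction, now on the opposite factor and for any bounded \<open>Y\<close>. The
  opposite representation is complex linear, because the adjoint and \<open>J\<close> each conjugate
  scalars, and it reverses products, because only the adjoint does.\<close>

lemma opposite_rep_commutator: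
  assumes Y: "bounded_clin Y" and gen: "\<And>l. commutator (op_gen l) Y \<in> K" and x: "x \<in> carrier (suq2 q)"
  shows "commutator (opposite_rep J rep x) Y \<in> K"
  using x
proof (induction x rule: suq2_induct)
  case (1 l) show ?case by (rule gen)
next
  case 2
  have "opposite_rep J rep \<one>\<^bsub>suq2 q\<^esub> = (\<lambda>v. v)"
    by (simp add: opposite_rep_eq suq2_class_one suq2_carrier)
      (simp add: suq2_class_one[symmetric] spinor_rep_one adj_id antiunitary_inv[OF J])
  hence "commutator (opposite_rep J rep \<one>\<^bsub>suq2 q\<^esub>) Y = (\<lambda>v. 0)" by (auto simp: commutator_def)
  thus ?case using K_zero[OF L K_def] by simp
next
  case (3 x y)
  have J_add: "J (v + w) = J v + J w" for v w using J by (auto simp: antiunitary_def)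
  have "x \<oplus>\<^bsub>suq2 q\<^esub> y \<in> carrier (suq2 q)" using 3(1,2)
    by (auto simp: suq2_carrier suq2_class_plus[symmetric])
  hence "opposite_rep J rep (x \<oplus>\<^bsub>suq2 q\<^esub> y) = (\<lambda>v. opposite_rep J rep x v + opposite_rep J rep y v)"
    by (simp add: opposite_rep_eq 3(1,2) spinor_rep_plus adj_plus bounded_spinor_rep J_add)
  thus ?case using commutator_K_plus_left[OF L K_def Y 3(3,4)] by simp
next
  case (4 x y)
  have "x \<otimes>\<^bsub>suq2 q\<^esub> y \<in> carrier (suq2 q)" using 4(1,2)
    by (auto simp: suq2_carrier suq2_class_mult[symmetric])
  hence "opposite_rep J rep (x \<otimes>\<^bsub>suq2 q\<^esub> y) = (\<lambda>v. opposite_rep J rep y (opposite_rep J rep x v))"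
    by (simp add: opposite_rep_eq 4(1,2) spinor_rep_mult adj_comp bounded_spinor_rep antiunitary_inv[OF J])
  thus ?case
    using commutator_K_comp_left[OF L K_def Y bounded_opposite_rep[OF 4(2)] bounded_opposite_rep[OF 4(1)] 4(4,3)]
    by simp
next
  case (5 x c)
  have J_scale: "J (c *\<^sub>C v) = cnj c *\<^sub>C J v" for c v using J by (auto simp: antiunitary_def)
  have "suq2_scale q c x \<in> carrier (suq2 q)" using 5(1)
    by (auto simp: suq2_carrier suq2_class_scale[symmetric])
  hence "opposite_rep J rep (suq2_scale q c x) = (\<lambda>v. c *\<^sub>C opposite_rep J rep x v)"
    by (simp add: opposite_rep_eq 5(1) spinor_rep_scale adj_scaleC bounded_spinor_rep J_scale)
  thus ?case using commutator_K_scale_left[OF L K_def Y 5(2)] by simp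
qed

lemma commutators_from_generators:
  "\<forall>x\<in>carrier (suq2 q). \<forall>y\<in>carrier (suq2 q).
     commutator (opposite_rep J rep x) (spinor_rep rep y) \<in> K \<and>
     (\<exists>T. bounded_commutator_ext E D (spinor_rep rep y) T \<and> commutator (opposite_rep J rep x) T \<in> K)"
  (is "\<forall>x\<in>_. \<forall>y\<in>_. ?P x y")
proof (intro ballI)
  fix x y assume x: "x \<in> carrier (suq2 q)" and y: "y \<in> carrier (suq2 q)"
  obtain T where T: "bounded_commutator_ext E D (spinor_rep rep y) T"
    "\<And>l. commutator (op_gen l) (spinor_rep rep y) \<in> K" "\<And>l. commutator (op_gen l) T \<in> K"
    using spinor_rep_commutators[OF y] by blast
  have "bounded_clin T" using T(1) by (simp add: bounded_commutator_ext_def bounded_clinear_iff)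
  thus "?P x y"
    using opposite_rep_commutator[OF bounded_spinor_rep[OF y] T(2) x]
      opposite_rep_commutator[OF _ T(3) x] T(1) by blast
qed

end

end

section \<open>Finite sums of operators\<close>

text \<open>A generator is a sum of shifts by different vectors, which no single weight describes;
  membership in such a set of sums lets all properties be checked on the summands.\<close>

inductive_set op_sums :: "('k ell2 \<Rightarrow> 'k ell2) set \<Rightarrow> ('k ell2 \<Rightarrow> 'k ell2) set" for A where
  zero: "(\<lambda>v. 0) \<in> op_sums A"
| plus: "S \<in> A \<Longrightarrow> T \<in> op_sums A \<Longrightarrow> (\<lambda>v. S v + T v) \<in> op_sums A"

lemma op_sums_bounded:
  "T \<in> op_sums A \<Longrightarrow> (\<And>S. S \<in> A \<Longrightarrow> bounded_clin S) \<Longrightarrow> bounded_clin T"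
  by (induction rule: op_sums.induct) (auto intro: bounded_clin_const_zero bounded_clin_plus)

lemma op_sums_mono: "T \<in> op_sums A \<Longrightarrow> (\<And>S. S \<in> A \<Longrightarrow> S \<in> B) \<Longrightarrow> T \<in> op_sums B"
  by (induction rule: op_sums.induct) (auto intro: op_sums.intros)

lemma op_sums_adj:
  assumes "T \<in> op_sums A" "\<And>S. S \<in> A \<Longrightarrow> bounded_clin S" "\<And>S. S \<in> A \<Longrightarrow> adj S \<in> B"
  shows "adj T \<in> op_sums B"
  using assms(1)
proof induction
  case (plus S T)
  thus ?case using op_sums_bounded[of T A] assms(2,3) by (simp add: adj_plus op_sums.plus)
qed (simp add: adj_zero op_sums.zero)

lemma op_sums_conj:
  assumes J: "antiunitary J" and "T \<in> op_sums A"
    "\<And>S. S \<in> A \<Longrightarrow> (\<lambda>v. J (S (inv_into UNIV J v))) \<in> B"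
  shows "(\<lambda>v. J (T (inv_into UNIV J v))) \<in> op_sums B"
  using assms(2)
proof induction
  case zero
  have "J 0 = 0" using antiunitary_norm[OF J, of 0] by simp
  thus ?case by (simp add: op_sums.zero)
next
  case (plus S T)
  have "J (v + w) = J v + J w" for v w using J by (auto simp: antiunitary_def)
  thus ?case using plus assms(3)[of S] op_sums.plus by simp
qed

lemma op_sums_commutator_ext:
  assumes D: "selfadjoint_on E D" and "Y \<in> op_sums A"
    "\<And>S. S \<in> A \<Longrightarrow> \<exists>T\<in>B. bounded_commutator_ext E D S T"
  shows "\<exists>T\<in>op_sums B. bounded_commutator_ext E D Y T"
  using assms(2)
proof induction
  case zero
  have "bounded_commutator_ext E D (\<lambda>v. 0) (\<lambda>v. 0)"
    using bounded_commutator_ext_scaleC[OF D bounded_commutator_ext_id, of 0]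
    by (simp add: scaleC_zero_left)
  thus ?case using op_sums.zero by blast
next
  case (plus S Y)
  then obtain S' T' where "S' \<in> B" "bounded_commutator_ext E D S S'"
    "T' \<in> op_sums B" "bounded_commutator_ext E D Y T'" using assms(3) by blast
  thus ?case using op_sums.plus bounded_commutator_ext_plus[OF D] by blast
qed

lemma op_sums_commutator:
  assumes L: "bounded_clin L" and K_def: "K = Idl\<^bsub>bounded_ops\<^esub> {L}"
    and X: "X \<in> op_sums A" and Y: "Y \<in> op_sums B"
    and bd: "\<And>S. S \<in> A \<Longrightarrow> bounded_clin S" "\<And>S. S \<in> B \<Longrightarrow> bounded_clin S"
    and AB: "\<And>S T. S \<in> A \<Longrightarrow> T \<in> B \<Longrightarrow> commutator S T \<in> K"
  shows "commutator X Y \<in> K"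
proof -
  have S: "commutator S Y \<in> K" if "S \<in> A" for S
    using Y
  proof induction
    case zero
    have "commutator S (\<lambda>v. 0) = (\<lambda>v. 0)"
      using bounded_clin_zero[OF bd(1)[OF that]] by (auto simp: commutator_def)
    thus ?case using K_zero[OF L K_def] by simp
  next
    case (plus T Y)
    thus ?case using commutator_K_plus_right[OF L K_def bd(1)[OF that]] AB[OF that] by blast
  qed
  from X show ?thesis
  proof induction
    case zero
    have "commutator (\<lambda>v. 0) Y = (\<lambda>v. 0)"
      using bounded_clin_zero[OF op_sums_bounded[OF Y bd(2)]] by (auto simp: commutator_def)
    thus ?case using K_zero[OF L K_def] by simp
  next
    case (plus T X)
    thus ?case using commutator_K_plus_left[OF L K_def op_sums_bounded[OF Y bd(2)]] S by blast
  qed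
qed

section \<open>The spinor basis\<close>

locale deformation =
  fixes q :: real
  assumes q_pos: "0 < q" and q_less_1: "q < 1"
begin

section \<open>Powers of q and square roots of q-numbers\<close>

lemma powi_pos: "0 < q powi n"
  using q_pos by simp

lemma powi_add: "q powi (m + n) = q powi m * q powi n"
  using q_pos by (simp add: power_int_add)

lemma powi_diff: "q powi (m - n) = q powi m / q powi n"
  using q_pos by (simp add: power_int_diff)

lemma powr_eq_powi: "q powr real_of_int n = q powi n"
  using q_pos by (simp add: powr_real_of_int')

lemma powi_le_1: "0 \<le> n \<Longrightarrow> q powi n \<le> 1"
  using q_pos q_less_1 by (simp add: power_int_le_one)

lemma powi_less_1: "0 < n \<Longrightarrow> q powi n < 1"
  using q_pos q_less_1 power_int_strict_decreasing[of 0 n q] by simp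

text \<open>The square root of [n] without its power of q and without the normalisation
  \<open>rt 1\<close>, see \<open>sqrt_qnum\<close>. For n \<ge> 0 it lies between 0 and 1, and it
  tends to 1, so each coefficient splits into a power of q and a harmless part.\<close>

definition rt :: "int \<Rightarrow> real"
  where "rt n = sqrt (1 - (q powi n)\<^sup>2)"

lemma rt_0 [simp]: "rt 0 = 0"
  by (simp add: rt_def)

lemma rt_pos: "0 < n \<Longrightarrow> 0 < rt n"
  using powi_less_1[of n] powi_pos[of n] by (simp add: rt_def power_less_one_iff)

lemma rt_nonneg: "0 \<le> n \<Longrightarrow> 0 \<le> rt n"
  using powi_le_1[of n] powi_pos[of n] by (simp add: rt_def power_le_one)

lemma rt_sq: "0 \<le> n \<Longrightarrow> (rt n)\<^sup>2 = 1 - (q powi n)\<^sup>2"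
  using powi_le_1[of n] powi_pos[of n] by (simp add: rt_def power_le_one)

lemma rt_le_1: "rt n \<le> 1"
  by (simp add: rt_def)

lemma sqrt_qnum:
  assumes "0 \<le> n"
  shows "sqrt (qnum q (real_of_int n)) = q powr ((1 - real_of_int n) / 2) * rt n / rt 1"
proof -
  have q1: "0 < 1 - q\<^sup>2" using q_pos q_less_1 by (simp add: power_less_one_iff)
  have "qnum q (real_of_int n) = q powi (1 - n) * (1 - (q powi n)\<^sup>2) / (1 - q\<^sup>2)"
  proof -
    have "q powr real_of_int n = q powi n" "q powr (- real_of_int n) = inverse (q powi n)"
      by (simp_all add: powr_eq_powi powr_minus)
    hence "qnum q (real_of_int n) = (q powi n - inverse (q powi n)) / (q - inverse q)"
      by (simp add: qnum_def)
    also have "\<dots> = (q / q powi n) * (1 - (q powi n)\<^sup>2) / (1 - q\<^sup>2)"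
      using q_pos powi_pos[of n] q1 q_less_1
      by (simp add: divide_simps power2_eq_square) (simp add: algebra_simps power2_eq_square)
    finally show ?thesis by (simp add: powi_diff)
  qed
  moreover have "sqrt (q powi (1 - n)) = q powr ((1 - real_of_int n) / 2)"
  proof (rule real_sqrt_unique)
    show "(q powr ((1 - real_of_int n) / 2))\<^sup>2 = q powi (1 - n)"
      by (simp add: power2_eq_square powr_add[symmetric] powr_eq_powi[symmetric])
  qed simp
  ultimately show ?thesis
    by (simp add: rt_def real_sqrt_mult real_sqrt_divide)
qed

section \<open>Kets in the integer coordinates L = 2l, X = l + m, Y = l + n\<close>

definition k3 :: "int \<Rightarrow> int \<Rightarrow> int \<Rightarrow> hpsi"
  where "k3 L X Y = ket (L / 2) (X - L / 2) (Y - L / 2)"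

abbreviation half :: "int \<Rightarrow> real" where "half n \<equiv> real_of_int n / 2"

lemma half_int_in_half_nats: "half L \<in> half_nats \<longleftrightarrow> 0 \<le> L"
proof
  assume "half L \<in> half_nats"
  then obtain k :: nat where "half L = real k / 2" by (auto simp: half_nats_def)
  thus "0 \<le> L" by simp
next
  assume "0 \<le> L"
  thus "half L \<in> half_nats"
    unfolding half_nats_def by (auto intro!: exI[of _ "nat L"])
qed

lemma steps_iff: "real_of_int X - half L \<in> steps (half L) \<longleftrightarrow> 0 \<le> X \<and> X \<le> L"
proof
  assume "real_of_int X - half L \<in> steps (half L)"
  then obtain k :: nat where "real_of_int X = real k" "real k \<le> real_of_int L"
    by (auto simp: steps_def field_simps)
  thus "0 \<le> X \<and> X \<le> L" by linarith
next
  assume "0 \<le> X \<and> X \<le> L"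
  thus "real_of_int X - half L \<in> steps (half L)"
    unfolding steps_def by (auto intro!: exI[of _ "nat X"])
qed

lemma half_int_indices:
  assumes "0 \<le> X" "X \<le> L" "0 \<le> Y" "Y \<le> L"
  shows "half L \<in> half_nats" "real_of_int X - half L \<in> steps (half L)"
    "real_of_int Y - half L \<in> steps (half L)"
  unfolding half_int_in_half_nats steps_iff using assms by auto

lemma k3_eq:
  "k3 L X Y = (if 0 \<le> X \<and> X \<le> L \<and> 0 \<le> Y \<and> Y \<le> L
    then basis_vec (Abs_lmn (L / 2, X - L / 2, Y - L / 2)) else 0)"
  unfolding k3_def ket_def half_int_in_half_nats steps_iff by auto

lemma cinner_k3:
  "cinner (k3 L X Y) (k3 L' X' Y') =
    (if L = L' \<and> X = X' \<and> Y = Y' \<and> 0 \<le> X \<and> X \<le> L \<and> 0 \<le> Y \<and> Y \<le> L then 1 else 0)"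
proof (cases "(0 \<le> X \<and> X \<le> L \<and> 0 \<le> Y \<and> Y \<le> L) \<and> (0 \<le> X' \<and> X' \<le> L' \<and> 0 \<le> Y' \<and> Y' \<le> L')")
  case True
  hence "Abs_lmn (half L, X - half L, Y - half L) =
      Abs_lmn (half L', X' - half L', Y' - half L') \<longleftrightarrow>
      (half L, X - half L, Y - half L) =
      (half L', X' - half L', Y' - half L')"
    by (intro Abs_lmn_inject) (simp_all add: half_int_in_half_nats steps_iff)
  thus ?thesis using True by (auto simp: k3_eq cinner_basis_vec coord_basis_vec)
qed (auto simp: k3_eq cinner_zero_left cinner_zero_right)

lemma basis_vec_is_k3: obtains L X Y where "basis_vec i = k3 L X Y" "0 \<le> X" "X \<le> L" "0 \<le> Y" "Y \<le> L"
proof (cases i)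
  case (Abs_lmn p)
  then obtain l m n where p: "i = Abs_lmn (l, m, n)" "l \<in> half_nats" "m \<in> steps l" "n \<in> steps l" by auto
  obtain L :: nat where L: "l = real L / 2" using p by (auto simp: half_nats_def)
  obtain X :: nat where X: "m = - l + real X" "- l + real X \<le> l" using p by (auto simp: steps_def)
  obtain Y :: nat where Y: "n = - l + real Y" "- l + real Y \<le> l" using p by (auto simp: steps_def)
  have XY: "X \<le> L" "Y \<le> L" using X Y L by auto
  hence "k3 (int L) (int X) (int Y) = basis_vec i"
    by (simp add: k3_eq p L X Y)
  thus ?thesis using that[of "int L" "int X" "int Y"] XY by simp
qed

text \<open>The coefficients C and S at j = N/2 and \<mu> = x - N/2, with q-numbers reduced to
  \<open>rt\<close>. The up versions are those at j + 1, that is, at N + 2 and x + 1.\<close>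

definition c_up :: "int \<Rightarrow> int \<Rightarrow> real" where "c_up N x = rt (N - x + 1) / rt (N + 2)"
definition s_up :: "int \<Rightarrow> int \<Rightarrow> real" where "s_up N x = q powi (N - x + 1) * rt (x + 1) / rt (N + 2)"
definition c_dn :: "int \<Rightarrow> int \<Rightarrow> real" where "c_dn N x = rt (N - x) / rt N"
definition s_dn :: "int \<Rightarrow> int \<Rightarrow> real" where "s_dn N x = q powi (N - x) * rt x / rt N"

lemma up_eq_dn: "c_up N x = c_dn (N + 2) (x + 1)" "s_up N x = s_dn (N + 2) (x + 1)"
  by (simp_all add: c_up_def c_dn_def s_up_def s_dn_def add.commute add_diff_eq)

text \<open>1 - q^(2(N - x)) + q^(2(N - x)) (1 - q^(2x)) = 1 - q^(2N). So \<open>c_dn\<close> and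
  \<open>s_dn\<close> are the entries of a rotation.\<close>

lemma cos_sin_sq: "0 \<le> x \<Longrightarrow> x \<le> N \<Longrightarrow> 0 < N \<Longrightarrow> (c_dn N x)\<^sup>2 + (s_dn N x)\<^sup>2 = 1"
proof -
  assume *: "0 \<le> x" "x \<le> N" "0 < N"
  have "q powi N = q powi (N - x) * q powi x" by (simp flip: powi_add)
  hence "(rt (N - x))\<^sup>2 + (q powi (N - x) * rt x)\<^sup>2 = (rt N)\<^sup>2"
    using * by (simp add: rt_sq power_mult_distrib algebra_simps)
  thus ?thesis using rt_pos[OF *(3)]
    by (simp add: c_dn_def s_dn_def power_divide flip: add_divide_distrib)
qed

text \<open>The vectors $|j\mu n\uparrow\rangle$ (\<open>s = 1\<close>) and $|j\mu n\downarrow\rangle$ (\<open>s = -1\<close>) are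
  indexed by \<open>s\<close> and the integers \<open>N\<close>, \<open>x\<close>, \<open>y\<close> standing for $2j$, $j+\mu$, $j+\frac s2+n$.\<close>

type_synonym index = "int \<times> int \<times> int \<times> int"

definition V :: "index set"
  where "V = {(s, N, x, y). (s = 1 \<or> s = - 1) \<and> 0 \<le> x \<and> x \<le> N \<and> 0 \<le> y \<and> y \<le> N + s}"

definition e_up :: "int \<Rightarrow> int \<Rightarrow> int \<Rightarrow> spinor"
  where "e_up N x y = - s_up N x *\<^sub>R (k3 (N + 1) (x + 1) y \<otimes>\<^sub>s Minus) + c_up N x *\<^sub>R (k3 (N + 1) x y \<otimes>\<^sub>s Plus)"

definition e_dn :: "int \<Rightarrow> int \<Rightarrow> int \<Rightarrow> spinor"
  where "e_dn N x y = c_dn N x *\<^sub>R (k3 (N - 1) x y \<otimes>\<^sub>s Minus) + s_dn N x *\<^sub>R (k3 (N - 1) (x - 1) y \<otimes>\<^sub>s Plus)"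

text \<open>The case distinction also removes s = 3 and s = - 3, which the translations by 2 and - 2
  in the first coordinate reach.\<close>

definition e :: "index \<Rightarrow> spinor"
  where "e = (\<lambda>(s, N, x, y). if (s, N, x, y) \<in> V then if s = 1 then e_up N x y else e_dn N x y else 0)"

lemma e_up_eq: "0 \<le> x \<Longrightarrow> x \<le> N \<Longrightarrow> 0 \<le> y \<Longrightarrow> y \<le> N + 1 \<Longrightarrow> e (1, N, x, y) = e_up N x y"
  and e_dn_eq: "0 \<le> x \<Longrightarrow> x \<le> N \<Longrightarrow> 0 \<le> y \<Longrightarrow> y \<le> N - 1 \<Longrightarrow> e (- 1, N, x, y) = e_dn N x y"
  by (simp_all add: e_def V_def)

text \<open>The prefactor q^(- x/2) cancels against the powers of q in the roots of [N - x] and [N],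
  so C has no decay. In S the power q^(N - x) survives.\<close>

lemma C_coef_eq:
  assumes "0 \<le> N - x" "0 \<le> N"
  shows "C_coef q (half N) (x - half N) = c_dn N x"
proof -
  have r: "half N - (x - half N) = real_of_int (N - x)"
    "2 * (half N) = real_of_int N" by simp_all
  have "C_coef q (half N) (x - half N) =
     q powr (- real_of_int x / 2) * (q powr ((1 - real_of_int (N - x)) / 2) / q powr ((1 - real_of_int N) / 2)) *
     c_dn N x"
    unfolding C_coef_def r sqrt_qnum[OF assms(1)] sqrt_qnum[OF assms(2)] c_dn_def
    using rt_pos[of 1] by simp
  also have "q powr (- real_of_int x / 2) *
      (q powr ((1 - real_of_int (N - x)) / 2) / q powr ((1 - real_of_int N) / 2)) = q powr 0"
    unfolding powr_diff[symmetric] powr_add[symmetric] by (rule arg_cong[of _ _ "(powr) q"]) (simp add: field_simps)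
  finally show ?thesis using q_pos by simp
qed

lemma S_coef_eq:
  assumes "0 \<le> x" "0 \<le> N"
  shows "S_coef q (half N) (x - half N) = s_dn N x"
proof -
  have r: "half N + (x - half N) = real_of_int x"
    "2 * (half N) = real_of_int N" by simp_all
  have "S_coef q (half N) (x - half N) =
     q powr ((N - real_of_int x) / 2) * (q powr ((1 - real_of_int x) / 2) / q powr ((1 - real_of_int N) / 2)) *
     (rt x / rt N)"
    unfolding S_coef_def r sqrt_qnum[OF assms(1)] sqrt_qnum[OF assms(2)]
    using rt_pos[of 1] by simp
  also have "q powr ((N - real_of_int x) / 2) *
      (q powr ((1 - real_of_int x) / 2) / q powr ((1 - real_of_int N) / 2)) = q powr real_of_int (N - x)"
    unfolding powr_diff[symmetric] powr_add[symmetric] by (rule arg_cong[of _ _ "(powr) q"]) (simp add: field_simps)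
  finally show ?thesis unfolding s_dn_def powr_eq_powi by simp
qed

lemma ket_up_eq:
  assumes "0 \<le> x" "x \<le> N"
  shows "ket_up q (N / 2) (x - N / 2) (y - (N + 1) / 2) = e_up N x y"
proof -
  have r: "half N + 1 = half (N + 2)"
    "real_of_int x - half N = real_of_int (x + 1) - half (N + 2)"
    by (simp_all add: field_simps)
  have "C_coef q (half N + 1) (x - half N) = c_up N x"
    "S_coef q (half N + 1) (x - half N) = s_up N x"
    unfolding r up_eq_dn by (rule C_coef_eq S_coef_eq; use assms in simp)+
  moreover have "ket (half N + 1 / 2) (x - half N + 1 / 2) (y - (real_of_int N + 1) / 2) =
      k3 (N + 1) (x + 1) y"
    "ket (half N + 1 / 2) (x - half N - 1 / 2) (y - (real_of_int N + 1) / 2) =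
      k3 (N + 1) x y"
    by (simp_all add: k3_def add_divide_distrib algebra_simps)
  ultimately show ?thesis by (simp add: ket_up_def e_up_def)
qed

lemma ket_dn_eq:
  assumes "0 \<le> x" "x \<le> N"
  shows "ket_dn q (N / 2) (x - N / 2) (y - (N - 1) / 2) = e_dn N x y"
proof -
  have "C_coef q (half N) (x - half N) = c_dn N x"
    "S_coef q (half N) (x - half N) = s_dn N x"
    by (rule C_coef_eq S_coef_eq; use assms in simp)+
  moreover have "ket (half N - 1 / 2) (x - half N + 1 / 2) (y - (real_of_int N - 1) / 2) =
      k3 (N - 1) x y"
    "ket (half N - 1 / 2) (x - half N - 1 / 2) (y - (real_of_int N - 1) / 2) =
      k3 (N - 1) (x - 1) y"
    by (simp_all add: k3_def diff_divide_distrib algebra_simps)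
  ultimately show ?thesis by (simp add: ket_dn_def e_dn_def)
qed

lemma cinner_tensor_spin: "cinner (u \<otimes>\<^sub>s s) (v \<otimes>\<^sub>s t) = (if s = t then cinner u v else 0)"
  unfolding cinner_spin spin_component_tensor_spin
  by (cases s; cases t) (simp_all add: cinner_zero_left cinner_zero_right)

lemmas cinner_simps = cinner_add_left cinner_add_right cinner_scaleR_left cinner_scaleR_right
  cinner_tensor_spin cinner_k3

lemma cinner_up_up:
  assumes "0 \<le> x" "x \<le> N" "0 \<le> y" "y \<le> N + 1"
  shows "cinner (e_up N x y) (e_up N' x' y') = (if N = N' \<and> x = x' \<and> y = y' then 1 else 0)"
proof -
  have "complex_of_real ((c_up N x)\<^sup>2 + (s_up N x)\<^sup>2) = 1"
    unfolding up_eq_dn by (subst cos_sin_sq) (use assms in auto)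
  thus ?thesis using assms
    by (auto simp: e_up_def cinner_simps power2_eq_square add.commute simp del: scaleR_minus_left)
qed

text \<open>Where the two vectors involve the same kets, \<open>up_eq_dn\<close> makes their
  coefficient pairs (- s, c) and (c, s).\<close>

lemma cinner_up_dn: "0 \<le> x \<Longrightarrow> x \<le> N \<Longrightarrow> cinner (e_up N x y) (e_dn N' x' y') = 0"
  by (auto simp: e_up_def e_dn_def cinner_simps up_eq_dn add.commute mult.commute simp del: scaleR_minus_left)

lemma cinner_dn_dn:
  assumes "0 \<le> x" "x \<le> N" "0 \<le> y" "y \<le> N - 1"
  shows "cinner (e_dn N x y) (e_dn N' x' y') = (if N = N' \<and> x = x' \<and> y = y' then 1 else 0)"
proof -
  have *: "complex_of_real ((c_dn N x)\<^sup>2 + (s_dn N x)\<^sup>2) = 1"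
    by (subst cos_sin_sq) (use assms in auto)
  have z: "c_dn N N = 0" "s_dn N 0 = 0" by (simp_all add: c_dn_def s_dn_def)
  show ?thesis using assms * z
    by (cases "x = 0"; cases "x = N") (auto simp: e_dn_def cinner_simps power2_eq_square)
qed

text \<open>The inverse rotation, in the plane spanned by the kets with X, \<open>Minus\<close> and
  with X - 1, \<open>Plus\<close>. It is what makes the spinor vectors total.\<close>

lemma k3_Minus:
  assumes "0 \<le> X" "X \<le> L" "0 \<le> Y" "Y \<le> L"
  shows "k3 L X Y \<otimes>\<^sub>s Minus =
    - s_dn (L + 1) X *\<^sub>R e (1, L - 1, X - 1, Y) + c_dn (L + 1) X *\<^sub>R e (- 1, L + 1, X, Y)"
proof -
  \<comment> \<open>At X = 0 the up vector would have x = - 1, but its coefficient contains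
    \<open>rt 0\<close>.\<close>
  have u: "s_dn (L + 1) X *\<^sub>R e (1, L - 1, X - 1, Y) = s_dn (L + 1) X *\<^sub>R e_up (L - 1) (X - 1) Y"
    using assms by (cases "X = 0") (simp_all add: e_up_eq s_dn_def)
  have cs: "(c_dn (L + 1) X)\<^sup>2 + (s_dn (L + 1) X)\<^sup>2 = 1" by (rule cos_sin_sq) (use assms in auto)
  have "- s_dn (L + 1) X *\<^sub>R e_up (L - 1) (X - 1) Y + c_dn (L + 1) X *\<^sub>R e_dn (L + 1) X Y =
      ((c_dn (L + 1) X)\<^sup>2 + (s_dn (L + 1) X)\<^sup>2) *\<^sub>R (k3 L X Y \<otimes>\<^sub>s Minus)"
    by (simp add: e_up_def e_dn_def up_eq_dn algebra_simps power2_eq_square)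
  thus ?thesis using assms by (simp add: u cs e_dn_eq)
qed

lemma k3_Plus:
  assumes "0 \<le> X" "X \<le> L" "0 \<le> Y" "Y \<le> L"
  shows "k3 L X Y \<otimes>\<^sub>s Plus =
    c_dn (L + 1) (X + 1) *\<^sub>R e (1, L - 1, X, Y) + s_dn (L + 1) (X + 1) *\<^sub>R e (- 1, L + 1, X + 1, Y)"
proof -
  \<comment> \<open>At X = L the up vector would have x = N + 1, but its coefficient contains
    \<open>rt 0\<close>.\<close>
  have u: "c_dn (L + 1) (X + 1) *\<^sub>R e (1, L - 1, X, Y) = c_dn (L + 1) (X + 1) *\<^sub>R e_up (L - 1) X Y"
    using assms by (cases "X = L") (simp_all add: e_up_eq c_dn_def)
  have cs: "(c_dn (L + 1) (X + 1))\<^sup>2 + (s_dn (L + 1) (X + 1))\<^sup>2 = 1" by (rule cos_sin_sq) (use assms in auto)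
  have "c_dn (L + 1) (X + 1) *\<^sub>R e_up (L - 1) X Y + s_dn (L + 1) (X + 1) *\<^sub>R e_dn (L + 1) (X + 1) Y =
      ((c_dn (L + 1) (X + 1))\<^sup>2 + (s_dn (L + 1) (X + 1))\<^sup>2) *\<^sub>R (k3 L X Y \<otimes>\<^sub>s Plus)"
    by (simp add: e_up_def e_dn_def up_eq_dn algebra_simps power2_eq_square)
  thus ?thesis using assms by (simp add: u cs e_dn_eq)
qed

lemma basis_vec_pair: "basis_vec (i, s) = basis_vec i \<otimes>\<^sub>s s"
  by (rule ell2_eqI) (auto simp: coord_basis_vec coord_tensor_spin)

sublocale shift_basis e V
proof
  fix i j :: index
  show "cinner (e i) (e j) = (if i = j \<and> i \<in> V then 1 else 0)"
  proof (cases "i \<in> V \<and> j \<in> V")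
    case True
    obtain s N x y s' N' x' y' where ij: "i = (s, N, x, y)" "j = (s', N', x', y')" by (metis surj_pair)
    have dn_up: "cinner (e_dn N x y) (e_up N' x' y') = 0" if "0 \<le> x'" "x' \<le> N'"
      using cinner_commute[of "e_dn N x y" "e_up N' x' y'"] cinner_up_dn[OF that] by simp
    show ?thesis using True unfolding ij
      by (auto simp: V_def e_up_eq e_dn_eq cinner_up_up cinner_up_dn cinner_dn_dn dn_up)
  qed (auto simp: e_def cinner_zero_left cinner_zero_right split: prod.splits)
next
  fix v :: spinor
  assume *: "\<And>i. i \<in> V \<Longrightarrow> cinner (e i) v = 0"
  have ev: "cinner (e i) v = 0" for i
    using * by (cases "i \<in> V") (auto simp: e_def cinner_zero_left split: prod.splits if_splits)
  show "v = 0"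
  proof (rule ell2_eqI)
    fix p :: "lmn \<times> spin"
    obtain i s where p: "p = (i, s)" by (cases p)
    obtain L X Y where i: "basis_vec i = k3 L X Y" "0 \<le> X" "X \<le> L" "0 \<le> Y" "Y \<le> L"
      using basis_vec_is_k3 by blast
    have "cinner (basis_vec i \<otimes>\<^sub>s s) v = 0"
      by (cases s) (simp_all add: i k3_Minus k3_Plus cinner_add_left cinner_scaleR_left ev
          del: scaleR_minus_left)
    thus "coord v p = coord 0 p"
      unfolding p cinner_basis_vec[symmetric] basis_vec_pair by (simp add: cinner_zero_right)
  qed
qed

section \<open>The generators in the spinor basis\<close>

text \<open>The roots of q-numbers contribute half-integral powers of q; the hypothesis on
  \<open>z\<close> says that with the prefactor they add up to an integral one. For A+, A-, B+, B-
  this exponent is 0, X + Y + 1, Y, X.\<close>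

lemma qnum_coef:
  assumes "k' = real_of_int k" "l' = real_of_int l" "m' = real_of_int m" "n' = real_of_int n"
    and "0 \<le> k" "0 \<le> l" "0 \<le> m" "0 \<le> n" and z: "r + (m' + n' - k' - l') / 2 = real_of_int z"
  shows "q powr r * sqrt (qnum q k' * qnum q l' / (qnum q m' * qnum q n')) =
    q powi z * (rt k * rt l / (rt m * rt n))"
proof -
  define A where "A = q powr ((1 - k') / 2) * q powr ((1 - l') / 2) /
     (q powr ((1 - m') / 2) * q powr ((1 - n') / 2))"
  have A: "q powr r * A = q powi z"
    unfolding A_def powr_eq_powi[symmetric] powr_diff[symmetric] powr_add[symmetric] z[symmetric]
    by (rule arg_cong[of _ _ "(powr) q"]) (simp add: field_simps)
  have "sqrt (qnum q k' * qnum q l' / (qnum q m' * qnum q n')) = A *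
    (rt k * rt l / (rt m * rt n))"
    unfolding A_def real_sqrt_divide real_sqrt_mult assms(1-4) sqrt_qnum[OF assms(5)] sqrt_qnum[OF assms(6)]
      sqrt_qnum[OF assms(7)] sqrt_qnum[OF assms(8)]
    using rt_pos[of 1] by (simp add: mult_ac)
  thus ?thesis by (simp only: A mult.assoc[symmetric])
qed

lemma A_plus_eq:
  assumes "0 \<le> X" "X \<le> L" "0 \<le> Y" "Y \<le> L"
  shows "A_plus q (half L) (X - half L) (Y - half L) =
    rt (Y + 1) * rt (X + 1) / (rt (L + 1) * rt (L + 2))"
  unfolding A_plus_def
  by (subst qnum_coef[where k = "X + 1" and l = "Y + 1" and m = "L + 1" and n = "L + 2" and z = "0"])
    (use assms in \<open>simp_all add: powi_add mult_ac, simp_all add: field_simps\<close>)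

lemma A_minus_eq:
  assumes "0 \<le> X" "X \<le> L" "0 \<le> Y" "Y \<le> L"
  shows "A_minus q (half L) (X - half L) (Y - half L) =
    q powi (Y + 1) * rt (L - Y) * q powi X * rt (L - X) / (rt L * rt (L + 1))"
  unfolding A_minus_def
  by (subst qnum_coef[where k = "L - X" and l = "L - Y" and m = "L" and n = "L + 1" and z = "Y + 1 + X"])
    (use assms in \<open>simp_all add: powi_add mult_ac, simp_all add: field_simps\<close>)

lemma B_plus_eq:
  assumes "0 \<le> X" "X \<le> L" "0 \<le> Y" "Y \<le> L"
  shows "B_plus q (half L) (X - half L) (Y - half L) =
    q powi Y * rt (L - Y + 1) * rt (X + 1) / (rt (L + 1) * rt (L + 2))"
  unfolding B_plus_def
  by (subst qnum_coef[where k = "X + 1" and l = "L - Y + 1" and m = "L + 1" and n = "L + 2" and z = "Y"])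
    (use assms in \<open>simp_all add: powi_add mult_ac, simp_all add: field_simps\<close>)

lemma B_minus_eq:
  assumes "0 \<le> X" "X \<le> L" "0 \<le> Y" "Y \<le> L"
  shows "B_minus q (half L) (X - half L) (Y - half L) =
    - rt Y * q powi X * rt (L - X) / (rt L * rt (L + 1))"
  unfolding B_minus_def
  by (subst qnum_coef[where k = "L - X" and l = "Y" and m = "L" and n = "L + 1" and z = "X"])
    (use assms in \<open>simp_all add: powi_add mult_ac, simp_all add: field_simps\<close>)

lemma tensor_id_tensor_spin: "T 0 = 0 \<Longrightarrow> tensor_id T (u \<otimes>\<^sub>s s) = T u \<otimes>\<^sub>s s"
  by (rule spin_eqI) (simp add: spin_component_tensor_id spin_component_tensor_spin)

text \<open>Covers both \<open>a\<close> (\<open>t = 1\<close>) and \<open>b\<close> (\<open>t = 0\<close>).\<close>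

definition gen_action ::
    "(hpsi \<Rightarrow> hpsi) \<Rightarrow> int \<Rightarrow> (int \<Rightarrow> int \<Rightarrow> real) \<Rightarrow> (int \<Rightarrow> int \<Rightarrow> real) \<Rightarrow> bool"
  where "gen_action g t Gp Gm \<longleftrightarrow> bounded_clin g \<and> (t = 0 \<or> t = 1) \<and>
    (\<forall>L X Y. 0 \<le> X \<longrightarrow> X \<le> L \<longrightarrow> 0 \<le> Y \<longrightarrow> Y \<le> L \<longrightarrow>
      g (k3 L X Y) = (Gp L Y * rt (X + 1) / (rt (L + 1) * rt (L + 2))) *\<^sub>R k3 (L + 1) (X + 1) (Y + t) +
        (Gm L Y * q powi X * rt (L - X) / (rt L * rt (L + 1))) *\<^sub>R k3 (L - 1) X (Y + t - 1)) \<and>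
    (\<forall>L Y. 0 \<le> Y \<longrightarrow> Y \<le> L \<longrightarrow> \<not> (0 \<le> Y + t - 1 \<and> Y + t - 1 \<le> L - 1) \<longrightarrow> Gm L Y = 0)"

lemma ket_cong: "l = l' \<Longrightarrow> m = m' \<Longrightarrow> n = n' \<Longrightarrow> ket l m n = ket l' m' n'"
  by simp

text \<open>On the last clause of \<open>gen_action\<close>: the lowering part of a leaves the range
  of Y only at Y = L, where rt (L - Y) = 0, and that of b only at Y = 0, where rt Y = 0.\<close>

lemma gen_action_a:
  assumes "left_regular q rep"
  shows "gen_action (rep (suq2_class q (gen La))) 1 (\<lambda>L Y. rt (Y + 1)) (\<lambda>L Y. q powi (Y + 1) * rt (L - Y))"
proof -
  have "bounded_clin (rep (suq2_class q (gen La)))"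
    using assms by (auto simp: left_regular_def star_representation_def bounded_clinear_iff suq2_carrier)
  moreover have "rep (suq2_class q (gen La)) (k3 L X Y) =
      A_plus q (half L) (X - half L) (Y - half L) *\<^sub>R k3 (L + 1) (X + 1) (Y + 1) +
      A_minus q (half L) (X - half L) (Y - half L) *\<^sub>R k3 (L - 1) X Y"
    if "0 \<le> X" "X \<le> L" "0 \<le> Y" "Y \<le> L" for L X Y
  proof -
    have k: "k3 (L + 1) (X + 1) (Y + 1) = ket (half L + 1 / 2) (X - half L + 1 / 2) (Y - half L + 1 / 2)"
      "k3 (L - 1) X Y = ket (half L - 1 / 2) (X - half L + 1 / 2) (Y - half L + 1 / 2)"
      unfolding k3_def by (rule ket_cong; simp add: field_simps)+
    show ?thesis using assms half_int_indices[OF that] unfolding k k3_def[of L] left_regular_def by blast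
  qed
  ultimately show ?thesis unfolding gen_action_def by (auto simp: A_plus_eq A_minus_eq)
qed

lemma gen_action_b:
  assumes "left_regular q rep"
  shows "gen_action (rep (suq2_class q (gen Lb))) 0 (\<lambda>L Y. q powi Y * rt (L - Y + 1)) (\<lambda>L Y. - rt Y)"
proof -
  have "bounded_clin (rep (suq2_class q (gen Lb)))"
    using assms by (auto simp: left_regular_def star_representation_def bounded_clinear_iff suq2_carrier)
  moreover have "rep (suq2_class q (gen Lb)) (k3 L X Y) =
      B_plus q (half L) (X - half L) (Y - half L) *\<^sub>R k3 (L + 1) (X + 1) Y +
      B_minus q (half L) (X - half L) (Y - half L) *\<^sub>R k3 (L - 1) X (Y - 1)"
    if "0 \<le> X" "X \<le> L" "0 \<le> Y" "Y \<le> L" for L X Y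
  proof -
    have k: "k3 (L + 1) (X + 1) Y = ket (half L + 1 / 2) (X - half L + 1 / 2) (Y - half L - 1 / 2)"
      "k3 (L - 1) X (Y - 1) = ket (half L - 1 / 2) (X - half L + 1 / 2) (Y - half L - 1 / 2)"
      unfolding k3_def by (rule ket_cong; simp add: field_simps)+
    show ?thesis using assms half_int_indices[OF that] unfolding k k3_def[of L] left_regular_def by blast
  qed
  ultimately show ?thesis unfolding gen_action_def by (auto simp: B_plus_eq B_minus_eq)
qed

section \<open>Matrix elements of a generator between spinor vectors\<close>

definition f_raise :: "(int \<Rightarrow> int \<Rightarrow> real) \<Rightarrow> index \<Rightarrow> real"
  where "f_raise Gp = (\<lambda>(s, N, x, y). Gp (N + s) y * rt (x + 1) / (rt (if s = 1 then N + 2 else N + 1))\<^sup>2)"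

definition f_lower :: "(int \<Rightarrow> int \<Rightarrow> real) \<Rightarrow> index \<Rightarrow> real"
  where "f_lower Gm = (\<lambda>(s, N, x, y).
    Gm (N + s) y * q powi x * rt (N - x) / (rt (if s = 1 then N + 1 else N))\<^sup>2)"

text \<open>As j changes by 1/2 only, an up vector can become a down vector only when l is lowered,
  and a down vector an up vector only when l is raised. Hence \<open>Gm\<close> enters here and
  \<open>Gp\<close> enters \<open>f_dn_up\<close>.\<close>

definition f_up_dn :: "(int \<Rightarrow> int \<Rightarrow> real) \<Rightarrow> index \<Rightarrow> real"
  where "f_up_dn Gm = (\<lambda>(s, N, x, y). if s = 1 then
    (1 - q\<^sup>2) * q powi N * rt (x + 1) * Gm (N + s) y / ((rt (N + 1))\<^sup>2 * (rt (N + 2))\<^sup>2) else 0)"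

definition f_dn_up :: "(int \<Rightarrow> int \<Rightarrow> real) \<Rightarrow> index \<Rightarrow> real"
  where "f_dn_up Gp = (\<lambda>(s, N, x, y). if s = 1 then 0 else
    - (1 - q\<^sup>2) * q powi (N + x) * rt (N - x) * Gp (N + s) y / ((rt N)\<^sup>2 * (rt (N + 1))\<^sup>2))"

text \<open>The two spin components of a lowered up vector, decomposed along one up and one down
  vector; \<open>G\<close> is a value of \<open>Gm\<close>. After common factors are cleared only
  squares of roots remain, and each claim becomes a polynomial identity in q, p = q^(N - x) and w =
  q^x.\<close>

lemma up_lower_identities:
  fixes a c d p w n1 n2 G :: real
  assumes a: "a\<^sup>2 = 1 - (q * w)\<^sup>2" and c: "c\<^sup>2 = 1 - p\<^sup>2" and d: "d\<^sup>2 = 1 - (q * p)\<^sup>2"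
    and n1: "n1\<^sup>2 = 1 - (q * p * w)\<^sup>2" and n2: "n2\<^sup>2 = 1 - (q\<^sup>2 * p * w)\<^sup>2" and n: "n1 \<noteq> 0" "n2 \<noteq> 0"
  shows "q * p * a / n2 * (G * (q * w) * c / (n1 * n2)) =
      G * w * c / n1\<^sup>2 * (p * a / n1) - (1 - q\<^sup>2) * (p * w) * a * G / (n1\<^sup>2 * n2\<^sup>2) * (c / n1)" (is "?l1 = ?r1")
    and "d / n2 * (G * w * d / (n1 * n2)) =
      G * w * c / n1\<^sup>2 * (c / n1) + (1 - q\<^sup>2) * (p * w) * a * G / (n1\<^sup>2 * n2\<^sup>2) * (p * a / n1)" (is "?l2 = ?r2")
proof -
  \<comment> \<open>This gap between the squares of the two normalisations is the origin of the
    factor 1 - q^2 in \<open>f_up_dn\<close>.\<close>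
  have id: "q\<^sup>2 * n1\<^sup>2 = n2\<^sup>2 - (1 - q\<^sup>2)" unfolding n1 n2 by (simp add: power2_eq_square algebra_simps)
  have "?l1 = G * w * c * p * a / (n1 * n1\<^sup>2 * n2\<^sup>2) * (q\<^sup>2 * n1\<^sup>2)"
    using n by (simp add: field_simps power2_eq_square)
  also have "\<dots> = G * w * c * p * a / (n1 * n1\<^sup>2 * n2\<^sup>2) * (n2\<^sup>2 - (1 - q\<^sup>2))"
    by (rule arg_cong[OF id])
  also have "\<dots> = ?r1"
    using n by (simp add: field_simps power2_eq_square)
  finally show "?l1 = ?r1" .
  have id: "d\<^sup>2 * n1\<^sup>2 = c\<^sup>2 * n2\<^sup>2 + (1 - q\<^sup>2) * p\<^sup>2 * a\<^sup>2" unfolding a c d n1 n2 by (simp add: power2_eq_square algebra_simps)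
  have "?l2 = G * w / (n1 * n1\<^sup>2 * n2\<^sup>2) * (d\<^sup>2 * n1\<^sup>2)"
    using n by (simp add: field_simps power2_eq_square)
  also have "\<dots> = G * w / (n1 * n1\<^sup>2 * n2\<^sup>2) * (c\<^sup>2 * n2\<^sup>2 + (1 - q\<^sup>2) * p\<^sup>2 * a\<^sup>2)"
    by (rule arg_cong[OF id])
  also have "\<dots> = ?r2"
    using n by (simp add: field_simps power2_eq_square)
  finally show "?l2 = ?r2" .
qed

text \<open>The counterpart for a raised down vector, with \<open>G\<close> a value of
  \<open>Gp\<close>. The mixing now carries p w^2 = q^(N + x).\<close>

lemma dn_raise_identities:
  fixes a b c p w n0 n1 G :: real
  assumes a: "a\<^sup>2 = 1 - (q * w)\<^sup>2" and b: "b\<^sup>2 = 1 - w\<^sup>2" and c: "c\<^sup>2 = 1 - p\<^sup>2"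
    and n0: "n0\<^sup>2 = 1 - (p * w)\<^sup>2" and n1: "n1\<^sup>2 = 1 - (q * p * w)\<^sup>2" and n: "n0 \<noteq> 0" "n1 \<noteq> 0"
  shows "c / n0 * (G * a / (n0 * n1)) =
      G * a / n1\<^sup>2 * (c / n1) + (1 - q\<^sup>2) * (p * w * w) * c * G / (n0\<^sup>2 * n1\<^sup>2) * (p * a / n1)" (is "?l1 = ?r1")
    and "p * b / n0 * (G * b / (n0 * n1)) =
      G * a / n1\<^sup>2 * (p * a / n1) - (1 - q\<^sup>2) * (p * w * w) * c * G / (n0\<^sup>2 * n1\<^sup>2) * (c / n1)" (is "?l2 = ?r2")
proof -
  have id: "n1\<^sup>2 = n0\<^sup>2 + (1 - q\<^sup>2) * p\<^sup>2 * w\<^sup>2" unfolding n1 n0 by (simp add: power2_eq_square algebra_simps)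
  have "?l1 = c * G * a / (n1 * n1\<^sup>2 * n0\<^sup>2) * (n1\<^sup>2)"
    using n by (simp add: field_simps power2_eq_square)
  also have "\<dots> = c * G * a / (n1 * n1\<^sup>2 * n0\<^sup>2) * (n0\<^sup>2 + (1 - q\<^sup>2) * p\<^sup>2 * w\<^sup>2)"
    by (rule arg_cong[OF id])
  also have "\<dots> = ?r1"
    using n by (simp add: field_simps power2_eq_square)
  finally show "?l1 = ?r1" .
  have id: "b\<^sup>2 * n1\<^sup>2 = a\<^sup>2 * n0\<^sup>2 - (1 - q\<^sup>2) * w\<^sup>2 * c\<^sup>2" unfolding a b c n0 n1 by (simp add: power2_eq_square algebra_simps)
  have "?l2 = p * G / (n1 * n1\<^sup>2 * n0\<^sup>2) * (b\<^sup>2 * n1\<^sup>2)"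
    using n by (simp add: field_simps power2_eq_square)
  also have "\<dots> = p * G / (n1 * n1\<^sup>2 * n0\<^sup>2) * (a\<^sup>2 * n0\<^sup>2 - (1 - q\<^sup>2) * w\<^sup>2 * c\<^sup>2)"
    by (rule arg_cong[OF id])
  also have "\<dots> = ?r2"
    using n by (simp add: field_simps power2_eq_square)
  finally show "?l2 = ?r2" .
qed

context
  fixes g t Gp Gm
  assumes g: "gen_action g t Gp Gm"
begin

lemma g_linear: "bounded_clin g" and t_cases: "t = 0 \<or> t = 1"
  using g by (auto simp: gen_action_def)

lemma g_k3: "0 \<le> X \<Longrightarrow> X \<le> L \<Longrightarrow> 0 \<le> Y \<Longrightarrow> Y \<le> L \<Longrightarrow>
    g (k3 L X Y) = (Gp L Y * rt (X + 1) / (rt (L + 1) * rt (L + 2))) *\<^sub>R k3 (L + 1) (X + 1) (Y + t) +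
      (Gm L Y * q powi X * rt (L - X) / (rt L * rt (L + 1))) *\<^sub>R k3 (L - 1) X (Y + t - 1)"
  using g by (auto simp: gen_action_def)

lemma Gm_zero: "0 \<le> Y \<Longrightarrow> Y \<le> L \<Longrightarrow> \<not> (0 \<le> Y + t - 1 \<and> Y + t - 1 \<le> L - 1) \<Longrightarrow> Gm L Y = 0"
  using g by (auto simp: gen_action_def)

lemmas g_simps = tensor_id_tensor_spin[where T = g, OF bounded_clin_zero[OF g_linear]]
  bounded_clin_add[where T = "tensor_id g", OF bounded_clin_tensor_id[OF g_linear]]
  bounded_clin_scaleR[where T = "tensor_id g", OF bounded_clin_tensor_id[OF g_linear]]

lemma tensor_id_e_up:
  assumes "0 \<le> x" "x \<le> N" "0 \<le> y" "y \<le> N + 1"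
  shows "tensor_id g (e_up N x y) = f_raise Gp (1, N, x, y) *\<^sub>R e_up (N + 1) (x + 1) (y + t) +
    f_lower Gm (1, N, x, y) *\<^sub>R e_up (N - 1) x (y + t - 1) +
    f_up_dn Gm (1, N, x, y) *\<^sub>R e_dn (N + 1) (x + 1) (y + t - 1)"
proof -
  \<comment> \<open>In these two variables all powers of q in the claim are monomials, and the
    squares of all roots are polynomials.\<close>
  define p w where "p = q powi (N - x)" and "w = q powi x"
  define a c d where "a = rt (x + 1)" and "c = rt (N - x)" and "d = rt (N - x + 1)"
  define n1 n2 n3 where "n1 = rt (N + 1)" and "n2 = rt (N + 2)" and "n3 = rt (N + 3)"
  define P M where "P = Gp (N + 1) y" and "M = Gm (N + 1) y"
  have pw: "q powi (N - x + 1) = q * p" "q powi (x + 1) = q * w" "q powi N = p * w"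
    "q powi (N + 1) = q * p * w" "q powi (N + 2) = q\<^sup>2 * p * w"
    using q_pos by (simp_all add: p_def w_def powi_add powi_diff)
  have n: "n1 \<noteq> 0" "n2 \<noteq> 0" "n3 \<noteq> 0"
    using assms rt_pos[of "N + 1"] rt_pos[of "N + 2"] rt_pos[of "N + 3"] by (simp_all add: n1_def n2_def n3_def)
  have sq: "a\<^sup>2 = 1 - (q * w)\<^sup>2" "c\<^sup>2 = 1 - p\<^sup>2" "d\<^sup>2 = 1 - (q * p)\<^sup>2" "n1\<^sup>2 = 1 - (q * p * w)\<^sup>2"
    "n2\<^sup>2 = 1 - (q\<^sup>2 * p * w)\<^sup>2"
    using assms by (simp_all add: a_def c_def d_def n1_def n2_def rt_sq pw) (simp add: p_def)
  note id = up_lower_identities[OF sq n(1,2), of M]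
  let ?Mr = "k3 (N + 2) (x + 2) (y + t) \<otimes>\<^sub>s Minus" and ?Pr = "k3 (N + 2) (x + 1) (y + t) \<otimes>\<^sub>s Plus"
  let ?Ml = "k3 N (x + 1) (y + t - 1) \<otimes>\<^sub>s Minus" and ?Pl = "k3 N x (y + t - 1) \<otimes>\<^sub>s Plus"
  have cs: "s_up N x = q * p * a / n2" "c_up N x = d / n2"
    by (simp_all add: s_up_def c_up_def pw a_def d_def n2_def)
  have "rt (N + 1 - x) = d" by (simp add: d_def algebra_simps)
  hence gM: "g (k3 (N + 1) (x + 1) y) = (P * rt (x + 2) / (n2 * n3)) *\<^sub>R k3 (N + 2) (x + 2) (y + t) +
      (M * (q * w) * c / (n1 * n2)) *\<^sub>R k3 N (x + 1) (y + t - 1)"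
    and gP: "g (k3 (N + 1) x y) = (P * a / (n2 * n3)) *\<^sub>R k3 (N + 2) (x + 1) (y + t) +
      (M * w * d / (n1 * n2)) *\<^sub>R k3 N x (y + t - 1)"
    using assms by (simp_all add: g_k3 P_def M_def a_def c_def n1_def n2_def n3_def w_def pw(2)[unfolded w_def]
        add.commute[of 2] add.commute[of 3])
  have "tensor_id g (e_up N x y) =
      - (q * p * a / n2 * (P * rt (x + 2) / (n2 * n3))) *\<^sub>R ?Mr - (q * p * a / n2 * (M * (q * w) * c / (n1 * n2))) *\<^sub>R ?Ml +
      (d / n2 * (P * a / (n2 * n3))) *\<^sub>R ?Pr + (d / n2 * (M * w * d / (n1 * n2))) *\<^sub>R ?Pl"
    unfolding e_up_def g_simps gM gP cs tensor_spin_add tensor_spin_scaleR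
    by (simp add: scaleR_add_right scaleR_diff_right)
  moreover have "f_raise Gp (1, N, x, y) *\<^sub>R e_up (N + 1) (x + 1) (y + t) =
      - (P * a / n2\<^sup>2 * (q * p * rt (x + 2) / n3)) *\<^sub>R ?Mr + (P * a / n2\<^sup>2 * (d / n3)) *\<^sub>R ?Pr"
    by (simp add: e_up_def f_raise_def s_up_def c_up_def pw a_def d_def n2_def n3_def P_def
        scaleR_add_right scaleR_diff_right add.commute[of 2] add.commute[of 3])
  moreover have "f_lower Gm (1, N, x, y) *\<^sub>R e_up (N - 1) x (y + t - 1) =
      - (M * w * c / n1\<^sup>2 * (p * a / n1)) *\<^sub>R ?Ml + (M * w * c / n1\<^sup>2 * (c / n1)) *\<^sub>R ?Pl"
    by (simp add: e_up_def f_lower_def s_up_def c_up_def a_def c_def n1_def M_def w_def p_def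
        add.commute[of 1 N] scaleR_add_right scaleR_diff_right)
  moreover have "f_up_dn Gm (1, N, x, y) *\<^sub>R e_dn (N + 1) (x + 1) (y + t - 1) =
      ((1 - q\<^sup>2) * (p * w) * a * M / (n1\<^sup>2 * n2\<^sup>2) * (c / n1)) *\<^sub>R ?Ml +
      ((1 - q\<^sup>2) * (p * w) * a * M / (n1\<^sup>2 * n2\<^sup>2) * (p * a / n1)) *\<^sub>R ?Pl"
    by (simp add: e_dn_def f_up_dn_def s_dn_def c_dn_def pw a_def c_def n1_def n2_def M_def p_def[symmetric]
        scaleR_add_right)
  \<comment> \<open>The raised part is already a multiple of a single up vector; no identity between
    the roots is required.\<close>
  moreover have "q * p * a / n2 * (P * rt (x + 2) / (n2 * n3)) = P * a / n2\<^sup>2 * (q * p * rt (x + 2) / n3)"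
    "d / n2 * (P * a / (n2 * n3)) = P * a / n2\<^sup>2 * (d / n3)"
    by (simp_all add: power2_eq_square mult_ac)
  ultimately show ?thesis
    by (simp only: id scaleR_add_left scaleR_diff_left scaleR_minus_left) (simp only: algebra_simps, simp)
qed

lemma tensor_id_e_dn:
  assumes "0 \<le> x" "x \<le> N" "0 \<le> y" "y \<le> N - 1"
  shows "tensor_id g (e_dn N x y) = f_raise Gp (- 1, N, x, y) *\<^sub>R e_dn (N + 1) (x + 1) (y + t) +
    f_lower Gm (- 1, N, x, y) *\<^sub>R e_dn (N - 1) x (y + t - 1) +
    f_dn_up Gp (- 1, N, x, y) *\<^sub>R e_up (N - 1) x (y + t)"
proof -
  define p w where "p = q powi (N - x)" and "w = q powi x"
  define a b c where "a = rt (x + 1)" and "b = rt x" and "c = rt (N - x)"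
  define n0 n1 m where "n0 = rt N" and "n1 = rt (N + 1)" and "m = rt (N - 1)"
  define P M z where "P = Gp (N - 1) y" and "M = Gm (N - 1) y" and "z = 1 - q\<^sup>2"
  have pw: "q powi (x + 1) = q * w" "q powi N = p * w" "q powi (N + x) = p * w * w"
    "q powi (N + 1) = q * p * w" "q powi (x - 1) = w / q" "q powi (N - x - 1) = p / q"
    using q_pos by (simp_all add: p_def w_def powi_add powi_diff)
  have n: "n0 \<noteq> 0" "n1 \<noteq> 0"
    using assms rt_pos[of "N + 1"] rt_pos[of N] by (simp_all add: n0_def n1_def)
  have sq: "a\<^sup>2 = 1 - (q * w)\<^sup>2" "b\<^sup>2 = 1 - w\<^sup>2" "c\<^sup>2 = 1 - p\<^sup>2" "n0\<^sup>2 = 1 - (p * w)\<^sup>2" "n1\<^sup>2 = 1 - (q * p * w)\<^sup>2"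
    using assms by (simp_all add: a_def b_def c_def n0_def n1_def rt_sq pw) (simp_all add: p_def w_def)
  note id = dn_raise_identities[OF sq n, of P, folded z_def]
  let ?Mr = "k3 N (x + 1) (y + t) \<otimes>\<^sub>s Minus" and ?Pr = "k3 N x (y + t) \<otimes>\<^sub>s Plus"
  let ?Ml = "k3 (N - 2) x (y + t - 1) \<otimes>\<^sub>s Minus" and ?Pl = "k3 (N - 2) (x - 1) (y + t - 1) \<otimes>\<^sub>s Plus"
  \<comment> \<open>The coefficient stays in front of the image: at x = N the ket is out of range,
    so that \<open>g_k3\<close> does not apply, but there \<open>c_dn\<close> is 0. The case x = 0
    of \<open>gP\<close> is similar, with \<open>s_dn\<close>.\<close>
  have gM: "c_dn N x *\<^sub>R g (k3 (N - 1) x y) = c_dn N x *\<^sub>R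
     ((P * a / (n0 * n1)) *\<^sub>R k3 N (x + 1) (y + t) + (M * w * rt (N - 1 - x) / (m * n0)) *\<^sub>R k3 (N - 2) x (y + t - 1))"
    using assms by (cases "x = N") (simp_all add: c_dn_def g_k3 P_def M_def a_def w_def n0_def n1_def m_def add.commute[of 1 N])
  have gP: "s_dn N x *\<^sub>R g (k3 (N - 1) (x - 1) y) = s_dn N x *\<^sub>R
     ((P * b / (n0 * n1)) *\<^sub>R k3 N x (y + t) + (M * (w / q) * c / (m * n0)) *\<^sub>R k3 (N - 2) (x - 1) (y + t - 1))"
    using assms by (cases "x = 0") (simp_all add: s_dn_def g_k3 P_def M_def b_def c_def pw n0_def n1_def m_def add.commute[of 1 N])
  have "tensor_id g (e_dn N x y) =
      (c_dn N x *\<^sub>R g (k3 (N - 1) x y)) \<otimes>\<^sub>s Minus + (s_dn N x *\<^sub>R g (k3 (N - 1) (x - 1) y)) \<otimes>\<^sub>s Plus"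
    by (simp add: e_dn_def g_simps tensor_spin_scaleR)
  also have "\<dots> =
      (c / n0 * (P * a / (n0 * n1))) *\<^sub>R ?Mr + (c / n0 * (M * w * rt (N - 1 - x) / (m * n0))) *\<^sub>R ?Ml +
      (p * b / n0 * (P * b / (n0 * n1))) *\<^sub>R ?Pr + (p * b / n0 * (M * (w / q) * c / (m * n0))) *\<^sub>R ?Pl" (is "_ = ?r")
    unfolding gM gP by (simp add: tensor_spin_add tensor_spin_scaleR s_dn_def c_dn_def
        c_def[symmetric] b_def[symmetric] n0_def[symmetric] p_def[symmetric] scaleR_add_right)
  finally have "tensor_id g (e_dn N x y) = ?r" .
  moreover have "f_raise Gp (- 1, N, x, y) *\<^sub>R e_dn (N + 1) (x + 1) (y + t) =
      (P * a / n1\<^sup>2 * (c / n1)) *\<^sub>R ?Mr + (P * a / n1\<^sup>2 * (p * a / n1)) *\<^sub>R ?Pr"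
    by (simp add: e_dn_def f_raise_def s_dn_def c_dn_def a_def c_def n1_def P_def p_def scaleR_add_right)
  moreover have "f_lower Gm (- 1, N, x, y) *\<^sub>R e_dn (N - 1) x (y + t - 1) =
      (M * w * c / n0\<^sup>2 * (rt (N - 1 - x) / m)) *\<^sub>R ?Ml + (M * w * c / n0\<^sup>2 * (p / q * b / m)) *\<^sub>R ?Pl"
    by (simp add: e_dn_def f_lower_def s_dn_def c_dn_def b_def c_def n0_def m_def M_def w_def pw(6)[symmetric]
        scaleR_add_right diff_diff_eq add.commute)
  moreover have "f_dn_up Gp (- 1, N, x, y) *\<^sub>R e_up (N - 1) x (y + t) =
      (z * (p * w * w) * c * P / (n0\<^sup>2 * n1\<^sup>2) * (p * a / n1)) *\<^sub>R ?Mr -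
      (z * (p * w * w) * c * P / (n0\<^sup>2 * n1\<^sup>2) * (c / n1)) *\<^sub>R ?Pr"
    by (simp add: e_up_def f_dn_up_def s_up_def c_up_def pw a_def c_def n0_def n1_def P_def p_def[symmetric] z_def[symmetric]
        add.commute[of 1 N] scaleR_add_right scaleR_diff_right)
  moreover have "c / n0 * (M * w * rt (N - 1 - x) / (m * n0)) = M * w * c / n0\<^sup>2 * (rt (N - 1 - x) / m)"
    "p * b / n0 * (M * (w / q) * c / (m * n0)) = M * w * c / n0\<^sup>2 * (p / q * b / m)"
    by (simp_all add: power2_eq_square mult_ac)
  ultimately show ?thesis
    by (simp only: id scaleR_add_left scaleR_diff_left scaleR_minus_left) (simp only: algebra_simps)
qed

text \<open>The same formulas with translations in Z^4, and the point is their validity at the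
  edges: each coefficient vanishes where its target leaves \<open>V\<close>, through rt (N - x) at x
  = N and through \<open>Gm\<close> at the edge of y.\<close>

lemma tensor_id_e:
  assumes "(s, N, x, y) \<in> V"
  shows "tensor_id g (e (s, N, x, y)) = f_raise Gp (s, N, x, y) *\<^sub>R e ((s, N, x, y) + (0, 1, 1, t)) +
    f_lower Gm (s, N, x, y) *\<^sub>R e ((s, N, x, y) + (0, - 1, 0, t - 1)) +
    f_up_dn Gm (s, N, x, y) *\<^sub>R e ((s, N, x, y) + (- 2, 1, 1, t - 1)) +
    f_dn_up Gp (s, N, x, y) *\<^sub>R e ((s, N, x, y) + (2, - 1, 0, t))"
proof (cases "s = 1")
  case True
  hence v: "0 \<le> x" "x \<le> N" "0 \<le> y" "y \<le> N + 1" using assms by (auto simp: V_def)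
  have 1: "e (1, N + 1, x + 1, y + t) = e_up (N + 1) (x + 1) (y + t)"
    by (rule e_up_eq) (use v t_cases in auto)
  have 2: "f_lower Gm (1, N, x, y) *\<^sub>R e (1, N - 1, x, y + t - 1) = f_lower Gm (1, N, x, y) *\<^sub>R e_up (N - 1) x (y + t - 1)"
  proof (cases "x = N \<or> \<not> (0 \<le> y + t - 1 \<and> y + t - 1 \<le> N + 1 - 1)")
    case True
    hence "f_lower Gm (1, N, x, y) = 0" using Gm_zero[of y "N + 1"] v by (auto simp: f_lower_def)
    thus ?thesis by simp
  next
    case False
    hence "e (1, N - 1, x, y + t - 1) = e_up (N - 1) x (y + t - 1)" by (intro e_up_eq) (use v in auto)
    thus ?thesis by simp
  qed
  have 3: "f_up_dn Gm (1, N, x, y) *\<^sub>R e (- 1, N + 1, x + 1, y + t - 1) =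
      f_up_dn Gm (1, N, x, y) *\<^sub>R e_dn (N + 1) (x + 1) (y + t - 1)"
  proof (cases "0 \<le> y + t - 1 \<and> y + t - 1 \<le> N + 1 - 1")
    case True
    hence "e (- 1, N + 1, x + 1, y + t - 1) = e_dn (N + 1) (x + 1) (y + t - 1)" by (intro e_dn_eq) (use v in auto)
    thus ?thesis by simp
  next
    case False
    hence "f_up_dn Gm (1, N, x, y) = 0" using Gm_zero[of y "N + 1"] v by (auto simp: f_up_dn_def)
    thus ?thesis by simp
  qed
  have 4: "f_dn_up Gp (1, N, x, y) = 0" by (simp add: f_dn_up_def)
  have sh: "(1 :: int, N, x, y) + (0, 1, 1, t) = (1, N + 1, x + 1, y + t)"
    "(1 :: int, N, x, y) + (0, - 1, 0, t - 1) = (1, N - 1, x, y + t - 1)"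
    "(1 :: int, N, x, y) + (- 2, 1, 1, t - 1) = (- 1, N + 1, x + 1, y + t - 1)"
    by simp_all
  show ?thesis unfolding \<open>s = 1\<close> sh e_up_eq[OF v] tensor_id_e_up[OF v] 1 2 3 4 by simp
next
  case False
  hence s: "s = - 1" and v: "0 \<le> x" "x \<le> N" "0 \<le> y" "y \<le> N - 1" using assms by (auto simp: V_def)
  have 1: "e (- 1, N + 1, x + 1, y + t) = e_dn (N + 1) (x + 1) (y + t)"
    by (rule e_dn_eq) (use v t_cases in auto)
  have 2: "f_lower Gm (- 1, N, x, y) *\<^sub>R e (- 1, N - 1, x, y + t - 1) = f_lower Gm (- 1, N, x, y) *\<^sub>R e_dn (N - 1) x (y + t - 1)"
  proof (cases "x = N \<or> \<not> (0 \<le> y + t - 1 \<and> y + t - 1 \<le> N - 1 - 1)")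
    case True
    hence "f_lower Gm (- 1, N, x, y) = 0" using Gm_zero[of y "N - 1"] v by (auto simp: f_lower_def)
    thus ?thesis by simp
  next
    case False
    hence "e (- 1, N - 1, x, y + t - 1) = e_dn (N - 1) x (y + t - 1)" by (intro e_dn_eq) (use v in auto)
    thus ?thesis by simp
  qed
  have 3: "f_dn_up Gp (- 1, N, x, y) *\<^sub>R e (1, N - 1, x, y + t) =
      f_dn_up Gp (- 1, N, x, y) *\<^sub>R e_up (N - 1) x (y + t)"
  proof (cases "x = N")
    case True
    thus ?thesis by (simp add: f_dn_up_def)
  next
    case False
    hence "e (1, N - 1, x, y + t) = e_up (N - 1) x (y + t)" by (intro e_up_eq) (use v t_cases in auto)
    thus ?thesis by simp
  qed
  have 4: "f_up_dn Gm (- 1, N, x, y) = 0" by (simp add: f_up_dn_def)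
  have sh: "(- 1 :: int, N, x, y) + (0, 1, 1, t) = (- 1, N + 1, x + 1, y + t)"
    "(- 1 :: int, N, x, y) + (0, - 1, 0, t - 1) = (- 1, N - 1, x, y + t - 1)"
    "(- 1 :: int, N, x, y) + (2, - 1, 0, t) = (1, N - 1, x, y + t)"
    by simp_all
  show ?thesis unfolding s sh e_dn_eq[OF v] tensor_id_e_dn[OF v] 1 2 3 4 by simp
qed

end

section \<open>Symbols\<close>

text \<open>Modulo $\mathcal{K}_q$ the coefficients of $\pi'(x)$ are products of functions of \<open>x\<close> and of
  \<open>y\<close>, and those of $\pi'^\circ(x)$ are products of functions of $N - x$ and of $N + s - y$.
  A factor \<open>\<phi>\<close> of \<open>x\<close> occurs together with the shifts \<open>\<kappa>\<close> of \<open>x\<close> and \<open>\<kappa>'\<close> of $N - x$, and it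
  decays unless \<open>\<kappa>' = 0\<close>; this is what makes the two sets of operators commute.\<close>

definition line :: "int \<Rightarrow> int \<Rightarrow> (int \<Rightarrow> real) \<Rightarrow> bool"
  where "line \<kappa> \<kappa>' \<phi> \<longleftrightarrow> (\<forall>x. x < 0 \<or> x + \<kappa> < 0 \<longrightarrow> \<phi> x = 0) \<and>
    (\<exists>l C. (\<kappa>' \<noteq> 0 \<longrightarrow> l = 0) \<and> (\<forall>x. \<bar>\<phi> x - l\<bar> \<le> C * q powi x))"

lemma lineE:
  assumes "line \<kappa> \<kappa>' \<phi>"
  obtains l C where "\<kappa>' \<noteq> 0 \<longrightarrow> l = 0" "\<And>x. \<bar>\<phi> x - l\<bar> \<le> C * q powi x" "0 \<le> C"
proof -
  obtain l C where *: "\<kappa>' \<noteq> 0 \<longrightarrow> l = 0" "\<And>x. \<bar>\<phi> x - l\<bar> \<le> C * q powi x"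
    using assms by (auto simp: line_def)
  have "0 \<le> C" using order_trans[OF abs_ge_zero *(2)[of 0]] by simp
  thus thesis using that * by blast
qed

lemma line_bounded:
  assumes "line \<kappa> \<kappa>' \<phi>"
  obtains B where "0 \<le> B" "\<And>x. \<bar>\<phi> x\<bar> \<le> B"
proof -
  obtain l C where *: "\<And>x. \<bar>\<phi> x - l\<bar> \<le> C * q powi x" "0 \<le> C"
    using assms by (metis lineE)
  have "\<bar>\<phi> x\<bar> \<le> \<bar>l\<bar> + C" for x
  proof (cases "x < 0")
    case True thus ?thesis using assms *(2) by (simp add: line_def)
  next
    case False
    hence "C * q powi x \<le> C * 1" by (intro mult_left_mono powi_le_1 *) auto
    thus ?thesis using *(1)[of x] by linarith
  qed
  thus thesis using that[of "\<bar>l\<bar> + C"] *(2) by auto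
qed

text \<open>The conditions x < 0 and x + \<kappa> < 0 trade places under the substitution, which is
  why \<open>line\<close> demands a zero in both.\<close>

lemma line_adj:
  assumes "line \<kappa> \<kappa>' \<phi>" shows "line (- \<kappa>) (- \<kappa>') (\<lambda>x. \<phi> (x - \<kappa>))"
proof -
  obtain l C where *: "\<kappa>' \<noteq> 0 \<longrightarrow> l = 0" "\<And>x. \<bar>\<phi> x - l\<bar> \<le> C * q powi x"
    using assms by (metis lineE)
  have "\<bar>\<phi> (x - \<kappa>) - l\<bar> \<le> C / q powi \<kappa> * q powi x" for x
    using *(2)[of "x - \<kappa>"] by (simp add: powi_diff)
  moreover have "- \<kappa>' \<noteq> 0 \<longrightarrow> l = 0" using *(1) by simp
  moreover have "\<phi> (x - \<kappa>) = 0" if "x < 0 \<or> x + - \<kappa> < 0" for x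
    using assms that by (auto simp: line_def)
  ultimately show ?thesis unfolding line_def by blast
qed

text \<open>Write \<phi> = l + u and \<psi> = m + v with decaying u and v. The constant l m cancels.
  The mixed term l (v (x' + \<kappa>') - v x') is 0, since l = 0 unless \<kappa>' = 0, and likewise
  the one with m. There remain products u v, of order q^(x + x'); with x' the dual coordinate N - x
  this is q^N.\<close>

lemma line_commute:
  assumes \<phi>: "line \<kappa> \<kappa>' \<phi>" and \<psi>: "line \<mu>' \<mu> \<psi>"
  obtains C where "0 \<le> C" "\<And>x x'. \<bar>\<phi> x * \<psi> (x' + \<kappa>') - \<phi> (x + \<mu>) * \<psi> x'\<bar> \<le> C * q powi (x + x')"
proof -
  obtain l C where *: "\<kappa>' \<noteq> 0 \<longrightarrow> l = 0" "\<And>x. \<bar>\<phi> x - l\<bar> \<le> C * q powi x" "0 \<le> C"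
    using \<phi> by (metis lineE)
  obtain m D where **: "\<mu> \<noteq> 0 \<longrightarrow> m = 0" "\<And>x. \<bar>\<psi> x - m\<bar> \<le> D * q powi x" "0 \<le> D"
    using \<psi> by (metis lineE)
  have "\<bar>\<phi> x * \<psi> (x' + \<kappa>') - \<phi> (x + \<mu>) * \<psi> x'\<bar> \<le>
      (C * D * q powi \<kappa>' + C * D * q powi \<mu>) * q powi (x + x')" for x x'
  proof -
    define u v where "u = (\<lambda>x. \<phi> x - l)" and "v = (\<lambda>x. \<psi> x - m)"
    have u: "\<bar>u z\<bar> \<le> C * q powi z" and v: "\<bar>v z\<bar> \<le> D * q powi z" for z
      using * ** by (simp_all add: u_def v_def)
    have uv: "\<bar>u z * v w\<bar> \<le> C * D * q powi (z + w)" for z w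
      using mult_mono[OF u v, of z w] * powi_pos[of z] by (simp add: abs_mult powi_add mult_ac)
    have z: "l * (v (x' + \<kappa>') - v x') = 0" "m * (u x - u (x + \<mu>)) = 0"
      using *(1) **(1) by (cases "\<kappa>' = 0"; cases "\<mu> = 0"; simp)+
    have "\<phi> x * \<psi> (x' + \<kappa>') - \<phi> (x + \<mu>) * \<psi> x' =
        l * (v (x' + \<kappa>') - v x') + m * (u x - u (x + \<mu>)) + (u x * v (x' + \<kappa>') - u (x + \<mu>) * v x')"
      by (simp add: u_def v_def algebra_simps)
    also have "\<dots> = u x * v (x' + \<kappa>') - u (x + \<mu>) * v x'" by (simp add: z)
    finally have "\<bar>\<phi> x * \<psi> (x' + \<kappa>') - \<phi> (x + \<mu>) * \<psi> x'\<bar> \<le> \<bar>u x * v (x' + \<kappa>')\<bar> + \<bar>u (x + \<mu>) * v x'\<bar>"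
      by simp
    also have "\<dots> \<le> C * D * q powi (x + (x' + \<kappa>')) + C * D * q powi ((x + \<mu>) + x')"
      by (intro add_mono uv)
    also have "\<dots> = (C * D * q powi \<kappa>' + C * D * q powi \<mu>) * q powi (x + x')"
      by (simp add: powi_add algebra_simps)
    finally show ?thesis .
  qed
  moreover have "0 \<le> C * D * q powi \<kappa>' + C * D * q powi \<mu>"
    using * ** q_pos by (intro add_nonneg_nonneg mult_nonneg_nonneg) auto
  ultimately show thesis using that by blast
qed

section \<open>Leading product weights and their remainders\<close>

definition prodsym :: "(int \<Rightarrow> real) \<Rightarrow> (int \<Rightarrow> real) \<Rightarrow> (int \<Rightarrow> real) \<Rightarrow> index \<Rightarrow> real"
  where "prodsym \<eta> \<phi> \<psi> = (\<lambda>(s, N, x, y). \<eta> s * \<phi> x * \<psi> y)"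

definition deg :: "index \<Rightarrow> int" where "deg = (\<lambda>(s, N, x, y). N)"

definition bar :: "index \<Rightarrow> index" where "bar = (\<lambda>(s, N, x, y). (s, N, N - x, N + s - y))"

lemma deg_simps [simp]: "deg (s, N, x, y) = N" "deg (i + k) = deg i + deg k" "deg (bar i) = deg i"
  "deg (i - k) = deg i - deg k" "deg (- k) = - deg k"
  by (auto simp: deg_def bar_def split: prod.splits)

lemma bar_simps [simp]: "bar (bar i) = i" "bar i \<in> V \<longleftrightarrow> i \<in> V" "bar (i + k) = bar i + bar k"
  by (auto simp: bar_def V_def split: prod.splits)

lemma V_D:
  assumes "(s, N, x, y) \<in> V"
  shows "s = 1 \<or> s = - 1" "0 \<le> x" "x \<le> N" "0 \<le> y" "y \<le> N + s"
  using assms by (auto simp: V_def)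

lemma deg_nonneg: "i \<in> V \<Longrightarrow> 0 \<le> deg i"
  by (auto simp: V_def)

text \<open>\<eta> is the factor depending on the arrow, which commutators with D produce. A shift
  that changes the arrow has leading part 0, so it consists of remainder only.\<close>

definition sym_parts :: "index \<Rightarrow> (int \<Rightarrow> real) \<Rightarrow> (int \<Rightarrow> real) \<Rightarrow> (int \<Rightarrow> real) \<Rightarrow> bool"
  where "sym_parts = (\<lambda>(ks, kN, kx, ky) \<eta> \<phi> \<psi>. (ks \<noteq> 0 \<longrightarrow> \<eta> = (\<lambda>_. 0)) \<and>
    line kx (kN - kx) \<phi> \<and> line ky (kN + ks - ky) \<psi>)"

text \<open>The rate \<rho> is a parameter because it drops from q to \<open>sqrt q\<close> on
  passing to the commutator with D. The exact zero where the target leaves \<open>V\<close> is what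
  lets products be truncated in \<open>symb_product\<close>.\<close>

definition symb :: "real \<Rightarrow> index \<Rightarrow> (index \<Rightarrow> real) \<Rightarrow> bool"
  where "symb \<rho> k f \<longleftrightarrow> (\<forall>i\<in>V. i + k \<notin> V \<longrightarrow> f i = 0) \<and>
    (\<exists>\<eta> \<phi> \<psi> C. sym_parts k \<eta> \<phi> \<psi> \<and> (\<forall>i\<in>V. \<bar>f i - prodsym \<eta> \<phi> \<psi> i\<bar> \<le> C * \<rho> powi deg i))"

lemma symbE:
  assumes "symb \<rho> k f"
  obtains \<eta> \<phi> \<psi> C where "sym_parts k \<eta> \<phi> \<psi>"
    "\<And>i. i \<in> V \<Longrightarrow> \<bar>f i - prodsym \<eta> \<phi> \<psi> i\<bar> \<le> C * \<rho> powi deg i"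
    "\<And>i. i \<in> V \<Longrightarrow> i + k \<notin> V \<Longrightarrow> f i = 0"
  using assms unfolding symb_def by blast

lemma symb_intro:
  assumes "sym_parts k \<eta> \<phi> \<psi>"
    and "\<And>i. i \<in> V \<Longrightarrow> \<bar>f i - prodsym \<eta> \<phi> \<psi> i\<bar> \<le> C * \<rho> powi deg i"
    and "\<And>i. i \<in> V \<Longrightarrow> i + k \<notin> V \<Longrightarrow> f i = 0"
  shows "symb \<rho> k f"
  using assms unfolding symb_def by blast

lemma powi_antimono: "m \<le> n \<Longrightarrow> q powi n \<le> q powi m"
  using q_pos q_less_1 by (simp add: power_int_decreasing)

text \<open>With \<eta> set to 0 away from s = 1 and s = - 1 the bound holds at every index, also at
  translates off \<open>V\<close>, where \<open>symb_product\<close> needs it.\<close>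

lemma prodsym_bounded:
  assumes "sym_parts k \<eta> \<phi> \<psi>"
  obtains B where "0 \<le> B" "\<And>i. \<bar>prodsym (\<lambda>s. if s = 1 \<or> s = - 1 then \<eta> s else 0) \<phi> \<psi> i\<bar> \<le> B"
    "\<And>i. i \<in> V \<Longrightarrow> \<bar>prodsym \<eta> \<phi> \<psi> i\<bar> \<le> B"
proof -
  obtain B\<phi> B\<psi> where B: "0 \<le> B\<phi>" "\<And>x. \<bar>\<phi> x\<bar> \<le> B\<phi>" "0 \<le> B\<psi>" "\<And>x. \<bar>\<psi> x\<bar> \<le> B\<psi>"
  proof -
    obtain ks kN kx ky where "k = (ks, kN, kx, ky)" by (metis surj_pair)
    hence "line kx (kN - kx) \<phi>" "line ky (kN + ks - ky) \<psi>" using assms by (auto simp: sym_parts_def)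
    thus thesis using that line_bounded by metis
  qed
  define H where "H = \<bar>\<eta> 1\<bar> + \<bar>\<eta> (- 1)\<bar>"
  define \<eta>' where "\<eta>' = (\<lambda>s::int. if s = 1 \<or> s = - 1 then \<eta> s else 0)"
  have "\<bar>\<eta>' s\<bar> \<le> H" for s by (auto simp: H_def \<eta>'_def)
  hence *: "\<bar>prodsym \<eta>' \<phi> \<psi> i\<bar> \<le> H * B\<phi> * B\<psi>" for i
    using B by (cases i) (auto simp: prodsym_def abs_mult H_def intro!: mult_mono)
  have "prodsym \<eta> \<phi> \<psi> i = prodsym \<eta>' \<phi> \<psi> i" if "i \<in> V" for i
    using that by (auto simp: prodsym_def V_def \<eta>'_def)
  thus thesis using that[of "H * B\<phi> * B\<psi>"] * B unfolding \<eta>'_def[symmetric] by (auto simp: H_def)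
qed

text \<open>Cutting off to \<open>V\<close> costs only O(q^N). Suppose that i lies in
  \<open>V\<close> and i + k does not. At a lower edge the leading part is 0 by \<open>line\<close>.
  If x crosses the upper edge, then kN - kx < 0, so the limit of \<phi> is 0 and \<phi> x is of
  order q^x with x > N + kN - kx; likewise for y.\<close>

lemma symbI:
  assumes parts: "sym_parts k \<eta> \<phi> \<psi>" and \<rho>: "q \<le> \<rho>"
    and f: "\<And>i. i \<in> V \<Longrightarrow> i + k \<in> V \<Longrightarrow> \<bar>f i - prodsym \<eta> \<phi> \<psi> i\<bar> \<le> C * \<rho> powi deg i"
  shows "symb \<rho> k (\<lambda>i. if i + k \<in> V then f i else 0)"
proof -
  obtain ks kN kx ky where k: "k = (ks, kN, kx, ky)" by (metis surj_pair)
  have l: "line kx (kN - kx) \<phi>" "line ky (kN + ks - ky) \<psi>" and \<eta>: "ks \<noteq> 0 \<longrightarrow> \<eta> = (\<lambda>_. 0)"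
    using parts by (auto simp: k sym_parts_def)
  obtain B\<phi> where B\<phi>: "0 \<le> B\<phi>" "\<And>x. \<bar>\<phi> x\<bar> \<le> B\<phi>" using line_bounded[OF l(1)] by blast
  obtain B\<psi> where B\<psi>: "0 \<le> B\<psi>" "\<And>x. \<bar>\<psi> x\<bar> \<le> B\<psi>" using line_bounded[OF l(2)] by blast
  obtain l1 C1 where C1: "kN - kx \<noteq> 0 \<longrightarrow> l1 = 0" "\<And>x. \<bar>\<phi> x - l1\<bar> \<le> C1 * q powi x" "0 \<le> C1"
    using lineE[OF l(1)] by blast
  obtain l2 C2 where C2: "kN + ks - ky \<noteq> 0 \<longrightarrow> l2 = 0" "\<And>x. \<bar>\<psi> x - l2\<bar> \<le> C2 * q powi x" "0 \<le> C2"
    using lineE[OF l(2)] by blast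
  define H where "H = \<bar>\<eta> 1\<bar> + \<bar>\<eta> (- 1)\<bar>"
  define K1 where "K1 = C1 * q powi (kN - kx)"
  \<comment> \<open>The - 1 in the exponent covers s = - 1: the upper edge for y is N + s \<ge> N -
    1.\<close>
  define K2 where "K2 = C2 * q powi (kN - ky - 1)"
  have K: "0 \<le> K1" "0 \<le> K2" using C1 C2 q_pos by (simp_all add: K1_def K2_def)
  define K where "K = H * (K1 * B\<psi> + B\<phi> * K2)"
  have K0: "0 \<le> K" using K B\<phi> B\<psi> by (simp add: K_def H_def)
  have out: "\<bar>prodsym \<eta> \<phi> \<psi> i\<bar> \<le> K * \<rho> powi deg i" if i: "i \<in> V" "i + k \<notin> V" for i
  proof -
    obtain s N x y where ii: "i = (s, N, x, y)" by (metis surj_pair)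
    note v = V_D[OF i(1)[unfolded ii]]
    have H: "\<bar>\<eta> s\<bar> \<le> H" using v by (auto simp: H_def)
    have "\<bar>prodsym \<eta> \<phi> \<psi> i\<bar> \<le> K * q powi N"
    proof (cases "ks = 0")
      case False
      thus ?thesis using \<eta> K0 powi_pos[of N] by (simp add: ii prodsym_def)
    next
      case True
      hence "x + kx < 0 \<or> x + kx > N + kN \<or> y + ky < 0 \<or> y + ky > N + kN + s"
        using i v by (auto simp: ii k V_def)
      then consider "x + kx < 0 \<or> y + ky < 0" | "x + kx > N + kN" | "y + ky > N + kN + s" by blast
      thus ?thesis
      proof cases
        case 1
        hence "\<phi> x = 0 \<or> \<psi> y = 0" using l by (auto simp: line_def)
        thus ?thesis using K0 powi_pos[of N] by (auto simp: ii prodsym_def)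
      next
        case 2
        hence "l1 = 0" using v C1 by auto
        hence "\<bar>\<phi> x\<bar> \<le> C1 * q powi x" using C1(2)[of x] by simp
        also have "\<dots> \<le> C1 * q powi (N + (kN - kx))"
          using 2 C1 by (intro mult_left_mono powi_antimono) auto
        finally have "\<bar>\<phi> x\<bar> \<le> K1 * q powi N" by (simp add: K1_def powi_add mult_ac)
        hence "\<bar>\<eta> s\<bar> * \<bar>\<phi> x\<bar> * \<bar>\<psi> y\<bar> \<le> H * (K1 * q powi N) * B\<psi>"
          using H B\<psi> K powi_pos[of N] by (intro mult_mono) (auto simp: H_def)
        also have "\<dots> \<le> K * q powi N"
          using K B\<phi> powi_pos[of N] by (simp add: K_def H_def algebra_simps)
        finally show ?thesis by (simp add: ii prodsym_def abs_mult)
      next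
        case 3
        hence "l2 = 0" using v C2 True by auto
        hence "\<bar>\<psi> y\<bar> \<le> C2 * q powi y" using C2(2)[of y] by simp
        also have "\<dots> \<le> C2 * q powi (N + (kN - ky - 1))"
          using 3 C2 v by (intro mult_left_mono powi_antimono) auto
        finally have "\<bar>\<psi> y\<bar> \<le> K2 * q powi N" by (simp add: K2_def powi_add mult_ac)
        hence "\<bar>\<eta> s\<bar> * \<bar>\<phi> x\<bar> * \<bar>\<psi> y\<bar> \<le> H * B\<phi> * (K2 * q powi N)"
          using H B\<phi> K powi_pos[of N] by (intro mult_mono) (auto simp: H_def)
        also have "\<dots> \<le> K * q powi N"
          using K B\<psi> powi_pos[of N] by (simp add: K_def H_def algebra_simps)
        finally show ?thesis by (simp add: ii prodsym_def abs_mult)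
      qed
    qed
    also have "\<dots> \<le> K * \<rho> powi N"
      using K0 \<rho> q_pos v by (intro mult_left_mono power_int_mono) auto
    finally show ?thesis by (simp add: ii)
  qed
  have "\<bar>(if i + k \<in> V then f i else 0) - prodsym \<eta> \<phi> \<psi> i\<bar> \<le> (\<bar>C\<bar> + K) * \<rho> powi deg i" if i: "i \<in> V" for i
  proof -
    have p: "0 \<le> \<rho> powi deg i" using \<rho> q_pos by simp
    have a: "C * \<rho> powi deg i \<le> (\<bar>C\<bar> + K) * \<rho> powi deg i" "K * \<rho> powi deg i \<le> (\<bar>C\<bar> + K) * \<rho> powi deg i"
      using p K0 by (auto intro!: mult_right_mono)
    show ?thesis using f[OF i] out[OF i] a by (cases "i + k \<in> V") auto
  qed
  thus ?thesis by (rule symb_intro[OF parts]) auto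
qed

lemma symb_bounded:
  assumes f: "symb \<rho> k f" and \<rho>: "q \<le> \<rho>" "\<rho> < 1"
  shows "bounded_symbol f"
proof -
  obtain \<eta> \<phi> \<psi> C where *: "sym_parts k \<eta> \<phi> \<psi>"
    "\<And>i. i \<in> V \<Longrightarrow> \<bar>f i - prodsym \<eta> \<phi> \<psi> i\<bar> \<le> C * \<rho> powi deg i"
    "\<And>i. i \<in> V \<Longrightarrow> i + k \<notin> V \<Longrightarrow> f i = 0"
    by (rule symbE[OF f]) (rule that)
  obtain B where B: "0 \<le> B" "\<And>i. i \<in> V \<Longrightarrow> \<bar>prodsym \<eta> \<phi> \<psi> i\<bar> \<le> B"
    by (rule prodsym_bounded[OF *(1)]) (rule that)
  show ?thesis
  proof (rule bounded_symbolI)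
    fix i assume i: "i \<in> V"
    have "\<rho> powi deg i \<le> 1" "0 \<le> \<rho> powi deg i"
      using \<rho> q_pos deg_nonneg[OF i] by (auto intro: power_int_le_one)
    hence "C * \<rho> powi deg i \<le> \<bar>C\<bar> * 1" by (intro mult_mono) auto
    thus "\<bar>f i\<bar> \<le> B + \<bar>C\<bar>" using *(2)[OF i] B(2)[OF i] by linarith
  qed
qed

lemma symb_scale:
  assumes "symb \<rho> k f" shows "symb \<rho> k (\<lambda>i. c * f i)"
proof -
  obtain \<eta> \<phi> \<psi> C where *: "sym_parts k \<eta> \<phi> \<psi>"
    "\<And>i. i \<in> V \<Longrightarrow> \<bar>f i - prodsym \<eta> \<phi> \<psi> i\<bar> \<le> C * \<rho> powi deg i"
    and v: "\<And>i. i \<in> V \<Longrightarrow> i + k \<notin> V \<Longrightarrow> f i = 0"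
    by (rule symbE[OF assms]) (rule that)
  have "sym_parts k (\<lambda>s. c * \<eta> s) \<phi> \<psi>" using *(1) by (cases k) (auto simp: sym_parts_def)
  moreover have "\<bar>c * f i - prodsym (\<lambda>s. c * \<eta> s) \<phi> \<psi> i\<bar> \<le> (\<bar>c\<bar> * C) * \<rho> powi deg i" if "i \<in> V" for i
  proof -
    have "c * f i - prodsym (\<lambda>s. c * \<eta> s) \<phi> \<psi> i = c * (f i - prodsym \<eta> \<phi> \<psi> i)"
      by (cases i) (simp add: prodsym_def algebra_simps)
    thus ?thesis using mult_left_mono[OF *(2)[OF that], of "\<bar>c\<bar>"] by (simp add: abs_mult mult.assoc)
  qed
  ultimately show ?thesis using v by (intro symb_intro) auto
qed

lemma symb_adj:
  assumes f: "symb \<rho> k f" and \<rho>: "q \<le> \<rho>"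
  shows "symb \<rho> (- k) (adj_symbol f k)"
proof -
  obtain \<eta> \<phi> \<psi> C where *: "sym_parts k \<eta> \<phi> \<psi>"
    "\<And>i. i \<in> V \<Longrightarrow> \<bar>f i - prodsym \<eta> \<phi> \<psi> i\<bar> \<le> C * \<rho> powi deg i"
    "\<And>i. i \<in> V \<Longrightarrow> i + k \<notin> V \<Longrightarrow> f i = 0"
    by (rule symbE[OF f]) (rule that)
  obtain ks kN kx ky where k: "k = (ks, kN, kx, ky)" by (metis surj_pair)
  have l: "line kx (kN - kx) \<phi>" "line ky (kN + ks - ky) \<psi>" and \<eta>: "ks \<noteq> 0 \<longrightarrow> \<eta> = (\<lambda>_. 0)"
    using *(1) by (auto simp: k sym_parts_def)
  have p: "sym_parts (- k) \<eta> (\<lambda>x. \<phi> (x - kx)) (\<lambda>y. \<psi> (y - ky))"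
    using line_adj[OF l(1)] line_adj[OF l(2)] \<eta> by (auto simp: k sym_parts_def algebra_simps)
  have \<rho>0: "\<rho> \<noteq> 0" using \<rho> q_pos by simp
  have "symb \<rho> (- k) (\<lambda>i. if i + - k \<in> V then f (i - k) else 0)"
  proof (rule symbI[OF p \<rho>])
    fix i assume i: "i \<in> V" "i + - k \<in> V"
    have "prodsym \<eta> (\<lambda>x. \<phi> (x - kx)) (\<lambda>y. \<psi> (y - ky)) i = prodsym \<eta> \<phi> \<psi> (i - k)"
      using \<eta> by (cases i; cases "ks = 0") (auto simp: k prodsym_def)
    moreover have "C * \<rho> powi deg (i - k) = C / \<rho> powi deg k * \<rho> powi deg i"
      using \<rho>0 by (simp add: power_int_diff)
    ultimately show "\<bar>f (i - k) - prodsym \<eta> (\<lambda>x. \<phi> (x - kx)) (\<lambda>y. \<psi> (y - ky)) i\<bar> \<le> C / \<rho> powi deg k * \<rho> powi deg i"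
      using *(2)[of "i - k"] i by simp
  qed
  thus ?thesis by (simp add: adj_symbol_def[abs_def])
qed

text \<open>A product of weights may be replaced by the product of their leading parts up to order
  \<rho>^N. When i + k leaves \<open>V\<close> the former is 0, but so is f i, whence f0 i is itself
  within the error.\<close>

lemma symb_product:
  assumes \<rho>: "q \<le> \<rho>"
    and f: "\<And>i. i \<in> V \<Longrightarrow> i + k \<notin> V \<Longrightarrow> f i = 0" "\<And>i. i \<in> V \<Longrightarrow> \<bar>f i - f0 i\<bar> \<le> C * \<rho> powi deg i"
      "\<And>i. i \<in> V \<Longrightarrow> \<bar>f i\<bar> \<le> B" "0 \<le> B"
    and g: "\<And>i. i \<in> V \<Longrightarrow> \<bar>g i - g0 i\<bar> \<le> C' * \<rho> powi deg i" "\<And>i. \<bar>g0 i\<bar> \<le> B'"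
    and i: "i \<in> V"
  shows "\<bar>(if i + k \<in> V then f i * g (i + k) else 0) - f0 i * g0 (i + k)\<bar> \<le>
    (B * \<bar>C'\<bar> * \<rho> powi deg k + B' * \<bar>C\<bar>) * \<rho> powi deg i"
proof -
  have \<rho>0: "0 < \<rho>" using \<rho> q_pos by simp
  have B': "0 \<le> B'" using g(2)[of i] by linarith
  have "\<bar>f0 i - f i\<bar> \<le> \<bar>C\<bar> * \<rho> powi deg i"
    using f(2)[OF i] mult_right_mono[OF abs_ge_self[of C], of "\<rho> powi deg i"] \<rho>0
    unfolding abs_minus_commute[of "f0 i"] by (auto intro: order_trans)
  hence 1: "\<bar>f0 i - f i\<bar> * \<bar>g0 (i + k)\<bar> \<le> \<bar>C\<bar> * \<rho> powi deg i * B'"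
    using g(2) \<rho>0 by (intro mult_mono) auto
  show ?thesis
  proof (cases "i + k \<in> V")
    case True
    have "C' * \<rho> powi deg (i + k) \<le> \<bar>C'\<bar> * \<rho> powi deg (i + k)" using \<rho>0 by (intro mult_right_mono) auto
    hence "\<bar>f i\<bar> * \<bar>g (i + k) - g0 (i + k)\<bar> \<le> B * (\<bar>C'\<bar> * \<rho> powi deg (i + k))"
      using f(3)[OF i] f(4) g(1)[OF True] by (intro mult_mono) auto
    moreover have "f i * g (i + k) - f0 i * g0 (i + k) = f i * (g (i + k) - g0 (i + k)) - (f0 i - f i) * g0 (i + k)"
      by (simp add: algebra_simps)
    hence "\<bar>f i * g (i + k) - f0 i * g0 (i + k)\<bar> \<le> \<bar>f i\<bar> * \<bar>g (i + k) - g0 (i + k)\<bar> + \<bar>f0 i - f i\<bar> * \<bar>g0 (i + k)\<bar>"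
      by (metis abs_mult abs_triangle_ineq4)
    ultimately show ?thesis using True 1 \<rho>0 by (simp add: power_int_add algebra_simps)
  next
    case False
    have "0 \<le> B * \<bar>C'\<bar> * \<rho> powi deg k * \<rho> powi deg i" using f(4) \<rho>0 by simp
    thus ?thesis using False f(1)[OF i False] 1 by (simp add: abs_mult algebra_simps)
  qed
qed

text \<open>The hypothesis on \<open>g\<close> describes its reflection by \<open>bar\<close>, so
  the leading part of \<open>g\<close> depends on the dual coordinates N - x and N + s - y. With
  both weights replaced by their leading parts, the difference is one of products over the two
  coordinates, and \<open>line_commute\<close> bounds it in each.\<close>

lemma symb_commute:
  assumes f: "symb \<rho> k f" and g: "symb \<rho> (bar l) (\<lambda>i. g (bar i))" and \<rho>: "q \<le> \<rho>" "\<rho> < 1"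
  obtains C where "\<And>i. i \<in> V \<Longrightarrow> \<bar>shift_comm g l f k i\<bar> \<le> C * \<rho> powi deg i"
proof -
  obtain \<eta> \<phi> \<psi> C where F: "sym_parts k \<eta> \<phi> \<psi>"
    "\<And>i. i \<in> V \<Longrightarrow> \<bar>f i - prodsym \<eta> \<phi> \<psi> i\<bar> \<le> C * \<rho> powi deg i"
    and fv: "\<And>i. i \<in> V \<Longrightarrow> i + k \<notin> V \<Longrightarrow> f i = 0"
    by (rule symbE[OF f]) (rule that)
  obtain \<eta>' \<phi>' \<psi>' C' where G: "sym_parts (bar l) \<eta>' \<phi>' \<psi>'"
    "\<And>i. i \<in> V \<Longrightarrow> \<bar>g (bar i) - prodsym \<eta>' \<phi>' \<psi>' i\<bar> \<le> C' * \<rho> powi deg i"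
    and gv': "\<And>i. i \<in> V \<Longrightarrow> i + bar l \<notin> V \<Longrightarrow> g (bar i) = 0"
    by (rule symbE[OF g]) (rule that)
  have gv: "g i = 0" if "i \<in> V" "i + l \<notin> V" for i
    using gv'[of "bar i"] that by (metis bar_simps)
  define r :: "(int \<Rightarrow> real) \<Rightarrow> int \<Rightarrow> real" where "r = (\<lambda>\<eta> s. if s = 1 \<or> s = - 1 then \<eta> s else 0)"
  define f0 g0 where "f0 = prodsym (r \<eta>) \<phi> \<psi>" and "g0 = (\<lambda>i. prodsym (r \<eta>') \<phi>' \<psi>' (bar i))"
  have rV: "prodsym (r \<eta>) \<phi> \<psi> i = prodsym \<eta> \<phi> \<psi> i" if "i \<in> V" for \<eta> \<phi> \<psi> i
    using that by (auto simp: r_def prodsym_def V_def)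
  have f0: "\<bar>f i - f0 i\<bar> \<le> C * \<rho> powi deg i" if "i \<in> V" for i
    using F(2)[OF that] by (simp add: f0_def rV that)
  have g0: "\<bar>g i - g0 i\<bar> \<le> C' * \<rho> powi deg i" if "i \<in> V" for i
    using G(2)[of "bar i"] that by (simp add: g0_def rV)
  obtain B0 where B0: "\<And>i. \<bar>f0 i\<bar> \<le> B0"
    using prodsym_bounded[OF F(1)] unfolding f0_def r_def by metis
  obtain B0' where B0': "\<And>i. \<bar>g0 i\<bar> \<le> B0'"
    using prodsym_bounded[OF G(1)] unfolding g0_def r_def by metis
  obtain B where B: "0 \<le> B" "\<And>i. i \<in> V \<Longrightarrow> \<bar>f i\<bar> \<le> B"
    using bounded_symbol_bound[OF symb_bounded[OF f \<rho>]] by blast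
  obtain B' where B': "0 \<le> B'" "\<And>i. i \<in> V \<Longrightarrow> \<bar>g (bar i)\<bar> \<le> B'"
    using bounded_symbol_bound[OF symb_bounded[OF g \<rho>]] by blast
  have B'': "\<And>i. i \<in> V \<Longrightarrow> \<bar>g i\<bar> \<le> B'" using B'(2)[of "bar _"] by simp
  define K1 where "K1 = B * \<bar>C'\<bar> * \<rho> powi deg k + B0' * \<bar>C\<bar>"
  define K2 where "K2 = B' * \<bar>C\<bar> * \<rho> powi deg l + B0 * \<bar>C'\<bar>"
  have p1: "\<bar>(if i + k \<in> V then f i * g (i + k) else 0) - f0 i * g0 (i + k)\<bar> \<le> K1 * \<rho> powi deg i"
    if "i \<in> V" for i
    unfolding K1_def by (rule symb_product[OF \<rho>(1) fv f0 B(2,1) g0 B0' that])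
  have p2: "\<bar>(if i + l \<in> V then g i * f (i + l) else 0) - g0 i * f0 (i + l)\<bar> \<le> K2 * \<rho> powi deg i"
    if "i \<in> V" for i
    unfolding K2_def by (rule symb_product[OF \<rho>(1) gv g0 B'' B'(1) f0 B0 that])
  obtain K3 where K3: "\<And>i. i \<in> V \<Longrightarrow> \<bar>f0 i * g0 (i + k) - g0 i * f0 (i + l)\<bar> \<le> K3 * q powi deg i" "0 \<le> K3"
  proof -
    obtain ks kN kx ky where k: "k = (ks, kN, kx, ky)" by (metis surj_pair)
    obtain ls lN lx ly where l: "l = (ls, lN, lx, ly)" by (metis surj_pair)
    have lf: "line kx (kN - kx) \<phi>" "line ky (kN + ks - ky) \<psi>" "ks \<noteq> 0 \<longrightarrow> \<eta> = (\<lambda>_. 0)"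
      using F(1) by (auto simp: k sym_parts_def)
    have lg: "line (lN - lx) lx \<phi>'" "line (lN + ls - ly) ly \<psi>'" "ls \<noteq> 0 \<longrightarrow> \<eta>' = (\<lambda>_. 0)"
      using G(1) by (auto simp: l sym_parts_def bar_def)
    obtain D1 where D1: "0 \<le> D1"
      "\<And>x x'. \<bar>\<phi> x * \<phi>' (x' + (kN - kx)) - \<phi> (x + lx) * \<phi>' x'\<bar> \<le> D1 * q powi (x + x')"
      using line_commute[OF lf(1) lg(1)] by blast
    obtain D2 where D2: "0 \<le> D2"
      "\<And>x x'. \<bar>\<psi> x * \<psi>' (x' + (kN + ks - ky)) - \<psi> (x + ly) * \<psi>' x'\<bar> \<le> D2 * q powi (x + x')"
      using line_commute[OF lf(2) lg(2)] by blast
    obtain b1 where b1: "0 \<le> b1" "\<And>x. \<bar>\<phi> x\<bar> \<le> b1" using line_bounded[OF lf(1)] by blast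
    obtain b2 where b2: "0 \<le> b2" "\<And>x. \<bar>\<psi> x\<bar> \<le> b2" using line_bounded[OF lf(2)] by blast
    obtain b1' where b1': "0 \<le> b1'" "\<And>x. \<bar>\<phi>' x\<bar> \<le> b1'" using line_bounded[OF lg(1)] by blast
    obtain b2' where b2': "0 \<le> b2'" "\<And>x. \<bar>\<psi>' x\<bar> \<le> b2'" using line_bounded[OF lg(2)] by blast
    define H where "H = \<bar>\<eta> 1 * \<eta>' 1\<bar> + \<bar>\<eta> (- 1) * \<eta>' (- 1)\<bar>"
    \<comment> \<open>From P1 P2 - Q1 Q2 = (P1 - Q1) P2 + Q1 (P2 - Q2). The division by q is due to
      y: with its dual coordinate it adds up to N + s, which may be N - 1.\<close>
    define K3 where "K3 = H * (D1 * (b2 * b2') + b1 * b1' * (D2 / q))"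
    have K30: "0 \<le> K3" using D1 D2 b1 b1' b2 b2' q_pos by (simp add: K3_def H_def)
    have "\<bar>f0 i * g0 (i + k) - g0 i * f0 (i + l)\<bar> \<le> K3 * q powi deg i" if i: "i \<in> V" for i
    proof (cases "ks = 0 \<and> ls = 0")
      case False
      hence "r \<eta> = (\<lambda>_. 0) \<or> r \<eta>' = (\<lambda>_. 0)" using lf(3) lg(3) by (auto simp: r_def)
      hence "f0 = (\<lambda>_. 0) \<or> g0 = (\<lambda>_. 0)" by (auto simp: f0_def g0_def prodsym_def)
      thus ?thesis using K30 powi_pos[of "deg i"] by auto
    next
      case True
      obtain s N x y where ii: "i = (s, N, x, y)" by (metis surj_pair)
      have s: "s = 1 \<or> s = - 1" using i by (auto simp: ii V_def)
      define P1 Q1 P2 Q2 where "P1 = \<phi> x * \<phi>' (N - x + (kN - kx))" and "Q1 = \<phi> (x + lx) * \<phi>' (N - x)"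
        and "P2 = \<psi> y * \<psi>' (N + s - y + (kN + ks - ky))" and "Q2 = \<psi> (y + ly) * \<psi>' (N + s - y)"
      have d1: "\<bar>P1 - Q1\<bar> \<le> D1 * q powi N" using D1(2)[of x "N - x"] by (simp add: P1_def Q1_def)
      have "\<bar>P2 - Q2\<bar> \<le> D2 * q powi (N + s)" using D2(2)[of y "N + s - y"] by (simp add: P2_def Q2_def)
      also have "\<dots> \<le> D2 * q powi (N - 1)" using s D2 by (intro mult_left_mono powi_antimono) auto
      finally have d2: "\<bar>P2 - Q2\<bar> \<le> D2 / q * q powi N" by (simp add: powi_diff)
      have h: "\<bar>\<eta> s * \<eta>' s\<bar> \<le> H" using s by (auto simp: H_def)
      have "f0 i * g0 (i + k) - g0 i * f0 (i + l) = (\<eta> s * \<eta>' s) * (P1 * P2 - Q1 * Q2)"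
        using True s by (simp add: f0_def g0_def ii k l bar_def prodsym_def r_def P1_def P2_def Q1_def Q2_def
            algebra_simps)
      also have "P1 * P2 - Q1 * Q2 = (P1 - Q1) * P2 + Q1 * (P2 - Q2)" by (simp add: algebra_simps)
      finally have "\<bar>f0 i * g0 (i + k) - g0 i * f0 (i + l)\<bar> = \<bar>\<eta> s * \<eta>' s\<bar> * \<bar>(P1 - Q1) * P2 + Q1 * (P2 - Q2)\<bar>"
        by (simp add: abs_mult)
      also have "\<dots> \<le> H * (D1 * q powi N * (b2 * b2') + b1 * b1' * (D2 / q * q powi N))"
      proof (intro mult_mono h)
        have "\<bar>(P1 - Q1) * P2\<bar> \<le> D1 * q powi N * (b2 * b2')"
          unfolding abs_mult P2_def using d1 D1 b2 b2' powi_pos[of N] by (intro mult_mono) auto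
        moreover have "\<bar>Q1 * (P2 - Q2)\<bar> \<le> b1 * b1' * (D2 / q * q powi N)"
          unfolding abs_mult Q1_def using d2 b1 b1' by (intro mult_mono) auto
        ultimately show "\<bar>(P1 - Q1) * P2 + Q1 * (P2 - Q2)\<bar> \<le>
            D1 * q powi N * (b2 * b2') + b1 * b1' * (D2 / q * q powi N)" by linarith
      qed (auto simp: H_def)
      also have "\<dots> = K3 * q powi deg i" by (simp add: K3_def ii algebra_simps)
      finally show ?thesis .
    qed
    thus thesis using that K30 by blast
  qed
  have "\<bar>shift_comm g l f k i\<bar> \<le> (K1 + K2 + K3) * \<rho> powi deg i" if i: "i \<in> V" for i
  proof -
    have "K3 * q powi deg i \<le> K3 * \<rho> powi deg i"
      using K3(2) \<rho> q_pos deg_nonneg[OF i] by (intro mult_left_mono power_int_mono) auto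
    hence "\<bar>f0 i * g0 (i + k) - g0 i * f0 (i + l)\<bar> \<le> K3 * \<rho> powi deg i" using K3(1)[OF i] by linarith
    thus ?thesis using p1[OF i] p2[OF i] unfolding shift_comm_def distrib_right by linarith
  qed
  thus thesis by (rule that)
qed

section \<open>Operators of left and right type\<close>

definition left_ops :: "real \<Rightarrow> (spinor \<Rightarrow> spinor) set"
  where "left_ops \<rho> = {wshift f k | f k. symb \<rho> k f}"

definition right_ops :: "real \<Rightarrow> (spinor \<Rightarrow> spinor) set"
  where "right_ops \<rho> = {wshift g l | g l. symb \<rho> (bar l) (\<lambda>i. g (bar i))}"

lemma symb_mono: "symb \<rho> k f \<Longrightarrow> q \<le> \<rho> \<Longrightarrow> \<rho> \<le> \<rho>' \<Longrightarrow> symb \<rho>' k f"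
proof -
  assume f: "symb \<rho> k f" and \<rho>: "q \<le> \<rho>" "\<rho> \<le> \<rho>'"
  obtain \<eta> \<phi> \<psi> C where *: "sym_parts k \<eta> \<phi> \<psi>"
    "\<And>i. i \<in> V \<Longrightarrow> \<bar>f i - prodsym \<eta> \<phi> \<psi> i\<bar> \<le> C * \<rho> powi deg i"
    and v: "\<And>i. i \<in> V \<Longrightarrow> i + k \<notin> V \<Longrightarrow> f i = 0"
    by (rule symbE[OF f]) (rule that)
  have "\<bar>f i - prodsym \<eta> \<phi> \<psi> i\<bar> \<le> \<bar>C\<bar> * \<rho>' powi deg i" if i: "i \<in> V" for i
  proof -
    have "C * \<rho> powi deg i \<le> \<bar>C\<bar> * \<rho>' powi deg i"
      using \<rho> q_pos deg_nonneg[OF i] by (intro mult_mono power_int_mono) auto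
    thus ?thesis using *(2)[OF i] by linarith
  qed
  thus ?thesis using v by (intro symb_intro[OF *(1)])
qed

lemma right_ops_bounded: "S \<in> right_ops \<rho> \<Longrightarrow> q \<le> \<rho> \<Longrightarrow> \<rho> < 1 \<Longrightarrow> bounded_clin S"
  and left_ops_bounded: "S \<in> left_ops \<rho> \<Longrightarrow> q \<le> \<rho> \<Longrightarrow> \<rho> < 1 \<Longrightarrow> bounded_clin S"
proof -
  assume "S \<in> right_ops \<rho>" and \<rho>: "q \<le> \<rho>" "\<rho> < 1"
  then obtain g l where S: "S = wshift g l" "symb \<rho> (bar l) (\<lambda>i. g (bar i))" by (auto simp: right_ops_def)
  obtain B where "\<And>i. i \<in> V \<Longrightarrow> \<bar>g (bar i)\<bar> \<le> B"
    using symb_bounded[OF S(2) \<rho>] by (auto simp: bounded_symbol_def)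
  hence "\<bar>g i\<bar> \<le> B" if "i \<in> V" for i using that bar_simps by metis
  thus "bounded_clin S" unfolding S by (intro bounded_clin_wshift bounded_symbolI)
next
  assume "S \<in> left_ops \<rho>" "q \<le> \<rho>" "\<rho> < 1"
  thus "bounded_clin S" by (auto simp: left_ops_def intro: bounded_clin_wshift symb_bounded)
qed

lemma sqrt_q: "q \<le> sqrt q" "sqrt q < 1"
  using q_pos q_less_1 by (auto intro!: real_le_rsqrt simp: power2_eq_square mult_le_one)

text \<open>The rate is dictated by \<open>L\<close>, whose eigenvalue q^j is the N-th power of
  \<open>sqrt q\<close>.\<close>

lemma commutator_left_right:
  assumes L: "bounded_clin L" "\<And>i. i \<in> V \<Longrightarrow> L (e i) = sqrt q powi deg i *\<^sub>R e i"
    and S: "S \<in> right_ops (sqrt q)" and T: "T \<in> left_ops (sqrt q)"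
  shows "commutator S T \<in> Idl\<^bsub>bounded_ops\<^esub> {L}"
proof -
  note \<rho> = sqrt_q
  obtain f k where T: "T = wshift f k" and f: "symb (sqrt q) k f" using T by (auto simp: left_ops_def)
  obtain g l where S: "S = wshift g l" and g: "symb (sqrt q) (bar l) (\<lambda>i. g (bar i))"
    using S by (auto simp: right_ops_def)
  have bf: "bounded_symbol f" by (rule symb_bounded[OF f \<rho>])
  obtain B where "\<And>i. i \<in> V \<Longrightarrow> \<bar>g (bar i)\<bar> \<le> B"
    using symb_bounded[OF g \<rho>] by (auto simp: bounded_symbol_def)
  hence "\<bar>g i\<bar> \<le> B" if "i \<in> V" for i using that bar_simps by metis
  hence bg: "bounded_symbol g" by (rule bounded_symbolI)
  obtain C where C: "\<And>i. i \<in> V \<Longrightarrow> \<bar>shift_comm g l f k i\<bar> \<le> C * sqrt q powi deg i"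
    using symb_commute[OF f g \<rho>] by blast
  show ?thesis unfolding S T commutator_wshift[OF bg bf]
    by (rule wshift_in_ideal[OF L _ C bounded_shift_comm[OF bg bf]]) (use q_pos in auto)
qed

section \<open>Symbols of the generators\<close>

text \<open>1 - rt n \<le> 1 - (rt n)^2 = q^(2n) \<le> q^n.\<close>

lemma rt_close: "0 \<le> n \<Longrightarrow> \<bar>rt n - 1\<bar> \<le> q powi n"
proof -
  assume n: "0 \<le> n"
  have p: "0 < q powi n" "q powi n \<le> 1" using powi_pos powi_le_1[OF n] by auto
  have "1 - (rt n)\<^sup>2 = (q powi n)\<^sup>2" using rt_sq[OF n] by simp
  hence "(1 - rt n) * (1 + rt n) \<le> q powi n"
    using mult_left_le[of "q powi n" "q powi n"] p unfolding power2_eq_square distrib_left left_diff_distrib by linarith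
  moreover have "(1 - rt n) * 1 \<le> (1 - rt n) * (1 + rt n)"
    using rt_nonneg[OF n] rt_le_1[of n] by (intro mult_left_mono) auto
  ultimately show ?thesis using rt_le_1[of n] by simp
qed

text \<open>The limit is 1, so \<kappa>' has to be 0. For x < 0 the estimate is free, as q^x \<ge> 1
  there; the same holds in the lemmas that follow with a cut-off at 0.\<close>

lemma line_rt_suc: "line 1 0 (\<lambda>x. if x < 0 then 0 else rt (x + 1))"
proof -
  have "\<bar>(if x < 0 then 0 else rt (x + 1)) - 1\<bar> \<le> 1 * q powi x" for x
  proof (cases "x < 0")
    case True thus ?thesis using powi_antimono[of x 0] by simp
  next
    case False
    hence "\<bar>rt (x + 1) - 1\<bar> \<le> q powi (x + 1)" by (intro rt_close) auto
    also have "\<dots> \<le> q powi x" by (intro powi_antimono) auto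
    finally show ?thesis using False by simp
  qed
  hence "\<exists>l C. (0 \<noteq> (0::int) \<longrightarrow> l = 0) \<and> (\<forall>x. \<bar>(if x < 0 then 0 else rt (x + 1)) - l\<bar> \<le> C * q powi x)"
    by blast
  thus ?thesis by (auto simp: line_def)
qed

lemma line_rt: "line (- 1) 0 (\<lambda>x. c * (if x < 0 then 0 else rt x))"
proof -
  have est: "\<bar>c * (if x < 0 then 0 else rt x) - c\<bar> \<le> \<bar>c\<bar> * q powi x" for x
  proof -
    have "\<bar>(if x < 0 then 0 else rt x) - 1\<bar> \<le> q powi x"
      using rt_close[of x] powi_antimono[of x 0] by simp
    hence "\<bar>c\<bar> * \<bar>(if x < 0 then 0 else rt x) - 1\<bar> \<le> \<bar>c\<bar> * q powi x" by (rule mult_left_mono) simp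
    thus ?thesis unfolding abs_mult[symmetric] right_diff_distrib by simp
  qed
  moreover have "x < 0 \<or> x + - 1 < 0 \<longrightarrow> c * (if x < 0 then 0 else rt x) = 0" for x
  proof
    assume "x < 0 \<or> x + - 1 < 0"
    hence "x < 0 \<or> x = 0" by auto
    thus "c * (if x < 0 then 0 else rt x) = 0" by auto
  qed
  ultimately show ?thesis using est unfolding line_def by blast
qed

text \<open>The limit is 0, whence any \<kappa>' is allowed.\<close>

lemma line_pow: "line 0 \<kappa>' (\<lambda>x. c * (if x < 0 then 0 else q powi x))"
proof -
  have "\<bar>c * (if x < 0 then 0 else q powi x) - 0\<bar> \<le> \<bar>c\<bar> * q powi x" for x
    using powi_pos[of x] by (simp add: abs_mult)
  hence "\<exists>C. \<forall>x. \<bar>c * (if x < 0 then 0 else q powi x) - 0\<bar> \<le> C * q powi x" by blast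
  moreover have "\<forall>x. x < 0 \<or> x + 0 < 0 \<longrightarrow> c * (if x < 0 then 0 else q powi x) = 0" by auto
  ultimately show ?thesis unfolding line_def by blast
qed

text \<open>1 / (1 - q^(2m)) - 1 = q^(2m) / (1 - q^(2m)), and the denominator is at least 1 - q^2 as
  m \<ge> 1.\<close>

lemma inverse_rt_sq_close:
  assumes "1 \<le> m" shows "\<bar>1 / (rt m)\<^sup>2 - 1\<bar> \<le> q powi m / (1 - q\<^sup>2)" "1 / (rt m)\<^sup>2 \<le> 1 / (1 - q\<^sup>2)" "0 < 1 - q\<^sup>2"
proof -
  show q2: "0 < 1 - q\<^sup>2" using q_pos q_less_1 by (simp add: power_less_one_iff)
  have r: "(rt m)\<^sup>2 = 1 - (q powi m)\<^sup>2" using assms by (intro rt_sq) auto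
  have "q powi m \<le> q" using powi_antimono[OF assms] by simp
  hence "(q powi m)\<^sup>2 \<le> q\<^sup>2" using powi_pos[of m] by (intro power_mono) auto
  hence R: "1 - q\<^sup>2 \<le> (rt m)\<^sup>2" using r by simp
  hence R0: "0 < (rt m)\<^sup>2" using q2 by linarith
  show "1 / (rt m)\<^sup>2 \<le> 1 / (1 - q\<^sup>2)" using R q2 by (simp add: frac_le)
  have "1 / (rt m)\<^sup>2 - 1 = (q powi m)\<^sup>2 / (rt m)\<^sup>2" using R0 by (simp only: r) (simp add: field_simps)
  moreover have "(q powi m)\<^sup>2 / (rt m)\<^sup>2 \<le> q powi m / (1 - q\<^sup>2)"
    using R q2 powi_pos[of m] powi_le_1[of m] assms
    by (intro frac_le) (auto simp: power2_eq_square mult_left_le)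
  moreover have "0 \<le> (q powi m)\<^sup>2 / (rt m)\<^sup>2" by simp
  ultimately show "\<bar>1 / (rt m)\<^sup>2 - 1\<bar> \<le> q powi m / (1 - q\<^sup>2)" by linarith
qed

text \<open>\<open>symb\<close> wants the weight to be 0 where the target leaves \<open>V\<close>.
  Setting it to 0 there does not change the operator, and by \<open>symbI\<close> it does not spoil
  the estimate.\<close>

lemma symb_restrict:
  assumes parts: "sym_parts k \<eta> \<phi> \<psi>"
    and f: "\<And>i. i \<in> V \<Longrightarrow> \<bar>f i - prodsym \<eta> \<phi> \<psi> i\<bar> \<le> C * q powi deg i"
  shows "bounded_symbol f" "wshift f k \<in> left_ops q"
proof -
  obtain B where B: "0 \<le> B" "\<And>i. i \<in> V \<Longrightarrow> \<bar>prodsym \<eta> \<phi> \<psi> i\<bar> \<le> B"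
    by (rule prodsym_bounded[OF parts]) (rule that)
  show b: "bounded_symbol f"
  proof (rule bounded_symbolI)
    fix i assume i: "i \<in> V"
    have "C * q powi deg i \<le> \<bar>C\<bar> * 1"
      using powi_le_1[OF deg_nonneg[OF i]] powi_pos[of "deg i"] by (intro mult_mono) auto
    thus "\<bar>f i\<bar> \<le> B + \<bar>C\<bar>" using f[OF i] B(2)[OF i] by linarith
  qed
  let ?f = "\<lambda>i. if i + k \<in> V then f i else 0"
  have s: "symb q k ?f" by (rule symbI[OF parts order_refl f])
  have "wshift f k = wshift ?f k" by (rule wshift_cong[OF symb_bounded[OF s order_refl q_less_1] _ b]) simp
  thus "wshift f k \<in> left_ops q" using s unfolding left_ops_def by blast
qed

section \<open>Estimates of the four weights of one generator\<close>

context
  fixes g t Gp Gm gp gm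
  assumes g: "gen_action g t Gp Gm"
    and Gp: "\<And>L Y. 0 \<le> Y \<Longrightarrow> Y \<le> L \<Longrightarrow> \<bar>Gp L Y\<bar> \<le> 1 \<and> \<bar>Gp L Y - gp Y\<bar> \<le> q powi L"
    and Gm: "\<And>L Y. 0 \<le> Y \<Longrightarrow> Y \<le> L \<Longrightarrow> \<bar>Gm L Y\<bar> \<le> 1 \<and> \<bar>Gm L Y - gm Y\<bar> \<le> q powi L"
    and gp: "line t (1 - t) gp" and gm: "line (t - 1) (- t) gm"
begin

text \<open>For large N the squared root in the denominator tends to 1 and \<open>Gp\<close> to
  \<open>gp\<close>, which leaves the product of rt (x + 1) and gp y.\<close>

lemma f_raise_left: "bounded_symbol (f_raise Gp)" "wshift (f_raise Gp) (0, 1, 1, t) \<in> left_ops q"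
proof -
  define \<phi> where "\<phi> = (\<lambda>x. if x < 0 then 0 else rt (x + 1))"
  have parts: "sym_parts (0, 1, 1, t) (\<lambda>_. 1) \<phi> gp"
    using gp line_rt_suc by (simp add: sym_parts_def \<phi>_def)
  have est: "\<bar>f_raise Gp i - prodsym (\<lambda>_. 1) \<phi> gp i\<bar> \<le> (1 / (1 - q\<^sup>2) + 1 / q) * q powi deg i" if i: "i \<in> V" for i
  proof -
    obtain s N x y where ii: "i = (s, N, x, y)" by (metis surj_pair)
    note v = V_D[OF i[unfolded ii]]
    define m where "m = (if s = 1 then N + 2 else N + 1)"
    have m: "1 \<le> m" "N \<le> m" using v by (auto simp: m_def)
    note c = inverse_rt_sq_close[OF m(1)]
    note G = Gp[OF v(4,5)]
    have r: "0 \<le> rt (x + 1)" "rt (x + 1) \<le> 1" using v by (auto intro: rt_nonneg rt_le_1)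
    have "f_raise Gp i - prodsym (\<lambda>_. 1) \<phi> gp i =
        rt (x + 1) * (Gp (N + s) y * (1 / (rt m)\<^sup>2 - 1) + (Gp (N + s) y - gp y))"
      using v by (simp add: ii f_raise_def prodsym_def \<phi>_def m_def[symmetric] algebra_simps)
    hence "\<bar>f_raise Gp i - prodsym (\<lambda>_. 1) \<phi> gp i\<bar> =
        rt (x + 1) * \<bar>Gp (N + s) y * (1 / (rt m)\<^sup>2 - 1) + (Gp (N + s) y - gp y)\<bar>"
      using r by (simp add: abs_mult)
    also have "\<dots> \<le> 1 * (1 * (q powi m / (1 - q\<^sup>2)) + q powi (N + s))"
    proof (intro mult_mono r)
      have "\<bar>Gp (N + s) y * (1 / (rt m)\<^sup>2 - 1)\<bar> \<le> 1 * (q powi m / (1 - q\<^sup>2))"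
        unfolding abs_mult using G c by (intro mult_mono) auto
      thus "\<bar>Gp (N + s) y * (1 / (rt m)\<^sup>2 - 1) + (Gp (N + s) y - gp y)\<bar> \<le> 1 * (q powi m / (1 - q\<^sup>2)) + q powi (N + s)"
        using G by linarith
    qed auto
    also have "\<dots> \<le> q powi N / (1 - q\<^sup>2) + q powi (N - 1)"
    proof -
      have "q powi m / (1 - q\<^sup>2) \<le> q powi N / (1 - q\<^sup>2)"
        using c(3) m powi_antimono[of N m] by (intro divide_right_mono) auto
      moreover have "q powi (N + s) \<le> q powi (N - 1)" using v by (intro powi_antimono) auto
      ultimately show ?thesis by simp
    qed
    also have "\<dots> = (1 / (1 - q\<^sup>2) + 1 / q) * q powi deg i" by (simp add: ii powi_diff algebra_simps)
    finally show ?thesis .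
  qed
  show "bounded_symbol (f_raise Gp)" "wshift (f_raise Gp) (0, 1, 1, t) \<in> left_ops q"
    using symb_restrict[OF parts est] by auto
qed

text \<open>The factor rt (N - x) is not a function of x, but it differs from 1 by at most q^(N -
  x), which the accompanying q^x turns into q^N.\<close>

lemma f_lower_left: "bounded_symbol (f_lower Gm)" "wshift (f_lower Gm) (0, - 1, 0, t - 1) \<in> left_ops q"
proof -
  define \<phi> where "\<phi> = (\<lambda>x. 1 * (if x < 0 then 0 else q powi x))"
  have parts: "sym_parts (0, - 1, 0, t - 1) (\<lambda>_. 1) \<phi> gm"
    using gm line_pow[of _ 1] by (simp add: sym_parts_def \<phi>_def)
  have est: "\<bar>f_lower Gm i - prodsym (\<lambda>_. 1) \<phi> gm i\<bar> \<le> (1 / (1 - q\<^sup>2) + 1 + 1 / q) * q powi deg i" if i: "i \<in> V" for i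
  proof -
    obtain s N x y where ii: "i = (s, N, x, y)" by (metis surj_pair)
    note v = V_D[OF i[unfolded ii]]
    \<comment> \<open>For s = - 1 the denominator is the square of \<open>rt N\<close>; it is
      nonzero because 0 \<le> y \<le> N - 1 forces N \<ge> 1.\<close>
    define m where "m = (if s = 1 then N + 1 else N)"
    have m: "1 \<le> m" "N \<le> m" using v by (auto simp: m_def)
    note c = inverse_rt_sq_close[OF m(1)]
    note G = Gm[OF v(4,5)]
    have w: "0 < q powi x" "q powi x \<le> 1" using v by (auto intro: powi_pos powi_le_1)
    have r: "0 \<le> rt (N - x)" "rt (N - x) \<le> 1" "\<bar>rt (N - x) - 1\<bar> \<le> q powi (N - x)"
      using v by (auto intro: rt_nonneg rt_le_1 rt_close)
    have "f_lower Gm i - prodsym (\<lambda>_. 1) \<phi> gm i =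
        q powi x * (Gm (N + s) y * rt (N - x) * (1 / (rt m)\<^sup>2 - 1)) +
        q powi x * (Gm (N + s) y * (rt (N - x) - 1)) + q powi x * (Gm (N + s) y - gm y)"
      using v by (simp add: ii f_lower_def prodsym_def \<phi>_def m_def[symmetric] algebra_simps)
    moreover have "\<bar>q powi x * (Gm (N + s) y * rt (N - x) * (1 / (rt m)\<^sup>2 - 1))\<bar> \<le>
        1 * (1 * 1 * (q powi m / (1 - q\<^sup>2)))"
      unfolding abs_mult using w r c G by (intro mult_mono) auto
    moreover have "\<bar>q powi x * (Gm (N + s) y * (rt (N - x) - 1))\<bar> \<le> q powi x * (1 * q powi (N - x))"
      unfolding abs_mult using w r G by (intro mult_mono) auto
    moreover have "\<bar>q powi x * (Gm (N + s) y - gm y)\<bar> \<le> 1 * q powi (N + s)"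
      unfolding abs_mult using w G by (intro mult_mono) auto
    moreover have "q powi x * (1 * q powi (N - x)) = q powi N" by (simp flip: powi_add)
    moreover have "q powi m / (1 - q\<^sup>2) \<le> q powi N / (1 - q\<^sup>2)"
      using c(3) m powi_antimono[of N m] by (intro divide_right_mono) auto
    moreover have "q powi (N + s) \<le> q powi (N - 1)" using v by (intro powi_antimono) auto
    ultimately have "\<bar>f_lower Gm i - prodsym (\<lambda>_. 1) \<phi> gm i\<bar> \<le> q powi N / (1 - q\<^sup>2) + q powi N + q powi (N - 1)"
      by linarith
    also have "\<dots> = (1 / (1 - q\<^sup>2) + 1 + 1 / q) * q powi deg i" by (simp add: ii powi_diff algebra_simps)
    finally show ?thesis .
  qed
  show "bounded_symbol (f_lower Gm)" "wshift (f_lower Gm) (0, - 1, 0, t - 1) \<in> left_ops q"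
    using symb_restrict[OF parts est] by auto
qed

lemma trivial_parts: "sym_parts k (\<lambda>_. 0) (\<lambda>_. 0) (\<lambda>_. 0)"
proof -
  have "\<exists>C. \<forall>x. \<bar>0 - 0\<bar> \<le> C * q powi x" by (rule exI[of _ 0]) simp
  hence "line \<kappa> \<kappa>' (\<lambda>_. 0)" for \<kappa> \<kappa>' unfolding line_def by blast
  thus ?thesis by (cases k) (simp add: sym_parts_def)
qed

text \<open>The weight has an explicit factor q^N and is entirely remainder, so any shift
  \<open>k\<close> will do.\<close>

lemma f_up_dn_left: "bounded_symbol (f_up_dn Gm)" "wshift (f_up_dn Gm) k \<in> left_ops q"
proof -
  have est: "\<bar>f_up_dn Gm i - prodsym (\<lambda>_. 0) (\<lambda>_. 0) (\<lambda>_. 0) i\<bar> \<le> (1 / (1 - q\<^sup>2))\<^sup>2 * q powi deg i"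
    if i: "i \<in> V" for i
  proof -
    obtain s N x y where ii: "i = (s, N, x, y)" by (metis surj_pair)
    note v = V_D[OF i[unfolded ii]]
    show ?thesis
    proof (cases "s = 1")
      case False
      thus ?thesis using powi_pos[of N] by (simp add: ii f_up_dn_def prodsym_def)
    next
      case True
      have m: "1 \<le> N + 1" "1 \<le> N + 2" using v by auto
      note c1 = inverse_rt_sq_close[OF m(1)] and c2 = inverse_rt_sq_close[OF m(2)]
      note G = Gm[OF v(4,5)]
      have r: "0 \<le> rt (x + 1)" "rt (x + 1) \<le> 1" using v by (auto intro: rt_nonneg rt_le_1)
      have "f_up_dn Gm i = (1 - q\<^sup>2) * q powi N * rt (x + 1) * Gm (N + s) y * (1 / (rt (N + 1))\<^sup>2) * (1 / (rt (N + 2))\<^sup>2)"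
        using True by (simp add: ii f_up_dn_def)
      also have "\<bar>\<dots>\<bar> \<le> 1 * q powi N * 1 * 1 * (1 / (1 - q\<^sup>2)) * (1 / (1 - q\<^sup>2))"
        unfolding abs_mult using c1 c2 r G powi_pos[of N] by (intro mult_mono) (auto simp: abs_le_iff)
      finally show ?thesis by (simp add: ii prodsym_def power2_eq_square)
    qed
  qed
  show "bounded_symbol (f_up_dn Gm)" "wshift (f_up_dn Gm) k \<in> left_ops q"
    using symb_restrict[OF trivial_parts est] by auto
qed

lemma f_dn_up_left: "bounded_symbol (f_dn_up Gp)" "wshift (f_dn_up Gp) k \<in> left_ops q"
proof -
  have est: "\<bar>f_dn_up Gp i - prodsym (\<lambda>_. 0) (\<lambda>_. 0) (\<lambda>_. 0) i\<bar> \<le> (1 / (1 - q\<^sup>2))\<^sup>2 * q powi deg i"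
    if i: "i \<in> V" for i
  proof -
    obtain s N x y where ii: "i = (s, N, x, y)" by (metis surj_pair)
    note v = V_D[OF i[unfolded ii]]
    show ?thesis
    proof (cases "s = 1")
      case True
      thus ?thesis using powi_pos[of N] by (simp add: ii f_dn_up_def prodsym_def)
    next
      case False
      have m: "1 \<le> N" "1 \<le> N + 1" using v False by auto
      note c1 = inverse_rt_sq_close[OF m(1)] and c2 = inverse_rt_sq_close[OF m(2)]
      note G = Gp[OF v(4,5)]
      have r: "0 \<le> rt (N - x)" "rt (N - x) \<le> 1" using v by (auto intro: rt_nonneg rt_le_1)
      have w: "q powi (N + x) \<le> q powi N" using v by (intro powi_antimono) auto
      have "f_dn_up Gp i = - ((1 - q\<^sup>2) * q powi (N + x) * rt (N - x) * Gp (N + s) y * (1 / (rt N)\<^sup>2) * (1 / (rt (N + 1))\<^sup>2))"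
        using False by (simp add: ii f_dn_up_def) (simp add: divide_simps algebra_simps)
      also have "\<bar>\<dots>\<bar> \<le> 1 * q powi N * 1 * 1 * (1 / (1 - q\<^sup>2)) * (1 / (1 - q\<^sup>2))"
        unfolding abs_minus_cancel abs_mult using c1 c2 r G w powi_pos[of N] powi_pos[of "N + x"]
        by (intro mult_mono) (auto simp: abs_le_iff)
      finally show ?thesis by (simp add: ii prodsym_def power2_eq_square)
    qed
  qed
  show "bounded_symbol (f_dn_up Gp)" "wshift (f_dn_up Gp) k \<in> left_ops q"
    using symb_restrict[OF trivial_parts est] by auto
qed

lemma generator_left: "tensor_id g \<in> op_sums (left_ops q)"
proof -
  \<comment> \<open>Nested to the right and closed by 0, in the shape that \<open>op_sums\<close>
    generates.\<close>
  let ?T = "\<lambda>v. wshift (f_raise Gp) (0, 1, 1, t) v + (wshift (f_lower Gm) (0, - 1, 0, t - 1) v +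
      (wshift (f_up_dn Gm) (- 2, 1, 1, t - 1) v + (wshift (f_dn_up Gp) (2, - 1, 0, t) v + 0)))"
  have "tensor_id g = ?T"
  proof (rule eq_on_basis)
    fix i assume i: "i \<in> V"
    obtain s N x y where ii: "i = (s, N, x, y)" by (metis surj_pair)
    show "tensor_id g (e i) = ?T (e i)"
      using tensor_id_e[OF g i[unfolded ii]] i
      by (simp add: wshift_e f_raise_left(1) f_lower_left(1) f_up_dn_left(1) f_dn_up_left(1) ii add.assoc)
  next
    show "bounded_clin (tensor_id g)" using g by (simp add: gen_action_def bounded_clin_tensor_id)
    show "bounded_clin ?T"
      by (intro bounded_clin_plus bounded_clin_wshift bounded_clin_const_zero
          f_raise_left(1) f_lower_left(1) f_up_dn_left(1) f_dn_up_left(1))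
  qed
  moreover have "?T \<in> op_sums (left_ops q)"
    by (intro op_sums.intros f_raise_left(2) f_lower_left(2) f_up_dn_left(2) f_dn_up_left(2))
  ultimately show ?thesis by simp
qed

end

section \<open>The four generators\<close>

lemma left_ops_adj: "S \<in> left_ops q \<Longrightarrow> adj S \<in> left_ops q"
proof -
  assume "S \<in> left_ops q"
  then obtain f k where S: "S = wshift f k" "symb q k f" by (auto simp: left_ops_def)
  show ?thesis unfolding S adj_wshift[OF symb_bounded[OF S(2) order_refl q_less_1]]
    using symb_adj[OF S(2) order_refl] unfolding left_ops_def by blast
qed

lemma powi_rt_close:
  assumes "0 \<le> m" "0 \<le> n" "L \<le> m + n"
  shows "\<bar>q powi m * rt n\<bar> \<le> 1" "\<bar>q powi m * rt n - q powi m\<bar> \<le> q powi L"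
proof -
  have w: "0 < q powi m" "q powi m \<le> 1" using assms by (auto intro: powi_pos powi_le_1)
  have r: "0 \<le> rt n" "rt n \<le> 1" using assms by (auto intro: rt_nonneg rt_le_1)
  show "\<bar>q powi m * rt n\<bar> \<le> 1" using mult_le_one[OF w(2) r] w r by simp
  have "q powi m * rt n - q powi m = q powi m * (rt n - 1)" by (simp add: algebra_simps)
  hence "\<bar>q powi m * rt n - q powi m\<bar> = q powi m * \<bar>rt n - 1\<bar>" using w by (simp add: abs_mult)
  also have "\<dots> \<le> q powi m * q powi n" using rt_close[OF assms(2)] w by (intro mult_left_mono) auto
  also have "\<dots> \<le> q powi L" unfolding powi_add[symmetric] by (rule powi_antimono[OF assms(3)])
  finally show "\<bar>q powi m * rt n - q powi m\<bar> \<le> q powi L" .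
qed

text \<open>\<open>gp\<close> and \<open>gm\<close> are the limits of \<open>Gp\<close> and
  \<open>Gm\<close> for growing L and fixed Y, set to 0 at negative arguments as \<open>line\<close>
  demands. The starred generators follow because left type is stable under adjoints.\<close>

lemma generators_left:
  assumes rep: "left_regular q rep"
  shows "spinor_rep rep (suq2_class q (gen l)) \<in> op_sums (left_ops q)"
proof -
  have sr: "star_representation q rep" using rep by (simp add: left_regular_def)
  have rt: "\<bar>rt n\<bar> \<le> 1" if "0 \<le> n" for n using rt_nonneg[OF that] rt_le_1[of n] by simp
  have a: "spinor_rep rep (suq2_class q (gen La)) \<in> op_sums (left_ops q)"
    unfolding spinor_rep_def
  proof (rule generator_left[OF gen_action_a[OF rep], where gp = "\<lambda>y. if y < 0 then 0 else rt (y + 1)"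
        and gm = "\<lambda>y. q * (if y < 0 then 0 else q powi y)"])
    fix L Y :: int assume Y: "0 \<le> Y" "Y \<le> L"
    show "\<bar>rt (Y + 1)\<bar> \<le> 1 \<and> \<bar>rt (Y + 1) - (if Y < 0 then 0 else rt (Y + 1))\<bar> \<le> q powi L"
      using rt[of "Y + 1"] Y powi_pos[of L] by simp
    show "\<bar>q powi (Y + 1) * rt (L - Y)\<bar> \<le> 1 \<and>
        \<bar>q powi (Y + 1) * rt (L - Y) - q * (if Y < 0 then 0 else q powi Y)\<bar> \<le> q powi L"
      using powi_rt_close[of "Y + 1" "L - Y" L] Y by (simp add: powi_add mult.commute)
  qed (use line_rt_suc line_pow in simp_all)
  have b: "spinor_rep rep (suq2_class q (gen Lb)) \<in> op_sums (left_ops q)"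
    unfolding spinor_rep_def
  proof (rule generator_left[OF gen_action_b[OF rep], where gp = "\<lambda>y. 1 * (if y < 0 then 0 else q powi y)"
        and gm = "\<lambda>y. - 1 * (if y < 0 then 0 else rt y)"])
    fix L Y :: int assume Y: "0 \<le> Y" "Y \<le> L"
    show "\<bar>- rt Y\<bar> \<le> 1 \<and> \<bar>- rt Y - - 1 * (if Y < 0 then 0 else rt Y)\<bar> \<le> q powi L"
      using rt[of Y] Y powi_pos[of L] by simp
    show "\<bar>q powi Y * rt (L - Y + 1)\<bar> \<le> 1 \<and>
        \<bar>q powi Y * rt (L - Y + 1) - 1 * (if Y < 0 then 0 else q powi Y)\<bar> \<le> q powi L"
      using powi_rt_close[of Y "L - Y + 1" L] Y by simp
  qed (use line_rt[of "- 1"] line_pow[of 1 1] in simp_all)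
  note bd = left_ops_bounded[OF _ order_refl q_less_1]
  show ?thesis
  proof (cases l)
    case La'
    show ?thesis unfolding La' spinor_rep_gen_star[OF sr, of La, simplified]
      by (rule op_sums_adj[OF a bd left_ops_adj])
  next
    case Lb'
    show ?thesis unfolding Lb' spinor_rep_gen_star[OF sr, of Lb, simplified]
      by (rule op_sums_adj[OF b bd left_ops_adj])
  qed (simp_all add: a b)
qed

section \<open>The operators $J$, $D$ and $L_q$\<close>

lemma left_ops_mono: "S \<in> left_ops q \<Longrightarrow> S \<in> left_ops (sqrt q)"
  unfolding left_ops_def using symb_mono[OF _ order_refl sqrt_q(1)] by blast

lemma right_ops_mono: "S \<in> right_ops q \<Longrightarrow> S \<in> right_ops (sqrt q)"
  unfolding right_ops_def using symb_mono[OF _ order_refl sqrt_q(1)] by blast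

section \<open>Action of J on the indexed basis\<close>

lemma V_up:
  assumes "(1, N, x, y) \<in> V"
  shows "(half N, x - half N, y - (real_of_int N + 1) / 2) \<in> up_index" (is "?p \<in> _")
    and "e (1, N, x, y) = ket_up q (half N) (x - half N) (y - (real_of_int N + 1) / 2)" (is "?l = ?r")
proof -
  have v: "0 \<le> x" "x \<le> N" "0 \<le> y" "y \<le> N + 1" using assms by (auto simp: V_def)
  have "half N \<in> half_nats" "x - half N \<in> steps (half N)"
    "y - half (N + 1) \<in> steps (half (N + 1))"
    unfolding half_int_in_half_nats steps_iff using v by auto
  thus "?p \<in> up_index"
    by (simp add: up_index_def add_divide_distrib)
  show "?l = ?r"
    using v by (simp only: ket_up_eq e_up_eq)
qed

lemma V_dn:
  assumes "(- 1, N, x, y) \<in> V"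
  shows "(half N, x - half N, y - (real_of_int N - 1) / 2) \<in> dn_index" (is "?p \<in> _")
    and "e (- 1, N, x, y) = ket_dn q (half N) (x - half N) (y - (real_of_int N - 1) / 2)" (is "?l = ?r")
proof -
  have v: "0 \<le> x" "x \<le> N" "0 \<le> y" "y \<le> N - 1" using assms by (auto simp: V_def)
  have "half N \<in> half_nats" "x - half N \<in> steps (half N)"
    "y - half (N - 1) \<in> steps (half (N - 1))"
    unfolding half_int_in_half_nats steps_iff using v by auto
  thus "?p \<in> dn_index"
    using v by (simp add: dn_index_def diff_divide_distrib)
  show "?l = ?r"
    using v by (simp only: ket_dn_eq e_dn_eq)
qed

lemma V_cases:
  assumes "i \<in> V"
  obtains N x y where "i = (1, N, x, y)" "(1, N, x, y) \<in> V" | N x y where "i = (- 1, N, x, y)" "(- 1, N, x, y) \<in> V"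
proof -
  obtain s N x y where i: "i = (s, N, x, y)" by (metis surj_pair)
  have "s = 1 \<or> s = - 1" using assms by (auto simp: i V_def)
  thus thesis using that assms i by blast
qed

lemma i_powi: "\<i> powi (2 * z - 1) = - \<i> * (- 1) powi z"
  by (simp add: power_int_diff power_int_mult)

text \<open>In integer coordinates the exponent of the imaginary unit is 2(x + y) - 1 on up vectors
  and 2(2N - x - y) - 1 on down vectors. As (- 1)^(2N) = 1, both arrows carry the same
  phase.\<close>

lemma e_real_structure:
  assumes J: "real_structure q J" and i: "i \<in> V"
  shows "J (e i) = (case i of (s, N, x, y) \<Rightarrow> - \<i> * (- 1) powi (x + y)) *\<^sub>C e (bar i)"
  using i
proof (cases rule: V_cases)
  case (1 N x y)
  have b: "(1, N, N - x, N + 1 - y) \<in> V" using 1 by (auto simp: V_def)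
  have r: "2 * (2 * (half N) + (x - half N) + (y - (real_of_int N + 1) / 2)) =
      real_of_int (2 * (x + y) - 1)"
    "- (x - half N) = real_of_int (N - x) - half N"
    "- (y - (real_of_int N + 1) / 2) = real_of_int (N + 1 - y) - (real_of_int N + 1) / 2"
    by (simp_all add: field_simps)
  have "\<forall>(j, \<mu>, n)\<in>up_index.
      J (ket_up q j \<mu> n) = (\<i> powi \<lfloor>2 * (2 * j + \<mu> + n)\<rfloor>) *\<^sub>C ket_up q j (- \<mu>) (- n)"
    using J by (simp add: real_structure_def)
  from bspec[OF this V_up(1)[OF 1(2)]]
  have "J (e i) = (\<i> powi (2 * (x + y) - 1)) *\<^sub>C e (1, N, N - x, N + 1 - y)"
    unfolding 1(1) V_up(2)[OF 1(2)] V_up(2)[OF b] case_prod_conv r floor_of_int .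
  also have "\<i> powi (2 * (x + y) - 1) = - \<i> * (- 1) powi (x + y)"
    by (rule i_powi)
  finally show ?thesis by (simp add: 1(1) bar_def)
next
  case (2 N x y)
  have b: "(- 1, N, N - x, N - 1 - y) \<in> V" using 2 by (auto simp: V_def)
  have r: "2 * (2 * (half N) - (x - half N) - (y - (real_of_int N - 1) / 2)) =
      real_of_int (2 * (2 * N - (x + y)) - 1)"
    "- (x - half N) = real_of_int (N - x) - half N"
    "- (y - (real_of_int N - 1) / 2) = real_of_int (N - 1 - y) - (real_of_int N - 1) / 2"
    by (simp_all add: field_simps)
  have "\<forall>(j, \<mu>, n)\<in>dn_index.
      J (ket_dn q j \<mu> n) = (\<i> powi \<lfloor>2 * (2 * j - \<mu> - n)\<rfloor>) *\<^sub>C ket_dn q j (- \<mu>) (- n)"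
    using J by (simp add: real_structure_def)
  from bspec[OF this V_dn(1)[OF 2(2)]]
  have "J (e i) = (\<i> powi (2 * (2 * N - (x + y)) - 1)) *\<^sub>C e (- 1, N, N - x, N - 1 - y)"
    unfolding 2(1) V_dn(2)[OF 2(2)] V_dn(2)[OF b] case_prod_conv r floor_of_int .
  also have "\<i> powi (2 * (2 * N - (x + y)) - 1) = - \<i> * (- 1) powi (2 * N - (x + y))"
    by (rule i_powi)
  also have "(- 1 :: complex) powi (2 * N - (x + y)) = (- 1) powi (x + y)"
  proof -
    have "((- 1 :: complex) powi z) * (- 1) powi z = 1" for z :: int
      by (simp flip: power_int_mult_distrib)
    hence "inverse ((- 1 :: complex) powi z) = (- 1) powi z" for z :: int by (rule inverse_unique)
    thus ?thesis by (simp add: power_int_diff power_int_mult divide_inverse)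
  qed
  finally show ?thesis by (simp add: 2(1) bar_def diff_diff_eq add.commute)
qed

text \<open>Along the shift by \<open>k\<close> the phase of \<open>J\<close> changes by the sign (-
  1)^(kx + ky), the same at every index. So conjugation only reflects the weight and multiplies it
  by a constant.\<close>

lemma left_ops_conj:
  assumes J: "real_structure q J" and S: "S \<in> left_ops q"
  shows "(\<lambda>v. J (S (inv_into UNIV J v))) \<in> right_ops q"
proof -
  obtain f k where S: "S = wshift f k" and f: "symb q k f" using S by (auto simp: left_ops_def)
  obtain ks kN kx ky where k: "k = (ks, kN, kx, ky)" by (metis surj_pair)
  have bf: "bounded_symbol f" by (rule symb_bounded[OF f order_refl q_less_1])
  have aJ: "antiunitary J" using J by (simp add: real_structure_def)
  define p where "p = (\<lambda>i::index. case i of (s, N, x, y) \<Rightarrow> - \<i> * (- 1) powi (x + y))"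
  define \<sigma> :: real where "\<sigma> = (- 1) powi (kx + ky)"
  have m1: "((- 1 :: complex) powi z) * (- 1) powi z = 1" for z :: int
    by (simp flip: power_int_mult_distrib)
  have 1: "cmod (p i) = 1" for i
    by (cases i) (simp add: p_def norm_mult norm_power_int)
  have 2: "p (i + k) * cnj (p i) = of_real \<sigma>" for i
  proof -
    obtain s N x y where ii: "i = (s, N, x, y)" by (metis surj_pair)
    have "(- 1 :: complex) powi (x + kx + (y + ky)) = (- 1) powi (x + y) * (- 1) powi (kx + ky)"
      by (simp add: power_int_add[symmetric] algebra_simps)
    moreover have "cnj ((- 1) powi z) = (- 1) powi z" for z :: int
      by (simp add: power_int_def)
    ultimately show ?thesis using m1[of "x + y"]
      by (simp add: p_def ii k \<sigma>_def of_real_power_int mult_ac)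
  qed
  have Je: "J (e i) = p i *\<^sub>C e (bar i)" if "i \<in> V" for i
    using e_real_structure[OF J that] by (simp add: p_def)
  have JT: "bounded_clin (\<lambda>v. J (wshift f k (inv_into UNIV J v)))"
    by (rule bounded_clin_conj[OF aJ bounded_clin_wshift[OF bf]])
  have "(\<lambda>v. J (S (inv_into UNIV J v))) = wshift (\<lambda>i. \<sigma> * f (bar i)) (bar k)"
    unfolding S by (rule conj_wshift(2)[OF aJ Je bar_simps(1,2,3) 1 2 bf JT])
  moreover have "symb q (bar (bar k)) (\<lambda>i. \<sigma> * f (bar (bar i)))"
    using symb_scale[OF f] by simp
  ultimately show ?thesis unfolding right_ops_def by blast
qed

section \<open>Commutators with D and the eigenvalues of L\<close>

lemma linear_times_powi_bounded:
  assumes "0 < \<rho>" "\<rho> < 1"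
  obtains B :: real where "0 \<le> B" "\<And>n. 0 \<le> n \<Longrightarrow> real_of_int n * \<rho> powi n \<le> B"
proof -
  have "(\<lambda>n. real n * \<rho> ^ n) \<longlonglongrightarrow> 0"
    using powser_times_n_limit_0[of \<rho>] assms by simp
  hence "Bseq (\<lambda>n. real n * \<rho> ^ n)" by (intro convergent_imp_Bseq convergentI)
  then obtain B where B: "\<And>n. norm (real n * \<rho> ^ n) \<le> B" by (auto simp: Bseq_def)
  have "real_of_int n * \<rho> powi n \<le> B" if "0 \<le> n" for n
    using B[of "nat n"] that assms by (simp add: power_int_def)
  moreover have "0 \<le> B" using order_trans[OF norm_ge_zero B[of 0]] .
  ultimately show thesis using that by blast
qed

definition dirac_eig :: "real \<Rightarrow> real \<Rightarrow> real \<Rightarrow> real \<Rightarrow> index \<Rightarrow> real"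
  where "dirac_eig c1u c2u c1d c2d =
    (\<lambda>(s, N, x, y). if s = 1 then c1u * (N / 2) + c2u else c1d * (N / 2) + c2d)"

lemma e_dirac:
  assumes D: "dirac_operator q (\<lambda>j. c1u * j + c2u) (\<lambda>j. c1d * j + c2d) E D" and i: "i \<in> V"
  shows "e i \<in> E \<and> D (e i) = dirac_eig c1u c2u c1d c2d i *\<^sub>R e i"
  using i
proof (cases rule: V_cases)
  case (1 N x y)
  have "\<forall>(j, \<mu>, n)\<in>up_index.
      ket_up q j \<mu> n \<in> E \<and> D (ket_up q j \<mu> n) = (c1u * j + c2u) *\<^sub>R ket_up q j \<mu> n"
    using D by (simp add: dirac_operator_def)
  from bspec[OF this V_up(1)[OF 1(2)]] show ?thesis
    unfolding 1(1) case_prod_conv V_up(2)[OF 1(2), symmetric] by (simp add: dirac_eig_def)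
next
  case (2 N x y)
  have "\<forall>(j, \<mu>, n)\<in>dn_index.
      ket_dn q j \<mu> n \<in> E \<and> D (ket_dn q j \<mu> n) = (c1d * j + c2d) *\<^sub>R ket_dn q j \<mu> n"
    using D by (simp add: dirac_operator_def)
  from bspec[OF this V_dn(1)[OF 2(2)]] show ?thesis
    unfolding 2(1) case_prod_conv V_dn(2)[OF 2(2), symmetric] by (simp add: dirac_eig_def)
qed

lemma e_L_q:
  assumes L: "is_L_q q L" and i: "i \<in> V"
  shows "L (e i) = sqrt q powi deg i *\<^sub>R e i"
proof -
  have pow: "q powr (half N) = sqrt q powi N" for N
  proof -
    have "q powr (half N) = (q powr (1 / 2)) powr real_of_int N" by (simp add: powr_powr)
    also have "\<dots> = sqrt q powi N" using q_pos by (simp add: powr_half_sqrt powr_real_of_int')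
    finally show ?thesis .
  qed
  from i show ?thesis
  proof (cases rule: V_cases)
    case (1 N x y)
    have "\<forall>(j, \<mu>, n)\<in>up_index. L (ket_up q j \<mu> n) = (q powr j) *\<^sub>R ket_up q j \<mu> n"
      using L by (simp add: is_L_q_def)
    from bspec[OF this V_up(1)[OF 1(2)]] show ?thesis
      unfolding 1(1) case_prod_conv V_up(2)[OF 1(2), symmetric] by (simp add: pow)
  next
    case (2 N x y)
    have "\<forall>(j, \<mu>, n)\<in>dn_index. L (ket_dn q j \<mu> n) = (q powr j) *\<^sub>R ket_dn q j \<mu> n"
      using L by (simp add: is_L_q_def)
    from bspec[OF this V_dn(1)[OF 2(2)]] show ?thesis
      unfolding 2(1) case_prod_conv V_dn(2)[OF 2(2), symmetric] by (simp add: pow)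
  qed
qed

text \<open>A diagonal symbol is multiplied by a function of \<open>s\<close>, because \<open>D\<close> grows linearly; on an
  off-diagonal one, of order $q^{2j}$, the linear growth of \<open>D\<close> costs a factor $q^j$.\<close>

lemma symb_dirac:
  assumes f: "symb q k f"
  shows "symb (sqrt q) k
    (\<lambda>i. (dirac_eig c1u c2u c1d c2d (i + k) - dirac_eig c1u c2u c1d c2d i) * f i)"
proof -
  let ?d = "dirac_eig c1u c2u c1d c2d"
  obtain \<eta> \<phi> \<psi> C where F: "sym_parts k \<eta> \<phi> \<psi>"
    "\<And>i. i \<in> V \<Longrightarrow> \<bar>f i - prodsym \<eta> \<phi> \<psi> i\<bar> \<le> C * q powi deg i"
    and fv: "\<And>i. i \<in> V \<Longrightarrow> i + k \<notin> V \<Longrightarrow> f i = 0"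
    by (rule symbE[OF f]) (rule that)
  obtain ks kN kx ky where k: "k = (ks, kN, kx, ky)" by (metis surj_pair)
  have C: "\<bar>f i - prodsym \<eta> \<phi> \<psi> i\<bar> \<le> \<bar>C\<bar> * q powi deg i" if "i \<in> V" for i
    using F(2)[OF that] mult_right_mono[OF abs_ge_self[of C], of "q powi deg i"] powi_pos[of "deg i"]
    by (auto intro: order_trans)
  have sq: "q powi n = sqrt q powi n * sqrt q powi n" for n
    using q_pos by (simp flip: power_int_mult_distrib)
  show ?thesis
  proof (cases "ks = 0")
    case True
    define \<delta> where "\<delta> = (\<lambda>s::int. if s = 1 then c1u * (kN / 2) else c1d * (kN / 2))"
    define M where "M = \<bar>c1u * (kN / 2)\<bar> + \<bar>c1d * (kN / 2)\<bar>"
    have M: "\<bar>\<delta> s\<bar> \<le> M" for s by (auto simp: \<delta>_def M_def)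
    have d: "?d (i + k) - ?d i = \<delta> (fst i)" for i
      using True by (cases i) (auto simp: k dirac_eig_def \<delta>_def algebra_simps add_divide_distrib)
    have "sym_parts k (\<lambda>s. \<delta> s * \<eta> s) \<phi> \<psi>" using F(1) True by (auto simp: k sym_parts_def)
    thus ?thesis
    proof (rule symb_intro)
      fix i assume i: "i \<in> V"
      have "(?d (i + k) - ?d i) * f i - prodsym (\<lambda>s. \<delta> s * \<eta> s) \<phi> \<psi> i = \<delta> (fst i) * (f i - prodsym \<eta> \<phi> \<psi> i)"
        unfolding d by (cases i) (simp add: prodsym_def algebra_simps)
      moreover have "\<bar>\<delta> (fst i)\<bar> * \<bar>f i - prodsym \<eta> \<phi> \<psi> i\<bar> \<le> M * (\<bar>C\<bar> * q powi deg i)"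
        using M C[OF i] by (intro mult_mono) (auto simp: M_def)
      moreover have "M * (\<bar>C\<bar> * q powi deg i) \<le> M * (\<bar>C\<bar> * sqrt q powi deg i)"
        using sqrt_q q_pos deg_nonneg[OF i] by (intro mult_left_mono power_int_mono) (auto simp: M_def)
      ultimately show "\<bar>(?d (i + k) - ?d i) * f i - prodsym (\<lambda>s. \<delta> s * \<eta> s) \<phi> \<psi> i\<bar> \<le> (M * \<bar>C\<bar>) * sqrt q powi deg i"
        by (simp add: abs_mult mult.assoc)
    qed (simp add: fv)
  next
    case False
    hence \<eta>: "\<eta> = (\<lambda>_. 0)" using F(1) by (auto simp: k sym_parts_def)
    hence fC: "\<bar>f i\<bar> \<le> \<bar>C\<bar> * q powi deg i" if "i \<in> V" for i
      using C[OF that] by (cases i) (simp add: prodsym_def)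
    obtain B where B: "0 \<le> B" "\<And>n. 0 \<le> n \<Longrightarrow> real_of_int n * sqrt q powi n \<le> B"
      using linear_times_powi_bounded[of "sqrt q"] sqrt_q q_pos by auto
    define a where "a = \<bar>c1u\<bar> + \<bar>c1d\<bar>"
    define b where "b = \<bar>c2u\<bar> + \<bar>c2d\<bar>"
    have ab: "0 \<le> a" "0 \<le> b" by (simp_all add: a_def b_def)
    have d: "\<bar>?d i\<bar> \<le> a * \<bar>real_of_int (deg i)\<bar> + b" for i
    proof -
      have "\<bar>c * (half N) + c'\<bar> \<le> \<bar>c\<bar> * \<bar>real_of_int N\<bar> + \<bar>c'\<bar>" for c c' :: real and N :: int
      proof -
        have "\<bar>c * (half N)\<bar> \<le> \<bar>c\<bar> * \<bar>real_of_int N\<bar>"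
          unfolding abs_mult by (intro mult_left_mono) auto
        thus ?thesis by linarith
      qed
      note * = this
      have **: "\<bar>c1u\<bar> * \<bar>real_of_int N\<bar> \<le> a * \<bar>real_of_int N\<bar>" "\<bar>c1d\<bar> * \<bar>real_of_int N\<bar> \<le> a * \<bar>real_of_int N\<bar>" for N :: int
        by (auto simp: a_def intro!: mult_right_mono)
      have "?d i = c1u * (real_of_int (deg i) / 2) + c2u \<or> ?d i = c1d * (real_of_int (deg i) / 2) + c2d"
        by (cases i) (simp add: dirac_eig_def)
      thus ?thesis using *[of c1u "deg i" c2u] *[of c1d "deg i" c2d] **[of "deg i"]
        unfolding b_def by (elim disjE) (simp only:, linarith)+
    qed
    \<comment> \<open>The eigenvalues at i + k and i are bounded by a (N + |kN|) + b and a N + b,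
      which add up to A + 2 a N.\<close>
    define A where "A = a * \<bar>real_of_int kN\<bar> + 2 * b"
    have A: "0 \<le> A" using ab by (simp add: A_def)
    have F0: "sym_parts k (\<lambda>_. 0) \<phi> \<psi>" using F(1) \<eta> by simp
    show ?thesis
    proof (rule symb_intro[OF F0])
      fix i assume i: "i \<in> V"
      have N: "0 \<le> deg i" by (rule deg_nonneg[OF i])
      have r: "0 < sqrt q powi deg i" "sqrt q powi deg i \<le> 1"
        using q_pos sqrt_q N by (auto intro!: power_int_le_one)
      have "\<bar>?d (i + k)\<bar> \<le> a * (real_of_int (deg i) + \<bar>real_of_int kN\<bar>) + b"
      proof -
        have "\<bar>real_of_int (deg (i + k))\<bar> \<le> real_of_int (deg i) + \<bar>real_of_int kN\<bar>"
          using N by (simp add: k)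
        hence "a * \<bar>real_of_int (deg (i + k))\<bar> \<le> a * (real_of_int (deg i) + \<bar>real_of_int kN\<bar>)"
          by (rule mult_left_mono[OF _ ab(1)])
        thus ?thesis using d[of "i + k"] by linarith
      qed
      moreover have "\<bar>?d i\<bar> \<le> a * real_of_int (deg i) + b" using d[of i] N by simp
      ultimately have "\<bar>?d (i + k) - ?d i\<bar> \<le> A + 2 * a * real_of_int (deg i)"
        unfolding A_def by (simp add: algebra_simps abs_le_iff)
      hence "\<bar>?d (i + k) - ?d i\<bar> * \<bar>f i\<bar> \<le> (A + 2 * a * real_of_int (deg i)) * (\<bar>C\<bar> * q powi deg i)"
        using fC[OF i] A ab N by (intro mult_mono) auto
      also have "\<dots> = (A * sqrt q powi deg i + 2 * a * (real_of_int (deg i) * sqrt q powi deg i)) * (\<bar>C\<bar> * sqrt q powi deg i)"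
        unfolding sq by (simp add: algebra_simps)
      also have "\<dots> \<le> (A * 1 + 2 * a * B) * (\<bar>C\<bar> * sqrt q powi deg i)"
        using r A ab B N by (intro mult_right_mono add_mono mult_left_mono) auto
      finally show "\<bar>(?d (i + k) - ?d i) * f i - prodsym (\<lambda>_. 0) \<phi> \<psi> i\<bar> \<le>
          ((A * 1 + 2 * a * B) * \<bar>C\<bar>) * sqrt q powi deg i"
        by (cases i) (simp add: prodsym_def abs_mult mult.assoc)
    qed (simp add: fv)
  qed
qed

lemma left_ops_dirac:
  assumes D: "dirac_operator q (\<lambda>j. c1u * j + c2u) (\<lambda>j. c1d * j + c2d) E D" and S: "S \<in> left_ops q"
  shows "\<exists>T\<in>left_ops (sqrt q). bounded_commutator_ext E D S T"
proof -
  obtain f k where S: "S = wshift f k" and f: "symb q k f" using S by (auto simp: left_ops_def)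
  let ?d = "dirac_eig c1u c2u c1d c2d"
  let ?f = "\<lambda>i. (?d (i + k) - ?d i) * f i"
  have s: "symb (sqrt q) k ?f" by (rule symb_dirac[OF f])
  have "selfadjoint_on E D" using D by (simp add: dirac_operator_def)
  hence "bounded_commutator_ext E D S (wshift ?f k)"
    unfolding S by (rule bounded_commutator_ext_wshift[OF _ e_dirac[OF D] symb_bounded[OF f order_refl q_less_1]
        symb_bounded[OF s sqrt_q]])
  thus ?thesis using s unfolding left_ops_def by blast
qed

end

theorem theorem7p4:
  fixes q :: real
    and rep :: "free_alg set \<Rightarrow> hpsi \<Rightarrow> hpsi"
    and J L D :: "spinor \<Rightarrow> spinor"
    and E :: "spinor set"
    and c1_up c2_up c1_dn c2_dn :: real
  assumes q: "0 < q" "q < 1"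
    and rep: "left_regular q rep"
    and J: "real_structure q J"
    and L: "is_L_q q L"
    and D: "dirac_operator q (\<lambda>j. c1_up * j + c2_up) (\<lambda>j. c1_dn * j + c2_dn) E D"
    and c: "c1_up \<noteq> 0" "c1_dn = - c1_up" "c2_dn = - c2_up + c1_up"
  shows "\<forall>x\<in>carrier (suq2 q). \<forall>y\<in>carrier (suq2 q).
           commutator (opposite_rep J rep x) (spinor_rep rep y) \<in> Idl\<^bsub>bounded_ops\<^esub> {L} \<and>
           (\<exists>T. bounded_commutator_ext E D (spinor_rep rep y) T \<and>
                commutator (opposite_rep J rep x) T \<in> Idl\<^bsub>bounded_ops\<^esub> {L})"
proof -
  interpret deformation q by standard (rule q)+
  let ?\<pi> = "\<lambda>l. spinor_rep rep (suq2_class q (gen l))" and ?\<pi>o = "\<lambda>l. opposite_rep J rep (suq2_class q (gen l))"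
  have sr: "star_representation q rep" using rep by (simp add: left_regular_def)
  have aJ: "antiunitary J" using J by (simp add: real_structure_def)
  have bL: "bounded_clin L"
    using L by (simp add: is_L_q_def positive_trace_class_def positive_op_def bounded_clinear_iff)
  have sD: "selfadjoint_on E D" using D by (simp add: dirac_operator_def)
  note left = generators_left[OF rep]
  \<comment> \<open>Used twice: with the sum for the generator itself and with the one for its
    commutator with \<open>D\<close>. Both are taken at the rate \<open>sqrt q\<close>.\<close>
  note comm = op_sums_commutator[OF bL refl _ _ right_ops_bounded[OF _ sqrt_q] left_ops_bounded[OF _ sqrt_q]
      commutator_left_right[OF bL e_L_q[OF L]]]
  \<comment> \<open>The adjoint keeps left type, and conjugation by \<open>J\<close> then reflects
    left type into right type.\<close>
  have right: "?\<pi>o l \<in> op_sums (right_ops (sqrt q))" for l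
  proof -
    have "adj (?\<pi> l) \<in> op_sums (left_ops q)"
      by (rule op_sums_adj[OF left left_ops_bounded[OF _ order_refl q_less_1] left_ops_adj])
    hence "(\<lambda>v. J (adj (?\<pi> l) (inv_into UNIV J v))) \<in> op_sums (right_ops q)"
      by (rule op_sums_conj[OF aJ _ left_ops_conj[OF J]])
    thus ?thesis
      by (subst opposite_rep_eq[OF sr]) (auto simp: suq2_carrier intro: op_sums_mono right_ops_mono)
  qed
  have "\<exists>T. bounded_commutator_ext E D (?\<pi> l) T \<and>
      (\<forall>l'. commutator (?\<pi>o l') (?\<pi> l) \<in> Idl\<^bsub>bounded_ops\<^esub> {L} \<and>
            commutator (?\<pi>o l') T \<in> Idl\<^bsub>bounded_ops\<^esub> {L})" for l
  proof -
    obtain T where T: "T \<in> op_sums (left_ops (sqrt q))"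
      "bounded_commutator_ext E D (?\<pi> l) T"
      using op_sums_commutator_ext[OF sD left left_ops_dirac[OF D]] by blast
    have "?\<pi> l \<in> op_sums (left_ops (sqrt q))"
      using op_sums_mono[OF left left_ops_mono] .
    thus ?thesis using T comm[OF right] by blast
  qed
  thus ?thesis by (rule commutators_from_generators[OF sr aJ bL sD refl])
qed

end
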